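(* Let $a>0$ with $a\neq1$. A map $\varphi:\mathbb{C}P^3\to\mathbb{C}P^3$ is an isometry of $(\mathbb{C}P^3,g_a)$ if and only if it is an isometry of $(\mathbb{C}P^3,g_1)$ that preserves the almost product structure $P$, i.e. $d\varphi\circ P=P\circ d\varphi$.
   Context: Identify $\mathbb{R}^8\cong\mathbb{C}^4\cong\mathbb{H}^2$ via $(z_1,z_2,z_3,z_4)\leftrightarrow(z_1+z_2j,\,z_3+z_4j)$ and let $i,j,k$ act by left multiplication. Let $\pi:\mathbb{S}^7\subset\mathbb{C}^4\to\mathbb{C}P^3$ be the Hopf fibration (vertical space at $q$ spanned by $iq$), $g_1$ the Fubini–Study metric for which $\pi$ is a Riemannian submersion from the round sphere of constant curvature $1$. Define $\mathcal{D}_1^2(\pi(q))=d\pi_q(\mathrm{span}\{jq,kq\})$ and $\mathcal{D}_2^4(\pi(q))=d\pi_q(\mathrm{span}\{iq,jq,kq\}^\perp)$ (orthogonal complement in $T_q\mathbb{S}^7$); these are well defined and $T\mathbb{C}P^3=\mathcal{D}_1^2\oplus\mathcal{D}_2^4$ is $g_1$-orthogonal. The almost product structure $P$ is $-\mathrm{Id}$ on $\mathcal{D}_1^2$ and $\mathrm{Id}$ on $\mathcal{D}_2^4$. For $a>0$ let $g_a$ be the metric equal to $g_1$ on $\mathcal{D}_1^2\times\mathcal{D}_1^2$, $a\,g_1$ on $\mathcal{D}_2^4\times\mathcal{D}_2^4$, and $0$ on $\mathcal{D}_1^2\times\mathcal{D}_2^4$. An isometry is a smooth metric-preserving map (no compatibility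 with any other structure is required). *)

theory Defs
  imports "HOL-Analysis.Analysis"
begin

section \<open>Smooth maps on open subsets of normed spaces\<close>

text \<open>For finite-dimensional \<open>'a\<close> and open \<open>S\<close>, \<open>Ck_on k S f\<close> says that all iterated directional
  derivatives of order at most \<open>k\<close> exist and are continuous on \<open>S\<close>.\<close>

primrec Ck_on :: "nat \<Rightarrow> 'a::real_normed_vector set \<Rightarrow> ('a \<Rightarrow> 'b::real_normed_vector) \<Rightarrow> bool" where
  "Ck_on 0 S f \<longleftrightarrow> continuous_on S f"
| "Ck_on (Suc k) S f \<longleftrightarrow>
     (\<forall>x\<in>S. f differentiable (at x)) \<and> (\<forall>v. Ck_on k S (\<lambda>x. frechet_derivative f (at x) v))"

definition smooth_on :: "'a::real_normed_vector set \<Rightarrow> ('a \<Rightarrow> 'b::real_normed_vector) \<Rightarrow> bool" where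
  "smooth_on S f \<longleftrightarrow> (\<forall>k. Ck_on k S f)"


section \<open>Complex projective 3-space as a smooth manifold\<close>

text \<open>Points are the complex lines in \<open>\<complex>\<^sup>4\<close>.  The map \<open>hopf\<close> is only meaningful away from \<open>0\<close>; its
  restriction to the unit sphere is the Hopf fibration.\<close>

typedef cp3 = "{L :: (complex^4) set. \<exists>z. z \<noteq> 0 \<and> L = range (\<lambda>c. c *s z)}"
  by (rule exI[of _ "range (\<lambda>c. c *s (1::complex^4))"]) (auto intro!: exI[of _ 1])

definition hopf :: "complex^4 \<Rightarrow> cp3" where
  "hopf z = Abs_cp3 (range (\<lambda>c. c *s z))"

text \<open>The four affine charts, indexed by \<open>i :: 4\<close>.  The type \<open>4\<close> is \<open>\<int>/4\<close> (its numeral \<open>4\<close> is \<open>0\<close>),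
  so the index arithmetic below is cyclic and the affine coordinates of chart \<open>i\<close> are listed
  starting from the homogeneous coordinate after \<open>i\<close>.\<close>

definition affine_coords :: "4 \<Rightarrow> complex^4 \<Rightarrow> complex^3" where
  "affine_coords i z = vector [z $ (i+1) / z $ i, z $ (i+2) / z $ i, z $ (i+3) / z $ i]"

definition chart_dom :: "4 \<Rightarrow> cp3 set" where
  "chart_dom i = {hopf z | z. z $ i \<noteq> 0}"

definition chart :: "4 \<Rightarrow> cp3 \<Rightarrow> complex^3" where
  "chart i p = affine_coords i (SOME z. z \<noteq> 0 \<and> hopf z = p)"

definition chart_inv :: "4 \<Rightarrow> complex^3 \<Rightarrow> cp3" where
  "chart_inv i w = hopf (\<chi> k. if k = i then 1 else if k = i + 1 then w $ 1
                              else if k = i + 2 then w $ 2 else w $ 3)"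

text \<open>Openness of the first set below, for all \<open>i\<close> and \<open>j\<close>, amounts to continuity of the map.\<close>

definition smooth_map :: "(cp3 \<Rightarrow> cp3) \<Rightarrow> bool" where
  "smooth_map \<phi> \<longleftrightarrow> (\<forall>i j.
     (let S = chart i ` (chart_dom i \<inter> \<phi> -` chart_dom j)
      in open S \<and> smooth_on S (chart j \<circ> \<phi> \<circ> chart_inv i)))"


section \<open>Tangent vectors and differentials\<close>

text \<open>A tangent vector at \<open>p\<close> is given by its components in all charts around \<open>p\<close>, related by the
  derivatives of the transition maps; the components in charts not containing \<open>p\<close> are set to \<open>0\<close>.\<close>

type_synonym tvec = "complex^3^4"

definition tangent_space :: "cp3 \<Rightarrow> tvec set" where
  "tangent_space p = {X.
     (\<forall>i. p \<notin> chart_dom i \<longrightarrow> X $ i = 0) \<and>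
     (\<forall>i j. p \<in> chart_dom i \<and> p \<in> chart_dom j \<longrightarrow>
        X $ j = frechet_derivative (chart j \<circ> chart_inv i) (at (chart i p)) (X $ i))}"

text \<open>The differential of \<open>\<phi>\<close> at \<open>p\<close>.  The chart used at \<open>p\<close> is immaterial for smooth \<open>\<phi>\<close> and
  \<open>X \<in> tangent_space p\<close>.\<close>

definition dmap :: "(cp3 \<Rightarrow> cp3) \<Rightarrow> cp3 \<Rightarrow> tvec \<Rightarrow> tvec" where
  "dmap \<phi> p X = (let i = (SOME i. p \<in> chart_dom i) in
     (\<chi> j. if \<phi> p \<in> chart_dom j
           then frechet_derivative (chart j \<circ> \<phi> \<circ> chart_inv i) (at (chart i p)) (X $ i) else 0))"

definition sphere_tangent :: "complex^4 \<Rightarrow> (complex^4) set" where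
  "sphere_tangent q = {v. orthogonal q v}"

text \<open>On \<open>sphere_tangent q\<close> this is the differential at \<open>q\<close> of the Hopf fibration on the sphere.\<close>

definition dhopf :: "complex^4 \<Rightarrow> complex^4 \<Rightarrow> tvec" where
  "dhopf q v = (\<chi> j. if hopf q \<in> chart_dom j
                     then frechet_derivative (chart j \<circ> hopf) (at q) v else 0)"


section \<open>Quaternions acting on the left\<close>

text \<open>The pair \<open>(a, b)\<close> stands for the quaternion \<open>a + b j\<close>; the product comes from
  \<open>j a = cnj a j\<close> and \<open>j j = -1\<close>.\<close>

type_synonym quat = "complex \<times> complex"

definition quat_mult :: "quat \<Rightarrow> quat \<Rightarrow> quat" where
  "quat_mult x y = (fst x * fst y - snd x * cnj (snd y), fst x * snd y + snd x * cnj (fst y))"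

definition quat_i :: quat where "quat_i = (\<i>, 0)"
definition quat_j :: quat where "quat_j = (0, 1)"
definition quat_k :: quat where "quat_k = quat_mult quat_i quat_j"

text \<open>Left multiplication on \<open>\<complex>\<^sup>4\<close> identified with pairs of quaternions by
  \<open>(z\<^sub>1, z\<^sub>2, z\<^sub>3, z\<^sub>4) \<mapsto> (z\<^sub>1 + z\<^sub>2 j, z\<^sub>3 + z\<^sub>4 j)\<close>.\<close>

definition lmul :: "quat \<Rightarrow> complex^4 \<Rightarrow> complex^4" where
  "lmul h z = (let x = quat_mult h (z $ 1, z $ 2); y = quat_mult h (z $ 3, z $ 4)
     in (\<chi> k. if k = 1 then fst x else if k = 2 then snd x else if k = 3 then fst y else snd y))"


section \<open>The metrics and the almost product structure\<close>

definition horizontal :: "complex^4 \<Rightarrow> (complex^4) set" where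
  "horizontal q = sphere_tangent q \<inter> orthogonal_comp (span {lmul quat_i q})"

text \<open>The metric that makes the Hopf fibration a Riemannian submersion from the round unit sphere.
  The value does not depend on the point \<open>q\<close> of the fibre.\<close>

definition fubini_study :: "cp3 \<Rightarrow> tvec \<Rightarrow> tvec \<Rightarrow> real" where
  "fubini_study p X Y = (THE r. \<exists>q\<in>sphere 0 1. \<exists>u\<in>horizontal q. \<exists>v\<in>horizontal q.
     hopf q = p \<and> dhopf q u = X \<and> dhopf q v = Y \<and> r = u \<bullet> v)"

text \<open>The unions over the fibre are unions of equal sets.\<close>

definition dist1 :: "cp3 \<Rightarrow> tvec set" where
  "dist1 p = (\<Union>q\<in>{q \<in> sphere 0 1. hopf q = p}. dhopf q ` span {lmul quat_j q, lmul quat_k q})"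

definition dist2 :: "cp3 \<Rightarrow> tvec set" where
  "dist2 p = (\<Union>q\<in>{q \<in> sphere 0 1. hopf q = p}.
     dhopf q ` (sphere_tangent q \<inter>
       orthogonal_comp (span {lmul quat_i q, lmul quat_j q, lmul quat_k q})))"

definition prod_struct :: "cp3 \<Rightarrow> tvec \<Rightarrow> tvec" where
  "prod_struct p X = (THE Y. \<exists>X1\<in>dist1 p. \<exists>X2\<in>dist2 p. X = X1 + X2 \<and> Y = - X1 + X2)"

definition metric_a :: "real \<Rightarrow> cp3 \<Rightarrow> tvec \<Rightarrow> tvec \<Rightarrow> real" where
  "metric_a a p X Y = (THE r. \<exists>X1\<in>dist1 p. \<exists>X2\<in>dist2 p. \<exists>Y1\<in>dist1 p. \<exists>Y2\<in>dist2 p.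
     X = X1 + X2 \<and> Y = Y1 + Y2 \<and> r = fubini_study p X1 Y1 + a * fubini_study p X2 Y2)"

definition isometry :: "(cp3 \<Rightarrow> tvec \<Rightarrow> tvec \<Rightarrow> real) \<Rightarrow> (cp3 \<Rightarrow> cp3) \<Rightarrow> bool" where
  "isometry g \<phi> \<longleftrightarrow> smooth_map \<phi> \<and>
     (\<forall>p. \<forall>X\<in>tangent_space p. \<forall>Y\<in>tangent_space p. g (\<phi> p) (dmap \<phi> p X) (dmap \<phi> p Y) = g p X Y)"

definition preserves_prod_struct :: "(cp3 \<Rightarrow> cp3) \<Rightarrow> bool" where
  "preserves_prod_struct \<phi> \<longleftrightarrow>
     (\<forall>p. \<forall>X\<in>tangent_space p. dmap \<phi> p (prod_struct p X) = prod_struct (\<phi> p) (dmap \<phi> p X))"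

end

(* The forward direction is local: it suffices that the differential of a g_a-isometry maps the vertical
   distribution D_1 into D_1, for then it also preserves the orthogonal complement D_2, on which g_a is
   a multiple of g_1.  That D_1 is determined by g_a is read off the curvature.  Around each point there
   are coordinates (from affine coordinates by a quadratic change of variables) in which the first
   derivatives of g_a vanish, so that its second derivatives give the curvature form
   K(x, u) = <R(x, u) u, x>, and the second and third derivatives of an isometry drop out of K.  With x = (U, X)
   and u = (V, Y) split into D_1 and D_2 components,
     K(x, u) = 4 p^2 + (|U|^2 |Y|^2 + |X|^2 |V|^2 - 2 <U, V> <X, Y>) / a
               + (4 a - 3) (|X|^2 |Y|^2 - <X, Y>^2) + 3 q^2 + (12 - 6 / a) p q
   where p = <i U, V>, q = <i X, Y> and all products are those of g_1.  For a /= 1 the vectors of D_1 are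
   exactly those x for which u |-> K(x, u) is a multiple of |x|^2 |u|^2 - <x, u>^2 (taken in g_a) plus a
   form of rank at most one.  Ricci curvature alone would not do: the metric with a = 2 is Einstein. *)

theory Submission
  imports Defs "HOL-Real_Asymp.Real_Asymp"
begin

section \<open>Maps of class \<open>C\<^sup>k\<close>\<close>

text \<open>Affine coordinates built on a frame \<open>q\<close>, \<open>J q\<close>,
  \<open>r\<close>, \<open>J r\<close> give the metric the same formula about every point. An
  isometry therefore becomes locally a map between two copies of one metric on \<complex>^3, and the
  forms K at its two ends are literally equal. Neither connection nor curvature tensor is formed:
  the quotient (metric - its value at 0) / r^2 along rays has an explicit formula, continuous up to
  r = 0, and its value there is all that enters. The test for D_1 has to survive every linear
  bijection that preserves the metric and K, so its constants are existentially quantified. For a =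
  1 it is void: then K = |x|^2 |u|^2 - <x, u>^2 + 3 (p + q)^2, and every x passes. For a /= 1 and X
  /= 0 the one available square is used up by 3 q^2; matching what remains in a vertical direction
  forces the factor 1 / a^2, and in horizontal directions this factor would require 4 a - 3 =
  1.\<close>

lemma Ck_on_subset: "Ck_on k S f \<Longrightarrow> T \<subseteq> S \<Longrightarrow> Ck_on k T f"
proof (induction k arbitrary: f)
  case 0 then show ?case using continuous_on_subset by auto
next
  case (Suc k) then show ?case by auto
qed

lemma frechet_derivative_cong_open:
  assumes "open S" "x \<in> S" "\<And>y. y \<in> S \<Longrightarrow> f y = g y" "f differentiable (at x)"
  shows "g differentiable (at x)" "frechet_derivative g (at x) = frechet_derivative f (at x)"
proof -
  have "(f has_derivative frechet_derivative f (at x)) (at x)"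
    using assms(4) frechet_derivative_works by blast
  then have "(g has_derivative frechet_derivative f (at x)) (at x)"
    using has_derivative_transform_within_open assms(1-3) by blast
  then show "g differentiable (at x)" "frechet_derivative g (at x) = frechet_derivative f (at x)"
    using frechet_derivative_at differentiable_def by metis+
qed

lemma Ck_on_cong:
  assumes "open S"
  shows "Ck_on k S f \<Longrightarrow> (\<And>y. y \<in> S \<Longrightarrow> f y = g y) \<Longrightarrow> Ck_on k S g"
proof (induction k arbitrary: f g)
  case 0
  then show ?case by (simp cong: continuous_on_cong)
next
  case (Suc k)
  have d: "g differentiable (at x)" "frechet_derivative g (at x) = frechet_derivative f (at x)"
    if "x \<in> S" for x
    using frechet_derivative_cong_open[OF assms that, of f g] Suc.prems that by auto
  have "Ck_on k S (\<lambda>x. frechet_derivative g (at x) v)" for v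
    using Suc.IH[of "\<lambda>x. frechet_derivative f (at x) v" "\<lambda>x. frechet_derivative g (at x) v"] Suc.prems(1) d
    by simp
  then show ?case using d by simp
qed

lemma Ck_on_SucD: "Ck_on (Suc k) S f \<Longrightarrow> Ck_on k S f"
proof (induction k arbitrary: f)
  case 0
  then show ?case
    by (auto intro!: continuous_at_imp_continuous_on differentiable_imp_continuous_within)
next
  case (Suc k)
  then show ?case by (metis Ck_on.simps(2))
qed

text \<open>The closure rules below all go through this form: on an open set any explicit derivative
  may stand in for \<open>frechet_derivative\<close>, because derivatives are unique and only values
  on \<open>S\<close> count.\<close>

lemma Ck_on_SucI:
  assumes "open S" "\<And>x. x \<in> S \<Longrightarrow> (f has_derivative f' x) (at x)"
    "\<And>v. Ck_on k S (\<lambda>x. f' x v)"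
  shows "Ck_on (Suc k) S f"
proof -
  have d: "frechet_derivative f (at x) = f' x" if "x \<in> S" for x
    using assms(2)[OF that] frechet_derivative_at by metis
  have "Ck_on k S (\<lambda>x. frechet_derivative f (at x) v)" for v
    by (rule Ck_on_cong[OF assms(1) assms(3)[of v]]) (simp add: d)
  then show ?thesis using assms(2) by (auto simp: differentiable_def)
qed

lemma Ck_on_Suc_has_derivative:
  "Ck_on (Suc k) S f \<Longrightarrow> x \<in> S \<Longrightarrow> (f has_derivative frechet_derivative f (at x)) (at x)"
  by (simp add: frechet_derivative_works)

lemma Ck_on_const [simp]: "Ck_on k S (\<lambda>x. c)"
proof (induction k arbitrary: c)
  case (Suc k) then show ?case by simp
qed simp

lemma Ck_on_bounded_linear:
  assumes "open S" "bounded_linear L"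
  shows "Ck_on k S f \<Longrightarrow> Ck_on k S (\<lambda>x. L (f x))"
proof (induction k arbitrary: f)
  case 0
  then show ?case using assms(2) by (simp add: bounded_linear.continuous_on)
next
  case (Suc k)
  show ?case
  proof (rule Ck_on_SucI[OF assms(1)])
    show "((\<lambda>x. L (f x)) has_derivative (\<lambda>v. L (frechet_derivative f (at x) v))) (at x)" if "x \<in> S" for x
      using bounded_linear.has_derivative[OF assms(2) Ck_on_Suc_has_derivative[OF Suc.prems that]] .
    show "Ck_on k S (\<lambda>x. L (frechet_derivative f (at x) v))" for v
      using Suc by simp
  qed
qed

lemma Ck_on_linear:
  assumes "open S" "bounded_linear L"
  shows "Ck_on k S L"
proof -
  have "Ck_on k S (\<lambda>x. x)"
  proof (cases k)
    case (Suc n)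
    show ?thesis unfolding Suc by (rule Ck_on_SucI[OF assms(1), of _ "\<lambda>x v. v"]) auto
  qed simp
  then show ?thesis using Ck_on_bounded_linear[OF assms] by auto
qed

lemma Ck_on_add:
  assumes "open S"
  shows "Ck_on k S f \<Longrightarrow> Ck_on k S g \<Longrightarrow> Ck_on k S (\<lambda>x. f x + g x)"
proof (induction k arbitrary: f g)
  case 0
  then show ?case by (simp add: continuous_on_add)
next
  case (Suc k)
  show ?case
  proof (rule Ck_on_SucI[OF assms(1)])
    show "((\<lambda>x. f x + g x) has_derivative
        (\<lambda>v. frechet_derivative f (at x) v + frechet_derivative g (at x) v)) (at x)" if "x \<in> S" for x
      using Suc.prems that by (intro has_derivative_add Ck_on_Suc_has_derivative)
    show "Ck_on k S (\<lambda>x. frechet_derivative f (at x) v + frechet_derivative g (at x) v)" for v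
      using Suc by simp
  qed
qed

lemma Ck_on_sum:
  assumes "open S" "finite A" "\<And>i. i \<in> A \<Longrightarrow> Ck_on k S (f i)"
  shows "Ck_on k S (\<lambda>x. \<Sum>i\<in>A. f i x)"
  using assms(2,3) by (induction A rule: finite_induct) (simp_all add: Ck_on_add[OF assms(1)])

lemma Ck_on_bilinear:
  assumes "open S" "bounded_bilinear B"
  shows "Ck_on k S f \<Longrightarrow> Ck_on k S g \<Longrightarrow> Ck_on k S (\<lambda>x. B (f x) (g x))"
proof (induction k arbitrary: f g)
  case 0
  then show ?case using bounded_bilinear.continuous_on[OF assms(2)] by simp
next
  case (Suc k)
  show ?case
  proof (rule Ck_on_SucI[OF assms(1)])
    show "((\<lambda>x. B (f x) (g x)) has_derivative
        (\<lambda>v. B (f x) (frechet_derivative g (at x) v) + B (frechet_derivative f (at x) v) (g x))) (at x)"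
      if "x \<in> S" for x
      using bounded_bilinear.FDERIV[OF assms(2) Ck_on_Suc_has_derivative[OF Suc.prems(1) that]
          Ck_on_Suc_has_derivative[OF Suc.prems(2) that]] .
    show "Ck_on k S (\<lambda>x. B (f x) (frechet_derivative g (at x) v) + B (frechet_derivative f (at x) v) (g x))" for v
      using Suc.IH Suc.prems Ck_on_SucD[OF Suc.prems(1)] Ck_on_SucD[OF Suc.prems(2)]
      by (intro Ck_on_add[OF assms(1)]) simp_all
  qed
qed

text \<open>\<open>Ck_on\<close> controls derivatives in a fixed direction, but in the chain rule
  the direction fed to the derivative of \<open>g\<close> moves with x. Expanding it in the basis of
  the intermediate space makes the directions constant, hence the finite-dimensional type
  there.\<close>

lemma Ck_on_compose:
  fixes f :: "'a::real_normed_vector \<Rightarrow> 'b::euclidean_space"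
  assumes "open S" "open T"
  shows "Ck_on k S f \<Longrightarrow> Ck_on k T g \<Longrightarrow> f ` S \<subseteq> T \<Longrightarrow> Ck_on k S (\<lambda>x. g (f x))"
proof (induction k arbitrary: g)
  case 0
  then show ?case by (auto intro: continuous_on_compose2)
next
  case (Suc k)
  show ?case
  proof (rule Ck_on_SucI[OF assms(1)])
    show "((\<lambda>x. g (f x)) has_derivative
       (\<lambda>v. \<Sum>b\<in>Basis. (frechet_derivative f (at x) v \<bullet> b) *\<^sub>R frechet_derivative g (at (f x)) b)) (at x)"
      if "x \<in> S" for x
    proof -
      have g: "(g has_derivative frechet_derivative g (at (f x))) (at (f x))"
        using Suc.prems that by (intro Ck_on_Suc_has_derivative[of k T]) auto
      have l: "linear (frechet_derivative g (at (f x)))"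
        using g has_derivative_linear by blast
      have rep: "frechet_derivative g (at (f x)) w = (\<Sum>b\<in>Basis. (w \<bullet> b) *\<^sub>R frechet_derivative g (at (f x)) b)" for w
        by (subst euclidean_representation[of w, symmetric]) (simp add: linear_sum[OF l] linear_scale[OF l])
      then show ?thesis
        using has_derivative_compose[OF Ck_on_Suc_has_derivative[OF Suc.prems(1) that] g]
        by (simp only: rep[symmetric])
    qed
    show "Ck_on k S (\<lambda>x. \<Sum>b\<in>Basis. (frechet_derivative f (at x) v \<bullet> b) *\<^sub>R frechet_derivative g (at (f x)) b)" for v
    proof (rule Ck_on_sum[OF assms(1) finite_Basis])
      fix b :: 'b assume "b \<in> Basis"
      have "Ck_on k S (\<lambda>x. frechet_derivative g (at (f x)) b)"
        using Suc.IH[of "\<lambda>y. frechet_derivative g (at y) b"] Suc.prems Ck_on_SucD[OF Suc.prems(1)] by simp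
      moreover have "Ck_on k S (\<lambda>x. frechet_derivative f (at x) v \<bullet> b)"
        using Suc.prems(1) by (intro Ck_on_bounded_linear[OF assms(1) bounded_linear_inner_left]) simp
      ultimately show "Ck_on k S (\<lambda>x. (frechet_derivative f (at x) v \<bullet> b) *\<^sub>R frechet_derivative g (at (f x)) b)"
        by (intro Ck_on_bilinear[OF assms(1) bounded_bilinear_scaleR])
    qed
  qed
qed

lemma Ck_on_inverse:
  fixes f :: "'a::real_normed_vector \<Rightarrow> 'b::real_normed_field"
  assumes "open S" "\<And>x. x \<in> S \<Longrightarrow> f x \<noteq> 0"
  shows "Ck_on k S f \<Longrightarrow> Ck_on k S (\<lambda>x. inverse (f x))"
proof (induction k)
  case 0
  then show ?case using assms by (auto intro!: continuous_on_inverse)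
next
  case (Suc k)
  show ?case
  proof (rule Ck_on_SucI[OF assms(1)])
    show "((\<lambda>x. inverse (f x)) has_derivative
       (\<lambda>v. - (inverse (f x) * frechet_derivative f (at x) v * inverse (f x)))) (at x)" if "x \<in> S" for x
      using Deriv.has_derivative_inverse[OF assms(2)[OF that] Ck_on_Suc_has_derivative[OF Suc.prems that]] .
    show "Ck_on k S (\<lambda>x. - (inverse (f x) * frechet_derivative f (at x) v * inverse (f x)))" for v
      using Suc.IH[OF Ck_on_SucD[OF Suc.prems]] Suc.prems
      by (intro Ck_on_bounded_linear[OF assms(1) bounded_linear_minus[OF bounded_linear_ident]]
            Ck_on_bilinear[OF assms(1) bounded_bilinear_mult]) simp_all
  qed
qed

lemma bounded_linear_axis: "bounded_linear (axis i :: 'b::euclidean_space \<Rightarrow> 'b ^ 'n)"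
  by (rule bounded_linearI'[OF _ , of _]) (auto simp: axis_def vec_eq_iff)

lemma sum_axis_nth: "(\<Sum>i\<in>UNIV. axis i (x $ i)) = (x :: 'b::euclidean_space ^ 'n)"
  by (simp add: vec_eq_iff axis_def if_distrib[of "\<lambda>y. y $ _"] sum.If_cases)

lemma Ck_on_vec:
  fixes f :: "'a::real_normed_vector \<Rightarrow> 'b::euclidean_space ^ 'n"
  assumes "open S" "\<And>i. Ck_on k S (\<lambda>x. f x $ i)"
  shows "Ck_on k S f"
proof -
  have "Ck_on k S (\<lambda>x. \<Sum>i\<in>UNIV. axis i (f x $ i))"
    by (intro Ck_on_sum assms Ck_on_bounded_linear[OF assms(1) bounded_linear_axis]) auto
  then show ?thesis by (simp only: sum_axis_nth)
qed

text \<open>Both iterated derivatives are recovered from the same second difference quotient by applying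
  the mean value theorem in either order.\<close>

lemma second_difference_mvt:
  fixes f :: "'a::real_normed_vector \<Rightarrow> real"
  assumes "Ck_on 2 S f" "0 < s"
    and sub: "\<And>\<xi> \<eta>. 0 \<le> \<xi> \<Longrightarrow> \<xi> \<le> s \<Longrightarrow> 0 \<le> \<eta> \<Longrightarrow> \<eta> \<le> s \<Longrightarrow> x + \<xi> *\<^sub>R u + \<eta> *\<^sub>R v \<in> S"
  obtains \<xi> \<eta> where "0 \<le> \<xi>" "\<xi> \<le> s" "0 \<le> \<eta>" "\<eta> \<le> s"
    "f (x + s *\<^sub>R u + s *\<^sub>R v) - f (x + s *\<^sub>R u) - f (x + s *\<^sub>R v) + f x =
      s\<^sup>2 * frechet_derivative (\<lambda>y. frechet_derivative f (at y) u) (at (x + \<xi> *\<^sub>R u + \<eta> *\<^sub>R v)) v"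
proof -
  let ?fu = "\<lambda>y. frechet_derivative f (at y) u"
  have C: "Ck_on (Suc (Suc 0)) S f" using assms(1) by (simp add: numeral_2_eq_2)
  have C1: "Ck_on (Suc 0) S ?fu" using C by simp
  have d: "(f has_derivative frechet_derivative f (at y)) (at y)" if "y \<in> S" for y
    using Ck_on_Suc_has_derivative[OF C that] .
  have du: "(?fu has_derivative frechet_derivative ?fu (at y)) (at y)" if "y \<in> S" for y
    using Ck_on_Suc_has_derivative[OF C1 that] .
  \<comment> \<open>The vanishing summand makes both terms instances of the derivative fact
    \<open>*\<close> below, for t = s and t = 0.\<close>
  define \<phi> where "\<phi> r = f (x + r *\<^sub>R u + s *\<^sub>R v) - f (x + r *\<^sub>R u + 0 *\<^sub>R v)" for r
  have d\<phi>: "(\<phi> has_real_derivative (?fu (x + r *\<^sub>R u + s *\<^sub>R v) - ?fu (x + r *\<^sub>R u + 0 *\<^sub>R v))) (at r)"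
    if "0 \<le> r" "r \<le> s" for r
  proof -
    have *: "((\<lambda>r. f (x + r *\<^sub>R u + t *\<^sub>R v)) has_real_derivative ?fu (x + r *\<^sub>R u + t *\<^sub>R v)) (at r)"
      if "0 \<le> t" "t \<le> s" for t
    proof -
      have m: "x + r *\<^sub>R u + t *\<^sub>R v \<in> S" using sub \<open>0 \<le> r\<close> \<open>r \<le> s\<close> that by auto
      have "((\<lambda>r. x + r *\<^sub>R u + t *\<^sub>R v) has_derivative (\<lambda>h. h *\<^sub>R u)) (at r)"
        by (auto intro!: derivative_eq_intros)
      from has_derivative_compose[OF this d[OF m]] show ?thesis
        using linear_scale[OF has_derivative_linear[OF d[OF m]]]
        by (simp add: has_field_derivative_def mult_commute_abs)
    qed
    show ?thesis unfolding \<phi>_def using assms(2) by (intro derivative_intros *) auto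
  qed
  obtain \<xi> where \<xi>: "0 < \<xi>" "\<xi> < s" "\<phi> s - \<phi> 0 = (s - 0) * (?fu (x + \<xi> *\<^sub>R u + s *\<^sub>R v) - ?fu (x + \<xi> *\<^sub>R u + 0 *\<^sub>R v))"
    using MVT2[OF assms(2) d\<phi>] by blast
  define \<psi> where "\<psi> t = ?fu (x + \<xi> *\<^sub>R u + t *\<^sub>R v)" for t
  have d\<psi>: "(\<psi> has_real_derivative frechet_derivative ?fu (at (x + \<xi> *\<^sub>R u + t *\<^sub>R v)) v) (at t)"
    if "0 \<le> t" "t \<le> s" for t
  proof -
    have m: "x + \<xi> *\<^sub>R u + t *\<^sub>R v \<in> S" using sub \<xi> that by auto
    have "((\<lambda>t. x + \<xi> *\<^sub>R u + t *\<^sub>R v) has_derivative (\<lambda>h. h *\<^sub>R v)) (at t)"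
      by (auto intro!: derivative_eq_intros)
    from has_derivative_compose[OF this du[OF m]] show ?thesis
      using linear_scale[OF has_derivative_linear[OF du[OF m]]]
      by (simp add: has_field_derivative_def mult_commute_abs \<psi>_def[abs_def])
  qed
  obtain \<eta> where \<eta>: "0 < \<eta>" "\<eta> < s" "\<psi> s - \<psi> 0 = (s - 0) * frechet_derivative ?fu (at (x + \<xi> *\<^sub>R u + \<eta> *\<^sub>R v)) v"
    using MVT2[OF assms(2) d\<psi>] by blast
  show ?thesis
    by (rule that[of \<xi> \<eta>]) (use \<xi> \<eta> in \<open>auto simp: \<phi>_def \<psi>_def power2_eq_square\<close>)
qed

text \<open>Schwarz's theorem: for steps tending to 0 the equal difference quotients are values of
  the two iterated derivatives at points tending to x, and both derivatives are continuous
  there.\<close>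

lemma Ck_on_symmetric_real:
  fixes f :: "'a::real_normed_vector \<Rightarrow> real"
  assumes "open S" "x \<in> S" and C: "Ck_on 2 S f"
  shows "frechet_derivative (\<lambda>y. frechet_derivative f (at y) u) (at x) v =
         frechet_derivative (\<lambda>y. frechet_derivative f (at y) v) (at x) u" (is "?P x = ?Q x")
proof -
  have cont: "continuous_on S (\<lambda>x. frechet_derivative (\<lambda>y. frechet_derivative f (at y) u) (at x) v)" for u v
    using C by (simp add: numeral_2_eq_2)
  have m0: "\<forall>\<^sub>F p in at (0::real \<times> real). x + fst p *\<^sub>R u + snd p *\<^sub>R v \<in> S"
  proof -
    have "((\<lambda>p. x + fst p *\<^sub>R u + snd p *\<^sub>R v) \<longlongrightarrow> x + fst (0::real\<times>real) *\<^sub>R u + snd (0::real\<times>real) *\<^sub>R v) (at 0)"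
      by (intro tendsto_intros)
    then show ?thesis using topological_tendstoD[OF _ assms(1)] assms(2) by fastforce
  qed
  obtain d where d: "d > 0" "\<And>\<xi> \<eta>. \<bar>\<xi>\<bar> < d \<Longrightarrow> \<bar>\<eta>\<bar> < d \<Longrightarrow> x + \<xi> *\<^sub>R u + \<eta> *\<^sub>R v \<in> S"
  proof -
    obtain e where e: "e > 0" "\<And>p::real\<times>real. p \<noteq> 0 \<Longrightarrow> dist p 0 < e \<Longrightarrow> x + fst p *\<^sub>R u + snd p *\<^sub>R v \<in> S"
      using m0 unfolding eventually_at by auto
    show ?thesis
    proof (rule that[of "e/2"])
      fix \<xi> \<eta> assume *: "\<bar>\<xi>\<bar> < e/2" "\<bar>\<eta>\<bar> < e/2"
      have "dist (\<xi>, \<eta>) 0 \<le> \<bar>\<xi>\<bar> + \<bar>\<eta>\<bar>"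
        using norm_Pair_le[of \<xi> \<eta>] by (simp add: dist_norm)
      then have "dist (\<xi>, \<eta>) 0 < e" using * by linarith
      then show "x + \<xi> *\<^sub>R u + \<eta> *\<^sub>R v \<in> S"
        using e(2)[of "(\<xi>, \<eta>)"] assms(2) by (cases "(\<xi>, \<eta>) = 0") (auto simp: zero_prod_def)
    qed (use e in auto)
  qed
  \<comment> \<open>The offset 2 makes the steps strictly smaller than d already at n = 0.\<close>
  define s where "s n = d / (real n + 2)" for n
  have s: "0 < s n" "s n < d" for n
    using d(1) by (auto simp: s_def field_simps intro: add_pos_nonneg) 
  have s0: "s \<longlonglongrightarrow> 0" unfolding s_def by real_asymp
  have ex: "\<exists>y z. dist y x \<le> s n * (norm u + norm v) \<and> dist z x \<le> s n * (norm u + norm v) \<and> ?P y = ?Q z" for n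
  proof -
    have m: "x + \<xi> *\<^sub>R u + \<eta> *\<^sub>R v \<in> S" "x + \<eta> *\<^sub>R v + \<xi> *\<^sub>R u \<in> S"
      if "0 \<le> \<xi>" "\<xi> \<le> s n" "0 \<le> \<eta>" "\<eta> \<le> s n" for \<xi> \<eta>
      using d(2)[of \<xi> \<eta>] that s[of n] by (auto simp: algebra_simps)
    have near: "dist (x + \<xi> *\<^sub>R u + \<eta> *\<^sub>R v) x \<le> s n * (norm u + norm v)"
      if "0 \<le> \<xi>" "\<xi> \<le> s n" "0 \<le> \<eta>" "\<eta> \<le> s n" for \<xi> \<eta> and u v :: 'a
    proof -
      have "dist (x + \<xi> *\<^sub>R u + \<eta> *\<^sub>R v) x = norm (\<xi> *\<^sub>R u + \<eta> *\<^sub>R v)"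
        by (simp add: dist_norm algebra_simps)
      also have "\<dots> \<le> \<xi> * norm u + \<eta> * norm v"
        using norm_triangle_ineq[of "\<xi> *\<^sub>R u" "\<eta> *\<^sub>R v"] that by simp
      also have "\<dots> \<le> s n * norm u + s n * norm v"
        using that by (intro add_mono mult_right_mono) auto
      finally show ?thesis by (simp add: algebra_simps)
    qed
    obtain \<xi> \<eta> where 1: "0 \<le> \<xi>" "\<xi> \<le> s n" "0 \<le> \<eta>" "\<eta> \<le> s n"
      "f (x + s n *\<^sub>R u + s n *\<^sub>R v) - f (x + s n *\<^sub>R u) - f (x + s n *\<^sub>R v) + f x = (s n)\<^sup>2 * ?P (x + \<xi> *\<^sub>R u + \<eta> *\<^sub>R v)"
      by (rule second_difference_mvt[OF C s(1)[of n] m(1)])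
    obtain \<xi>' \<eta>' where 2: "0 \<le> \<xi>'" "\<xi>' \<le> s n" "0 \<le> \<eta>'" "\<eta>' \<le> s n"
      "f (x + s n *\<^sub>R v + s n *\<^sub>R u) - f (x + s n *\<^sub>R v) - f (x + s n *\<^sub>R u) + f x = (s n)\<^sup>2 * ?Q (x + \<xi>' *\<^sub>R v + \<eta>' *\<^sub>R u)"
      by (rule second_difference_mvt[OF C s(1)[of n] m(2)])
    have sw: "x + s n *\<^sub>R v + s n *\<^sub>R u = x + s n *\<^sub>R u + s n *\<^sub>R v" by (simp add: algebra_simps)
    have "(s n)\<^sup>2 * ?P (x + \<xi> *\<^sub>R u + \<eta> *\<^sub>R v) = (s n)\<^sup>2 * ?Q (x + \<xi>' *\<^sub>R v + \<eta>' *\<^sub>R u)"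
      using 1(5) 2(5) unfolding sw by linarith
    then have "?P (x + \<xi> *\<^sub>R u + \<eta> *\<^sub>R v) = ?Q (x + \<xi>' *\<^sub>R v + \<eta>' *\<^sub>R u)"
      using s(1)[of n] by simp
    then show ?thesis
      using near[OF 1(1-4), of u v] near[OF 2(1-4), of v u] by (metis add.commute)
  qed
  obtain y z where yz: "\<And>n. dist (y n) x \<le> s n * (norm u + norm v)"
    "\<And>n. dist (z n) x \<le> s n * (norm u + norm v)" and eq: "\<And>n. ?P (y n) = ?Q (z n)"
    using ex by metis
  have lim: "y \<longlonglongrightarrow> x" if "\<And>n. dist (y n) x \<le> s n * (norm u + norm v)" for y
  proof -
    have "(\<lambda>n. s n * (norm u + norm v)) \<longlonglongrightarrow> 0"
      using tendsto_mult[OF s0 tendsto_const] by simp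
    then have "(\<lambda>n. dist (y n) x) \<longlonglongrightarrow> 0"
      by (rule tendsto_sandwich[OF _ _ tendsto_const, rotated 2]) (simp_all add: that)
    then show ?thesis using tendsto_dist_iff by blast
  qed
  have c: "isCont ?P x" "isCont ?Q x"
    using cont assms by (auto simp: continuous_on_eq_continuous_at)
  have l1: "(\<lambda>n. ?P (y n)) \<longlonglongrightarrow> ?P x"
    by (rule isCont_tendsto_compose[OF c(1) lim[OF yz(1)]])
  have l2: "(\<lambda>n. ?Q (z n)) \<longlonglongrightarrow> ?Q x"
    by (rule isCont_tendsto_compose[OF c(2) lim[OF yz(2)]])
  have "(\<lambda>n. ?P (y n)) = (\<lambda>n. ?Q (z n))" by (simp add: eq)
  with l1 have "(\<lambda>n. ?Q (z n)) \<longlonglongrightarrow> ?P x" by simp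
  then show ?thesis by (rule LIMSEQ_unique[OF _ l2])
qed

lemma Ck_on_symmetric:
  fixes f :: "'a::real_normed_vector \<Rightarrow> 'b::euclidean_space"
  assumes "open S" "x \<in> S" and C: "Ck_on 2 S f"
  shows "frechet_derivative (\<lambda>y. frechet_derivative f (at y) u) (at x) v =
         frechet_derivative (\<lambda>y. frechet_derivative f (at y) v) (at x) u"
proof (rule euclidean_eqI)
  fix b :: 'b
  have C2: "Ck_on (Suc (Suc 0)) S f" using C by (simp add: numeral_2_eq_2)
  have 1: "frechet_derivative (\<lambda>y. f y \<bullet> b) (at y) u = frechet_derivative f (at y) u \<bullet> b" if "y \<in> S" for y u
    using has_derivative_inner_left[OF Ck_on_Suc_has_derivative[OF C2 that], of b] frechet_derivative_at by metis
  have 2: "frechet_derivative (\<lambda>y. frechet_derivative (\<lambda>y. f y \<bullet> b) (at y) u) (at x) v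
     = frechet_derivative (\<lambda>y. frechet_derivative f (at y) u) (at x) v \<bullet> b" for u v
  proof -
    have d: "((\<lambda>y. frechet_derivative f (at y) u) has_derivative
          frechet_derivative (\<lambda>y. frechet_derivative f (at y) u) (at x)) (at x)"
      using C2 assms(2) by (intro Ck_on_Suc_has_derivative[of 0 S]) simp_all
    have "((\<lambda>y. frechet_derivative f (at y) u \<bullet> b) has_derivative
      (\<lambda>v. frechet_derivative (\<lambda>y. frechet_derivative f (at y) u) (at x) v \<bullet> b)) (at x)"
      using has_derivative_inner_left[OF d] .
    then have "((\<lambda>y. frechet_derivative (\<lambda>y. f y \<bullet> b) (at y) u) has_derivative
      (\<lambda>v. frechet_derivative (\<lambda>y. frechet_derivative f (at y) u) (at x) v \<bullet> b)) (at x)"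
      by (rule has_derivative_transform_within_open[OF _ assms(1,2)]) (simp add: 1)
    then show ?thesis using frechet_derivative_at by metis
  qed
  have "Ck_on 2 S (\<lambda>y. f y \<bullet> b)"
    using C by (intro Ck_on_bounded_linear[OF assms(1) bounded_linear_inner_left])
  from Ck_on_symmetric_real[OF assms(1,2) this, of u v]
  show "frechet_derivative (\<lambda>y. frechet_derivative f (at y) u) (at x) v \<bullet> b =
         frechet_derivative (\<lambda>y. frechet_derivative f (at y) v) (at x) u \<bullet> b"
    by (simp add: 2)
qed

text \<open>A second-order Taylor limit in which \<open>g'\<close> need only be differentiable at 0:
  one use of L'Hopital's rule in each component leaves the difference quotient of
  \<open>g'\<close>.\<close>

lemma second_order_quotient:
  fixes g :: "real \<Rightarrow> 'b::euclidean_space"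
  assumes d: "\<forall>\<^sub>F r in nhds 0. (g has_vector_derivative g' r) (at r)"
    and "g' 0 = 0" and d2: "(g' has_vector_derivative c) (at 0)"
  shows "((\<lambda>r. (g r - g 0) /\<^sub>R r\<^sup>2) \<longlongrightarrow> c /\<^sub>R 2) (at 0)"
proof (subst tendsto_componentwise_iff, intro ballI)
  fix b :: 'b assume "b \<in> Basis"
  have d': "\<forall>\<^sub>F r in nhds 0. ((\<lambda>r. (g r - g 0) \<bullet> b) has_real_derivative g' r \<bullet> b) (at r)"
    using d
  proof eventually_elim
    case (elim r)
    then have "(g has_derivative (\<lambda>h. h *\<^sub>R g' r)) (at r)" by (simp add: has_vector_derivative_def)
    then have "((\<lambda>r. g r - g 0) has_derivative (\<lambda>h. h *\<^sub>R g' r)) (at r)"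
      using has_derivative_diff[OF _ has_derivative_const] by fastforce
    from has_derivative_inner_left[OF this, of b]
    have "((\<lambda>r. (g r - g 0) \<bullet> b) has_derivative (\<lambda>h. (h *\<^sub>R g' r) \<bullet> b)) (at r)" .
    then show ?case by (simp add: has_field_derivative_def mult_commute_abs)
  qed
  have c: "isCont (\<lambda>r. (g r - g 0) \<bullet> b) 0"
    by (rule DERIV_isCont[OF eventually_nhds_x_imp_x[OF d']])
  have "(g' has_derivative (\<lambda>h. h *\<^sub>R c)) (at 0)" using d2 by (simp add: has_vector_derivative_def)
  from has_derivative_inner_left[OF this, of b]
  have "((\<lambda>r. g' r \<bullet> b) has_derivative (\<lambda>h. (h *\<^sub>R c) \<bullet> b)) (at 0)" .
  then have "((\<lambda>r. g' r \<bullet> b) has_real_derivative c \<bullet> b) (at 0)"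
    by (simp add: has_field_derivative_def mult_commute_abs)
  then have "((\<lambda>r. (g' r \<bullet> b) / r) \<longlongrightarrow> c \<bullet> b) (at 0)"
    using assms(2) by (simp add: DERIV_def)
  then have lim: "((\<lambda>r. (g' r \<bullet> b) / (2 * r)) \<longlongrightarrow> (c \<bullet> b) / 2) (at 0)"
    using tendsto_divide[OF _ tendsto_const, of "\<lambda>r. (g' r \<bullet> b) / r" "c \<bullet> b" "at 0" 2]
    by (simp add: mult.commute)
  have "((\<lambda>r. ((g r - g 0) \<bullet> b) / r\<^sup>2) \<longlongrightarrow> (c \<bullet> b) / 2) (at 0)"
  proof (rule lhopital[OF _ _ _ _ _ _ lim])
    show "((\<lambda>r. (g r - g 0) \<bullet> b) \<longlongrightarrow> 0) (at 0)" using c by (simp add: isCont_def)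
    show "((\<lambda>r::real. r\<^sup>2) \<longlongrightarrow> 0) (at 0)" 
      using tendsto_power[OF tendsto_ident_at, of 2 "0::real" UNIV] by simp
    show "\<forall>\<^sub>F r in at (0::real). r\<^sup>2 \<noteq> 0" "\<forall>\<^sub>F r in at (0::real). 2 * r \<noteq> 0"
      by (simp_all add: eventually_at_filter)
    show "\<forall>\<^sub>F r in at 0. ((\<lambda>r. (g r - g 0) \<bullet> b) has_real_derivative g' r \<bullet> b) (at r)"
      using d' unfolding eventually_at_filter by (rule eventually_mono) simp
    show "\<forall>\<^sub>F r in at 0. ((\<lambda>r::real. r\<^sup>2) has_real_derivative 2 * r) (at r)"
      using DERIV_pow[of 2] by (intro always_eventually allI) simp
  qed
  then show "((\<lambda>r. ((g r - g 0) /\<^sub>R r\<^sup>2) \<bullet> b) \<longlongrightarrow> (c /\<^sub>R 2) \<bullet> b) (at 0)"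
    by (simp only: inner_scaleR_left divide_inverse_commute)
qed

section \<open>Isometries and second-order expansions of metrics\<close>

text \<open>If \<open>Q\<close> is the second-order coefficient of a metric whose first derivatives vanish at the origin,
  this is (up to a constant) the biquadratic form \<open>\<langle>R(x, u) u, x\<rangle>\<close> of its curvature tensor.\<close>

definition sec_form :: "('e::real_vector \<Rightarrow> 'e \<Rightarrow> 'e \<Rightarrow> real) \<Rightarrow> 'e \<Rightarrow> 'e \<Rightarrow> real" where
  "sec_form Q x u = Q (x + u) x u - Q (x - u) x u - 2 * Q x u u - 2 * Q u x x"

lemma has_vector_derivative_quotient:
  assumes "(g has_vector_derivative d) (at 0)"
  shows "((\<lambda>r. (g r - g 0) /\<^sub>R r) \<longlongrightarrow> d) (at 0)"
proof -
  have "((\<lambda>r. norm (g r - g 0 - r *\<^sub>R d) / norm r) \<longlongrightarrow> 0) (at 0)"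
    using assms by (simp add: has_vector_derivative_def has_derivative_iff_norm)
  moreover have "\<forall>\<^sub>F r in at (0::real). norm (g r - g 0 - r *\<^sub>R d) / norm r = norm ((g r - g 0) /\<^sub>R r - d)"
    unfolding eventually_at_filter
  proof (intro always_eventually allI impI)
    fix r :: real assume "r \<noteq> 0"
    then have "(g r - g 0) /\<^sub>R r - d = (g r - g 0 - r *\<^sub>R d) /\<^sub>R r"
      by (simp add: scaleR_right_diff_distrib)
    then show "norm (g r - g 0 - r *\<^sub>R d) / norm r = norm ((g r - g 0) /\<^sub>R r - d)"
      by (simp add: divide_inverse_commute)
  qed
  ultimately have "((\<lambda>r. norm ((g r - g 0) /\<^sub>R r - d)) \<longlongrightarrow> 0) (at 0)"
    by (simp cong: tendsto_cong)
  then show ?thesis using tendsto_norm_zero_iff LIM_zero_iff by blast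
qed

text \<open>Compare powers of r in the isometry equation along the ray r y. Order r says that the
  second derivative B of F is skew for h0; being symmetric as well it vanishes, as in the uniqueness
  of the Levi-Civita connection. Order r^2 then expresses the change of \<Phi> 0 under A by the
  third derivative T, and \<open>sec_form\<close> is the combination from which a totally symmetric
  T cancels.\<close>

lemma local_isometry_jet:
  fixes F :: "'e::euclidean_space \<Rightarrow> 'e" and h0 :: "'e \<Rightarrow> 'e \<Rightarrow> real"
  assumes h0: "bounded_bilinear h0" and sym: "\<And>u v. h0 u v = h0 v u" and pos: "\<And>u. u \<noteq> 0 \<Longrightarrow> h0 u u > 0"
    and expansion: "\<And>r x u v. h (r *\<^sub>R x) u v = h0 u v + r\<^sup>2 * \<Phi> r x u v"
    and cont: "\<And>x u v. isCont (\<lambda>(r, x, u, v). \<Phi> r x u v) (0, x, u, v)"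
    and S: "open S" "0 \<in> S" and C: "Ck_on 3 S F" and F0: "F 0 = 0"
    and iso: "\<And>x u v. x \<in> S \<Longrightarrow>
        h (F x) (frechet_derivative F (at x) u) (frechet_derivative F (at x) v) = h x u v"
  defines "A \<equiv> frechet_derivative F (at 0)"
  shows "h0 (A u) (A v) = h0 u v"
    and "sec_form (\<Phi> 0) (A x) (A u) = sec_form (\<Phi> 0) x u"
proof -
  interpret h0: bounded_bilinear h0 by (rule h0)
  define f where "f u = (\<lambda>x. frechet_derivative F (at x) u)" for u
  define B where "B y u = frechet_derivative (f u) (at 0) y" for y u
  define D where "D y u = (\<lambda>x. frechet_derivative (f u) (at x) y)" for y u
  define T where "T z y u = frechet_derivative (D y u) (at 0) z" for z y u
  have C3: "Ck_on (Suc (Suc (Suc 0))) S F" using C by (simp add: numeral_3_eq_3)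
  have Cf: "Ck_on (Suc (Suc 0)) S (f u)" for u using C3 unfolding f_def by simp
  have CD: "Ck_on (Suc 0) S (D y u)" for y u using Cf[of u] unfolding D_def by simp
  have dF: "(F has_derivative (\<lambda>u. f u x)) (at x)" if "x \<in> S" for x
    using Ck_on_Suc_has_derivative[OF C3 that] by (simp add: f_def)
  have df: "(f u has_derivative (\<lambda>y. D y u x)) (at x)" if "x \<in> S" for x u
    using Ck_on_Suc_has_derivative[OF Cf that] by (simp add: D_def)
  have dD: "(D y u has_derivative (\<lambda>z. T z y u)) (at 0)" for y u
    using Ck_on_Suc_has_derivative[OF CD S(2)] by (simp add: T_def)
  have A: "A u = f u 0" for u by (simp add: A_def f_def)
  have BD: "B y u = D y u 0" for y u by (simp add: B_def D_def)
  have linA: "linear A" unfolding A_def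
    using dF[OF S(2)] has_derivative_linear by (fastforce simp: f_def)
  have symD: "D y u x = D u y x" if "x \<in> S" for y u x
    using Ck_on_symmetric[OF S(1) that, of F] C3 Ck_on_SucD
    unfolding D_def f_def by (metis numeral_2_eq_2)
  have linB: "linear (\<lambda>y. B y u)" for u
    using has_derivative_linear[OF df[OF S(2)], of u] by (simp add: BD)
  have linT: "linear (\<lambda>z. T z y u)" for y u
    using has_derivative_linear[OF dD] .
  have symT1: "T z y u = T y z u" for z y u
    using Ck_on_symmetric[OF S, of "f u" y z] Cf unfolding T_def D_def numeral_2_eq_2 by simp
  have symT2: "T z y u = T z u y" for z y u
  proof -
    have "(D u y has_derivative (\<lambda>z. T z y u)) (at 0)"
      by (rule has_derivative_transform_within_open[OF dD S]) (rule symD)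
    then show ?thesis using frechet_derivative_at unfolding T_def by metis
  qed
  have ray: "\<forall>\<^sub>F r in nhds 0. r *\<^sub>R y \<in> S" for y
  proof -
    have "((\<lambda>r. r *\<^sub>R y) \<longlongrightarrow> 0 *\<^sub>R y) (nhds 0)" by (intro tendsto_intros filterlim_ident)
    then show ?thesis using topological_tendstoD[OF _ S(1)] S(2) by fastforce
  qed
  have rayd: "((\<lambda>r. r *\<^sub>R y) has_derivative (\<lambda>s. s *\<^sub>R y)) (at r)" for r and y :: 'e
    by (auto intro!: derivative_eq_intros)
  have vdf: "((\<lambda>r. f u (r *\<^sub>R y)) has_vector_derivative D y u (r *\<^sub>R y)) (at r)"
    if "r *\<^sub>R y \<in> S" for r y u
    using has_derivative_compose[OF rayd df[OF that]] linear_scale[OF has_derivative_linear[OF df[OF that]]]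
    by (simp add: has_vector_derivative_def)
  have limF: "((\<lambda>r. F (r *\<^sub>R y) /\<^sub>R r) \<longlongrightarrow> A y) (at 0)" for y
  proof -
    have "((\<lambda>r. F (r *\<^sub>R y)) has_vector_derivative A y) (at 0)"
      using has_derivative_compose[OF rayd[of y 0], of F "\<lambda>u. f u 0"] dF[OF S(2)] linear_scale[OF linA]
      by (simp add: has_vector_derivative_def A)
    from has_vector_derivative_quotient[OF this] show ?thesis by (simp add: F0)
  qed
  have limU: "((\<lambda>r. f u (r *\<^sub>R y)) \<longlongrightarrow> A u) (at 0)" for u y
    using has_vector_derivative_continuous[OF vdf[of 0 y u]] S(2)
    by (simp add: A isCont_def)
  \<comment> \<open>Joint continuity of \<Phi> is what is needed: at the image point the direction F
    (r y) / r and both vectors vary with r.\<close>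
  have lim\<Phi>: "((\<lambda>r. \<Phi> r (F (r *\<^sub>R y) /\<^sub>R r) (f u (r *\<^sub>R y)) (f v (r *\<^sub>R y)) - \<Phi> r y u v)
      \<longlongrightarrow> \<Phi> 0 (A y) (A u) (A v) - \<Phi> 0 y u v) (at 0)" for y u v
  proof (intro tendsto_diff)
    show "((\<lambda>r. \<Phi> r (F (r *\<^sub>R y) /\<^sub>R r) (f u (r *\<^sub>R y)) (f v (r *\<^sub>R y))) \<longlongrightarrow> \<Phi> 0 (A y) (A u) (A v)) (at 0)"
      using isCont_tendsto_compose[OF cont[of "A y" "A u" "A v"], of
          "\<lambda>r. (r, F (r *\<^sub>R y) /\<^sub>R r, f u (r *\<^sub>R y), f v (r *\<^sub>R y))" "at 0"]
      by (simp add: tendsto_Pair limF limU)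
    show "((\<lambda>r. \<Phi> r y u v) \<longlongrightarrow> \<Phi> 0 y u v) (at 0)"
      using isCont_tendsto_compose[OF cont[of y u v], of "\<lambda>r. (r, y, u, v)" "at 0"]
      by (simp add: tendsto_Pair)
  qed
  have h0A: "h0 (A u) (A v) = h0 u v" for u v
    using iso[OF S(2), of u v] expansion[of 0 0] by (simp add: F0 A f_def)
  have "inj A"
    unfolding linear_injective_0[OF linA]
  proof (intro allI impI, rule ccontr)
    fix u assume "A u = 0" "u \<noteq> 0"
    then show False using h0A[of u u] pos[of u] by (simp add: h0.zero_left)
  qed
  then have "surj A" using linear_injective_imp_surjective[OF linA] by simp
  \<comment> \<open>Writing F (r y) as r times F (r y) / r gives the image point the same expansion
    parameter r, so that both remainders carry the factor r^2.\<close>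
  have key: "\<forall>\<^sub>F r in at 0. h0 (A u) (A v) - h0 (f u (r *\<^sub>R y)) (f v (r *\<^sub>R y)) =
      r\<^sup>2 * (\<Phi> r (F (r *\<^sub>R y) /\<^sub>R r) (f u (r *\<^sub>R y)) (f v (r *\<^sub>R y)) - \<Phi> r y u v)" for u v y
    unfolding eventually_at_filter using ray[of y]
  proof eventually_elim
    case (elim r)
    show ?case
    proof (intro impI)
      assume "r \<noteq> 0"
      then have "F (r *\<^sub>R y) = r *\<^sub>R (F (r *\<^sub>R y) /\<^sub>R r)" by simp
      then have "h0 (f u (r *\<^sub>R y)) (f v (r *\<^sub>R y)) + r\<^sup>2 * \<Phi> r (F (r *\<^sub>R y) /\<^sub>R r) (f u (r *\<^sub>R y)) (f v (r *\<^sub>R y))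
        = h0 u v + r\<^sup>2 * \<Phi> r y u v"
        using iso[OF elim, of u v] expansion by (metis f_def)
      then show "h0 (A u) (A v) - h0 (f u (r *\<^sub>R y)) (f v (r *\<^sub>R y)) =
        r\<^sup>2 * (\<Phi> r (F (r *\<^sub>R y) /\<^sub>R r) (f u (r *\<^sub>R y)) (f v (r *\<^sub>R y)) - \<Phi> r y u v)"
        unfolding h0A by (simp add: algebra_simps)
    qed
  qed
  have expand: "h0 (A u + c *\<^sub>R a) (A v + c *\<^sub>R b) - h0 (A u) (A v) = c * (h0 a (A v + c *\<^sub>R b) + h0 (A u) b)"
    for u v a b c
    by (simp add: h0.add_left h0.add_right h0.scaleR_left h0.scaleR_right algebra_simps)
  \<comment> \<open>Order r: after division by r the right-hand side of \<open>key\<close> still has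
    a factor r.\<close>
  have skew: "h0 (B y u) (A v) + h0 (A u) (B y v) = 0" for y u v
  proof -
    let ?U = "\<lambda>u r. (f u (r *\<^sub>R y) - A u) /\<^sub>R r"
    have limU1: "(?U u \<longlongrightarrow> B y u) (at 0)" for u
      using has_vector_derivative_quotient[OF vdf[of 0 y u]] S(2) by (simp add: A BD)
    have "((\<lambda>r. h0 (?U u r) (f v (r *\<^sub>R y)) + h0 (A u) (?U v r)) \<longlongrightarrow> h0 (B y u) (A v) + h0 (A u) (B y v)) (at 0)"
      by (intro tendsto_add h0.tendsto limU1 limU tendsto_const)
    moreover have "((\<lambda>r. h0 (?U u r) (f v (r *\<^sub>R y)) + h0 (A u) (?U v r)) \<longlongrightarrow> 0) (at 0)"
    proof (rule Lim_transform_eventually)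
      show "((\<lambda>r. - r * (\<Phi> r (F (r *\<^sub>R y) /\<^sub>R r) (f u (r *\<^sub>R y)) (f v (r *\<^sub>R y)) - \<Phi> r y u v)) \<longlongrightarrow> 0) (at 0)"
        using tendsto_mult[OF tendsto_minus[OF tendsto_ident_at] lim\<Phi>[of y u v]] by simp
      show "\<forall>\<^sub>F r in at 0. - r * (\<Phi> r (F (r *\<^sub>R y) /\<^sub>R r) (f u (r *\<^sub>R y)) (f v (r *\<^sub>R y)) - \<Phi> r y u v)
         = h0 (?U u r) (f v (r *\<^sub>R y)) + h0 (A u) (?U v r)"
        using key[of u v y] unfolding eventually_at_filter
      proof eventually_elim
        case (elim r)
        show ?case
        proof (intro impI)
          assume r: "r \<noteq> 0"
          have "r * (h0 (?U u r) (f v (r *\<^sub>R y)) + h0 (A u) (?U v r)) =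
             h0 (f u (r *\<^sub>R y)) (f v (r *\<^sub>R y)) - h0 (A u) (A v)"
            using expand[of u r "?U u r" v "?U v r"] r by simp
          also have "\<dots> = r * (- r * (\<Phi> r (F (r *\<^sub>R y) /\<^sub>R r) (f u (r *\<^sub>R y)) (f v (r *\<^sub>R y)) - \<Phi> r y u v))"
            using elim r by (simp add: power2_eq_square algebra_simps)
          finally show "- r * (\<Phi> r (F (r *\<^sub>R y) /\<^sub>R r) (f u (r *\<^sub>R y)) (f v (r *\<^sub>R y)) - \<Phi> r y u v)
            = h0 (?U u r) (f v (r *\<^sub>R y)) + h0 (A u) (?U v r)"
            using r by (metis mult_left_cancel power_eq_0_iff)
        qed
      qed
    qed
    ultimately show ?thesis using tendsto_unique[OF at_neq_bot] by blast
  qed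
  have symB: "B y u = B u y" for y u using symD[OF S(2)] by (simp add: BD)
  have B0: "B y u = 0" for y u
  proof -
    \<comment> \<open>A trilinear form symmetric in its first two arguments and skew in the last two
      is zero; the three permuted instances of \<open>skew\<close> show this.\<close>
    have "h0 (B y u) (A v) = 0" for v
      using skew[of y u v] skew[of u v y] skew[of v y u]
      by (simp add: symB[of v y] symB[of u y] symB[of v u] sym[of "A _"])
    then show ?thesis using \<open>surj A\<close> pos by (metis less_irrefl surjD)
  qed
  \<comment> \<open>Order r^2: as B vanishes, f u (r y) - A u is of second order with coefficient T
    y y u / 2.\<close>
  have second: "2 * (\<Phi> 0 (A y) (A u) (A v) - \<Phi> 0 y u v) = - (h0 (T y y u) (A v) + h0 (A u) (T y y v))" for y u v
  proof -
    let ?U = "\<lambda>u r. (f u (r *\<^sub>R y) - A u) /\<^sub>R r\<^sup>2"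
    have vd2: "((\<lambda>r. D y u (r *\<^sub>R y)) has_vector_derivative T y y u) (at 0)" for u
      using has_derivative_compose[OF rayd[of y 0], of "D y u" "\<lambda>z. T z y u"] dD[of y u]
        linear_scale[OF linT] by (simp add: has_vector_derivative_def)
    have limU2: "(?U u \<longlongrightarrow> T y y u /\<^sub>R 2) (at 0)" for u
    proof -
      have "\<forall>\<^sub>F r in nhds 0. ((\<lambda>r. f u (r *\<^sub>R y)) has_vector_derivative D y u (r *\<^sub>R y)) (at r)"
        using ray[of y] by eventually_elim (rule vdf)
      from second_order_quotient[OF this _ vd2] show ?thesis
        using B0[of y u] by (simp add: A BD)
    qed
    have "((\<lambda>r. h0 (?U u r) (f v (r *\<^sub>R y)) + h0 (A u) (?U v r))
        \<longlongrightarrow> h0 (T y y u /\<^sub>R 2) (A v) + h0 (A u) (T y y v /\<^sub>R 2)) (at 0)"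
      by (intro tendsto_add h0.tendsto limU2 limU tendsto_const)
    moreover have "((\<lambda>r. h0 (?U u r) (f v (r *\<^sub>R y)) + h0 (A u) (?U v r))
        \<longlongrightarrow> - (\<Phi> 0 (A y) (A u) (A v) - \<Phi> 0 y u v)) (at 0)"
    proof (rule Lim_transform_eventually[OF tendsto_minus[OF lim\<Phi>]])
      show "\<forall>\<^sub>F r in at 0. - (\<Phi> r (F (r *\<^sub>R y) /\<^sub>R r) (f u (r *\<^sub>R y)) (f v (r *\<^sub>R y)) - \<Phi> r y u v)
         = h0 (?U u r) (f v (r *\<^sub>R y)) + h0 (A u) (?U v r)"
        using key[of u v y] unfolding eventually_at_filter
      proof eventually_elim
        case (elim r)
        show ?case
        proof (intro impI)
          assume r: "r \<noteq> 0"
          have "r\<^sup>2 * (h0 (?U u r) (f v (r *\<^sub>R y)) + h0 (A u) (?U v r)) =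
             h0 (f u (r *\<^sub>R y)) (f v (r *\<^sub>R y)) - h0 (A u) (A v)"
            using expand[of u "r\<^sup>2" "?U u r" v "?U v r"] r by simp
          also have "\<dots> = r\<^sup>2 * - (\<Phi> r (F (r *\<^sub>R y) /\<^sub>R r) (f u (r *\<^sub>R y)) (f v (r *\<^sub>R y)) - \<Phi> r y u v)"
            using elim r by (simp add: algebra_simps)
          finally show "- (\<Phi> r (F (r *\<^sub>R y) /\<^sub>R r) (f u (r *\<^sub>R y)) (f v (r *\<^sub>R y)) - \<Phi> r y u v)
            = h0 (?U u r) (f v (r *\<^sub>R y)) + h0 (A u) (?U v r)"
            using r by (metis mult_left_cancel power_eq_0_iff)
        qed
      qed
    qed
    ultimately have "h0 (T y y u /\<^sub>R 2) (A v) + h0 (A u) (T y y v /\<^sub>R 2) = - (\<Phi> 0 (A y) (A u) (A v) - \<Phi> 0 y u v)"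
      using tendsto_unique[OF at_neq_bot] by blast
    then show ?thesis by (simp add: h0.scaleR_left h0.scaleR_right)
  qed
  \<comment> \<open>Linearity is at hand in the first argument; symmetry brings the second one into
    that place.\<close>
  have Tp: "T (x + u) (x + u) w = T x x w + 2 *\<^sub>R T x u w + T u u w" for x u w
  proof -
    have "T (x + u) (x + u) w = T x (x + u) w + T u (x + u) w" using linear_add[OF linT] .
    also have "\<dots> = T (x + u) x w + T (x + u) u w" by (metis symT1)
    also have "\<dots> = T x x w + T u x w + (T x u w + T u u w)" by (simp add: linear_add[OF linT])
    finally show ?thesis by (simp add: symT1[of u x] scaleR_2)
  qed
  have Tm: "T (x - u) (x - u) w = T x x w - 2 *\<^sub>R T x u w + T u u w" for x u w
  proof -
    have "T (x - u) (x - u) w = T x (x - u) w - T u (x - u) w" using linear_diff[OF linT] .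
    also have "\<dots> = T (x - u) x w - T (x - u) u w" by (metis symT1)
    also have "\<dots> = T x x w - T u x w - (T x u w - T u u w)" by (simp add: linear_diff[OF linT])
    finally show ?thesis by (simp add: symT1[of u x] scaleR_2)
  qed
  have T3: "T x u x = T x x u" "T x u u = T u u x" for x u
    using symT1 symT2 by metis+
  show "h0 (A u) (A v) = h0 u v" by (rule h0A)
  show "sec_form (\<Phi> 0) (A x) (A u) = sec_form (\<Phi> 0) x u"
    using second[of "x + u" x u] second[of "x - u" x u] second[of x u u] second[of u x x]
      arg_cong[OF T3(1), of "\<lambda>z. h0 z (A u)" x u]
    unfolding sec_form_def linear_add[OF linA, symmetric] linear_diff[OF linA, symmetric] Tp Tm
    by (simp add: h0.add_left h0.add_right h0.diff_left h0.diff_right h0.scaleR_left h0.scaleR_right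
        T3(2) sym[of "A _"] algebra_simps)
qed

section \<open>Tangent vectors of complex projective 3-space\<close>

lemma has_derivative_vec:
  fixes f :: "'a::real_normed_vector \<Rightarrow> 'b::euclidean_space ^ 'n"
  assumes "\<And>i. ((\<lambda>x. f x $ i) has_derivative (\<lambda>v. f' v $ i)) F"
  shows "(f has_derivative f') F"
proof -
  have "((\<lambda>x. \<Sum>i\<in>UNIV. axis i (f x $ i)) has_derivative (\<lambda>v. \<Sum>i\<in>UNIV. axis i (f' v $ i))) F"
    by (intro has_derivative_sum bounded_linear.has_derivative[OF bounded_linear_axis] assms)
  then show ?thesis by (simp only: sum_axis_nth)
qed

lemma index4_cases: "k = j \<or> k = j + 1 \<or> k = j + 2 \<or> k = j + (3::4)"
  using exhaust_4[of "k - j"] by (auto simp: algebra_simps)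

lemma vec4_nonzeroD: "z \<noteq> (0 :: complex^4) \<Longrightarrow> \<exists>i. z $ i \<noteq> 0"
  by (auto simp: vec_eq_iff)

lemma hopf_eq_iff:
  assumes "z \<noteq> 0" "w \<noteq> 0"
  shows "hopf z = hopf w \<longleftrightarrow> (\<exists>c. c \<noteq> 0 \<and> w = c *s z)"
proof -
  have "hopf z = hopf w \<longleftrightarrow> range (\<lambda>c. c *s z) = range (\<lambda>c. c *s w)"
    unfolding hopf_def using assms by (intro Abs_cp3_inject) auto
  also have "\<dots> \<longleftrightarrow> (\<exists>c. c \<noteq> 0 \<and> w = c *s z)"
  proof
    assume eq: "range (\<lambda>c. c *s z) = range (\<lambda>c. c *s w)"
    have "w \<in> range (\<lambda>c. c *s w)" using range_eqI[of w "\<lambda>c. c *s w" 1] by simp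
    then obtain c where "w = c *s z" using eq by auto
    then show "\<exists>c. c \<noteq> 0 \<and> w = c *s z" using assms by (auto intro!: exI[of _ c])
  next
    assume "\<exists>c. c \<noteq> 0 \<and> w = c *s z"
    then obtain c where c: "c \<noteq> 0" "w = c *s z" by blast
    have "d *s z \<in> range (\<lambda>c. c *s w)" for d
      using c by (intro range_eqI[of _ _ "d / c"]) (simp add: vector_smult_assoc)
    then show "range (\<lambda>c. c *s z) = range (\<lambda>c. c *s w)"
      using c by (auto simp: vector_smult_assoc)
  qed
  finally show ?thesis .
qed

lemma hopf_smult: "c \<noteq> 0 \<Longrightarrow> z \<noteq> 0 \<Longrightarrow> hopf (c *s z) = hopf z"
  using hopf_eq_iff[of z "c *s z"] by auto

lemma norm_smult_complex: "norm (c *s z) = norm c * norm (z :: complex^'n)"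
  unfolding norm_vec_def L2_set_def
  by (simp add: norm_mult power_mult_distrib real_sqrt_mult flip: sum_distrib_left)

lemma scaleR_eq_smult: "r *\<^sub>R z = complex_of_real r *s (z :: complex^'n)"
  unfolding vec_eq_iff vector_scaleR_component vector_smult_component by (simp add: scaleR_conv_of_real)

lemma hopf_surj: obtains z where "norm z = 1" "hopf z = p"
proof -
  obtain w where w: "w \<noteq> 0" "Rep_cp3 p = range (\<lambda>c. c *s w)" using Rep_cp3[of p] by auto
  then have p: "hopf w = p" unfolding hopf_def by (metis Rep_cp3_inverse)
  have "hopf (complex_of_real (inverse (norm w)) *s w) = p"
    using hopf_smult[of "complex_of_real (inverse (norm w))" w] w(1) p by simp
  moreover have "norm (complex_of_real (inverse (norm w)) *s w) = 1"
    using w(1) by (simp add: norm_smult_complex norm_inverse)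
  ultimately show ?thesis using that by blast
qed

lemma hopf_in_chart_dom:
  assumes "z \<noteq> 0"
  shows "hopf z \<in> chart_dom i \<longleftrightarrow> z $ i \<noteq> 0"
proof
  assume "hopf z \<in> chart_dom i"
  then obtain w where w: "hopf w = hopf z" "w $ i \<noteq> 0" by (auto simp: chart_dom_def)
  then have "w \<noteq> 0" by auto
  then show "z $ i \<noteq> 0" using w hopf_eq_iff[of z w] assms by auto
qed (auto simp: chart_dom_def)

lemma affine_coords_smult: "c \<noteq> 0 \<Longrightarrow> affine_coords i (c *s z) = affine_coords i z"
  by (simp add: affine_coords_def)

text \<open>The representative chosen in \<open>chart\<close> is immaterial, since a nonzero factor
  cancels in the affine quotients.\<close>

lemma chart_hopf:
  assumes "z $ i \<noteq> 0"
  shows "chart i (hopf z) = affine_coords i z"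
proof -
  have z: "z \<noteq> 0" using assms by auto
  define w where "w = (SOME w. w \<noteq> 0 \<and> hopf w = hopf z)"
  have "w \<noteq> 0 \<and> hopf w = hopf z" unfolding w_def by (rule someI[of _ z]) (use z in auto)
  then obtain c where "c \<noteq> 0" "w = c *s z" using hopf_eq_iff[of z w] z by auto
  then show ?thesis unfolding chart_def w_def[symmetric] by (simp add: affine_coords_smult)
qed

text \<open>The lift to \<complex>^4 behind \<open>chart_inv\<close>, named so that it can be
  differentiated as a map of vector spaces.\<close>

definition affine_section :: "4 \<Rightarrow> complex^3 \<Rightarrow> complex^4" where
  "affine_section i w = (\<chi> k. if k = i then 1 else if k = i + 1 then w $ 1
                              else if k = i + 2 then w $ 2 else w $ 3)"

lemma chart_inv_eq: "chart_inv i w = hopf (affine_section i w)"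
  by (simp add: chart_inv_def affine_section_def)

lemma affine_section_nth [simp]: "affine_section i w $ i = 1"
  by (simp add: affine_section_def)

lemma affine_section_nonzero [simp]: "affine_section i w \<noteq> 0"
  using affine_section_nth[of i w] by (metis zero_index zero_neq_one)

lemma affine_coords_section: "affine_coords i (affine_section i w) = w"
  by (simp add: vec_eq_iff forall_3 affine_coords_def affine_section_def)

lemma affine_section_coords:
  assumes "z $ i \<noteq> 0"
  shows "z = z $ i *s affine_section i (affine_coords i z)"
proof -
  have "z $ k = z $ i * affine_section i (affine_coords i z) $ k" for k
    using index4_cases[of k i] assms by (elim disjE) (simp_all add: affine_section_def affine_coords_def)
  then show ?thesis unfolding vec_eq_iff vector_smult_component by blast
qed

lemma chart_inv_chart_hopf: "z $ i \<noteq> 0 \<Longrightarrow> chart_inv i (affine_coords i z) = hopf z"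
  using affine_section_coords[of z i] hopf_smult[of "z $ i" "affine_section i (affine_coords i z)"]
  by (simp add: chart_inv_eq)

definition affine_deriv :: "4 \<Rightarrow> complex^4 \<Rightarrow> complex^4 \<Rightarrow> complex^3" where
  "affine_deriv i z v = vector [(v $ (i+1) * z $ i - z $ (i+1) * v $ i) / (z $ i)\<^sup>2,
     (v $ (i+2) * z $ i - z $ (i+2) * v $ i) / (z $ i)\<^sup>2,
     (v $ (i+3) * z $ i - z $ (i+3) * v $ i) / (z $ i)\<^sup>2]"

lemma has_derivative_affine_coords:
  assumes "z $ i \<noteq> 0"
  shows "(affine_coords i has_derivative affine_deriv i z) (at z)"
proof (rule has_derivative_vec)
  have "((\<lambda>x. x $ k / x $ i) has_derivative (\<lambda>v. (v $ k * z $ i - z $ k * v $ i) / (z $ i)\<^sup>2)) (at z)" for k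
  proof -
    have d: "((\<lambda>x. x $ k) has_derivative (\<lambda>v. v $ k)) (at z)" for k :: 4
      using bounded_linear.has_derivative[OF bounded_linear_vec_nth has_derivative_ident] .
    show ?thesis
      using has_derivative_divide'[OF d d assms, of k] by (simp add: power2_eq_square)
  qed
  then show "((\<lambda>x. affine_coords i x $ j) has_derivative (\<lambda>v. affine_deriv i z v $ j)) (at z)" for j
    using exhaust_3[of j] by (auto simp: affine_coords_def affine_deriv_def)
qed

lemma open_nth_nonzero: "open {z :: complex^'n. z $ i \<noteq> 0}"
proof -
  have "{z :: complex^'n. z $ i \<noteq> 0} = (\<lambda>z. z $ i) -` (- {0})" by auto
  then show ?thesis by (simp add: open_vimage_vec_nth open_Compl)
qed

lemma has_derivative_chart_hopf:
  assumes "z $ i \<noteq> 0"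
  shows "((\<lambda>z. chart i (hopf z)) has_derivative affine_deriv i z) (at z)"
  by (rule has_derivative_transform_within_open[OF has_derivative_affine_coords[OF assms]
        open_nth_nonzero[of i]]) (use assms in \<open>auto simp: chart_hopf\<close>)

text \<open>\<open>hopf\<close> is differentiated on all of \<complex>^4 minus the origin. So z may
  have any length and v need not be tangent to a sphere; in return the kernel becomes the whole
  complex line of z instead of the real line of i z.\<close>

lemma dhopf_nth:
  assumes "z \<noteq> 0"
  shows "dhopf z v $ j = (if z $ j \<noteq> 0 then affine_deriv j z v else 0)"
  using frechet_derivative_at[OF has_derivative_chart_hopf, of z j]
  by (auto simp: dhopf_def hopf_in_chart_dom[OF assms] o_def)

lemma affine_deriv_add: "affine_deriv i z (u + v) = affine_deriv i z u + affine_deriv i z v"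
  by (simp add: affine_deriv_def vec_eq_iff forall_3 diff_divide_distrib add_divide_distrib algebra_simps)

lemma affine_deriv_smult: "affine_deriv i z (c *s v) = c *s affine_deriv i z v"
  by (simp add: affine_deriv_def vec_eq_iff forall_3 diff_divide_distrib algebra_simps)

lemma linear_dhopf: "z \<noteq> 0 \<Longrightarrow> linear (dhopf z)"
  by (rule linearI) (simp_all add: vec_eq_iff[where ?'b=4] dhopf_nth affine_deriv_add scaleR_eq_smult affine_deriv_smult)

lemma affine_deriv_eq_0:
  assumes "z $ i \<noteq> 0"
  shows "affine_deriv i z v = 0 \<longleftrightarrow> v = (v $ i / z $ i) *s z"
proof
  assume "affine_deriv i z v = 0"
  then have *: "v $ (i+1) * z $ i = z $ (i+1) * v $ i" "v $ (i+2) * z $ i = z $ (i+2) * v $ i"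
    "v $ (i+3) * z $ i = z $ (i+3) * v $ i"
    using assms by (simp_all add: affine_deriv_def vec_eq_iff forall_3)
  have "v $ k = (v $ i / z $ i) * z $ k" for k
    using index4_cases[of k i]
    by (elim disjE) (use * assms in \<open>simp_all add: nonzero_eq_divide_eq mult.commute\<close>)
  then show "v = (v $ i / z $ i) *s z" unfolding vec_eq_iff vector_smult_component by blast
next
  assume v: "v = (v $ i / z $ i) *s z"
  have "affine_deriv i z z = 0" by (simp add: affine_deriv_def vec_eq_iff forall_3)
  then show "affine_deriv i z v = 0" by (subst v) (simp add: affine_deriv_smult)
qed

lemma dhopf_eq_0_iff:
  assumes "z \<noteq> 0"
  shows "dhopf z v = 0 \<longleftrightarrow> (\<exists>c. v = c *s z)"
proof
  assume v: "dhopf z v = 0"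
  obtain i where i: "z $ i \<noteq> 0" using vec4_nonzeroD[OF assms] by blast
  then have "affine_deriv i z v = 0" using v dhopf_nth[OF assms, of v i] by simp
  then show "\<exists>c. v = c *s z" using affine_deriv_eq_0[OF i] by blast
next
  assume "\<exists>c. v = c *s z"
  then obtain c where c: "v = c *s z" by blast
  have "affine_deriv i z v = 0" if "z $ i \<noteq> 0" for i
    unfolding affine_deriv_eq_0[OF that] using that by (simp add: c)
  then show "dhopf z v = 0" by (simp add: vec_eq_iff[where ?'b=4] dhopf_nth[OF assms])
qed

lemma dhopf_eq_iff:
  assumes "z \<noteq> 0"
  shows "dhopf z u = dhopf z v \<longleftrightarrow> (\<exists>c. u = v + c *s z)"
  using dhopf_eq_0_iff[OF assms, of "u - v"] linear_diff[OF linear_dhopf[OF assms], of u v]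
  by (simp add: algebra_simps)

lemma affine_deriv_scale:
  assumes "c \<noteq> 0"
  shows "affine_deriv i (c *s z) (c *s v) = affine_deriv i z v"
proof -
  have "(c * a * (c * b) - c * d * (c * e)) / (c * b)\<^sup>2 = (a * b - d * e) / b\<^sup>2" for a b d e :: complex
  proof -
    have "c * a * (c * b) - c * d * (c * e) = c\<^sup>2 * (a * b - d * e)" by (simp add: power2_eq_square algebra_simps)
    then show ?thesis using assms by (simp add: power_mult_distrib)
  qed
  then show ?thesis by (simp add: affine_deriv_def)
qed

lemma dhopf_smult:
  assumes "c \<noteq> 0" "z \<noteq> 0"
  shows "dhopf (c *s z) (c *s v) = dhopf z v"
proof -
  have "c *s z \<noteq> 0" using assms by auto
  then show ?thesis using assms
    by (simp add: vec_eq_iff[where ?'b=4] dhopf_nth affine_deriv_scale)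
qed

text \<open>The transition map from chart \<open>i\<close> to chart \<open>j\<close> is differentiated by lifting it to \<open>\<complex>\<^sup>4\<close>.\<close>

lemma affine_section_has_derivative:
  "(affine_section i has_derivative (\<lambda>w. affine_section i w - axis i 1)) (at x)"
proof (rule has_derivative_vec)
  fix k
  have d: "((\<lambda>x. x $ m) has_derivative (\<lambda>v. v $ m)) (at x)" for m :: 3
    using bounded_linear.has_derivative[OF bounded_linear_vec_nth has_derivative_ident] .
  show "((\<lambda>x. affine_section i x $ k) has_derivative (\<lambda>w. (affine_section i w - axis i 1) $ k)) (at x)"
    using index4_cases[of k i] by (elim disjE) (simp_all add: affine_section_def axis_def d)
qed

lemma chart_comp_differentiable:
  assumes "z $ i \<noteq> 0" "z $ j \<noteq> 0"
  shows "(chart j \<circ> chart_inv i) differentiable (at (affine_coords i z))"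
proof -
  let ?s = "affine_section i (affine_coords i z)"
  have "?s $ j \<noteq> 0"
    using affine_section_coords[OF assms(1)] assms by (metis mult_eq_0_iff vector_smult_component)
  from has_derivative_compose[OF affine_section_has_derivative has_derivative_chart_hopf[OF this]]
  show ?thesis by (auto simp: o_def chart_inv_eq differentiable_def)
qed

text \<open>No formula for the transition map is needed: near z it composes with
  \<open>affine_coords i\<close> to chart j after \<open>hopf\<close>, and both sides are
  derivatives of this one map.\<close>

lemma frechet_transition:
  assumes "z $ i \<noteq> 0" "z $ j \<noteq> 0"
  shows "frechet_derivative (chart j \<circ> chart_inv i) (at (affine_coords i z)) (affine_deriv i z v) = affine_deriv j z v"
proof -
  have d: "((chart j \<circ> chart_inv i) has_derivative frechet_derivative (chart j \<circ> chart_inv i) (at (affine_coords i z)))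
      (at (affine_coords i z))"
    using chart_comp_differentiable[OF assms] frechet_derivative_works by blast
  have "((\<lambda>z. (chart j \<circ> chart_inv i) (affine_coords i z)) has_derivative
      (\<lambda>v. frechet_derivative (chart j \<circ> chart_inv i) (at (affine_coords i z)) (affine_deriv i z v))) (at z)"
    using has_derivative_compose[OF has_derivative_affine_coords[OF assms(1)] d] .
  then have "((\<lambda>z. chart j (hopf z)) has_derivative
      (\<lambda>v. frechet_derivative (chart j \<circ> chart_inv i) (at (affine_coords i z)) (affine_deriv i z v))) (at z)"
    by (rule has_derivative_transform_within_open[OF _ open_nth_nonzero[of i]])
      (use assms in \<open>auto simp: chart_inv_chart_hopf\<close>)
  from fun_cong[OF has_derivative_unique[OF this has_derivative_chart_hopf[OF assms(2)]], of v] show ?thesis by simp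
qed

lemma affine_deriv_surj:
  assumes "z $ i \<noteq> 0"
  obtains v where "affine_deriv i z v = w"
proof
  \<comment> \<open>The vector has coordinate 0 at i and w elsewhere; the factor z $ i cancels
    against the denominator.\<close>
  show "affine_deriv i z (z $ i *s (affine_section i w - axis i 1)) = w"
    using assms by (simp add: affine_deriv_def affine_section_def axis_def vec_eq_iff forall_3 power2_eq_square)
qed

text \<open>From here on a tangent vector is handled through a representative in \<complex>^4. One
  chart component can be lifted because \<open>affine_deriv\<close> is onto, and the transition rule
  determines the others.\<close>

lemma tangent_space_hopf:
  assumes "z \<noteq> 0"
  shows "tangent_space (hopf z) = range (dhopf z)"
proof
  show "range (dhopf z) \<subseteq> tangent_space (hopf z)"
    using frechet_transition assms
    by (auto simp: tangent_space_def dhopf_nth hopf_in_chart_dom chart_hopf)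
next
  show "tangent_space (hopf z) \<subseteq> range (dhopf z)"
  proof
    fix X assume X: "X \<in> tangent_space (hopf z)"
    obtain i where i: "z $ i \<noteq> 0" using vec4_nonzeroD[OF assms] by blast
    obtain v where v: "affine_deriv i z v = X $ i" using affine_deriv_surj[OF i] by blast
    have "X $ j = dhopf z v $ j" for j
    proof (cases "z $ j = 0")
      case True
      then show ?thesis using X assms by (simp add: tangent_space_def dhopf_nth hopf_in_chart_dom)
    next
      case False
      then have "X $ j = frechet_derivative (chart j \<circ> chart_inv i) (at (chart i (hopf z))) (X $ i)"
        using X i hopf_in_chart_dom[OF assms] unfolding tangent_space_def by blast
      then show ?thesis
        using frechet_transition[OF i False, of v] v i False assms by (simp add: dhopf_nth chart_hopf)
    qed
    then have "X = dhopf z v" by (simp add: vec_eq_iff[where ?'b=4])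
    then show "X \<in> range (dhopf z)" by blast
  qed
qed

lemma smooth_map_differentiable:
  assumes "smooth_map \<phi>" "z $ i \<noteq> 0" "\<phi> (hopf z) \<in> chart_dom j"
  shows "(chart j \<circ> \<phi> \<circ> chart_inv i) differentiable (at (affine_coords i z))"
proof -
  define S where "S = chart i ` (chart_dom i \<inter> \<phi> -` chart_dom j)"
  have "z \<noteq> 0" using assms(2) by auto
  then have "affine_coords i z \<in> S"
    unfolding S_def using assms(2,3) by (intro image_eqI[of _ _ "hopf z"]) (auto simp: chart_hopf hopf_in_chart_dom)
  moreover have "Ck_on (Suc 0) S (chart j \<circ> \<phi> \<circ> chart_inv i)"
    using assms(1) unfolding smooth_map_def smooth_on_def S_def Let_def by blast
  ultimately show ?thesis by simp
qed

text \<open>Any two parametrizations \<sigma> and \<tau> with \<open>hopf\<close> after \<tau> equal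
  to \<phi> after \<open>hopf\<close> after \<sigma> compute the differential of \<phi>. In each
  chart this is uniqueness of the derivative of one map written in two ways, so the chart chosen in
  \<open>dmap\<close> disappears.\<close>

lemma dmap_dhopf:
  fixes \<sigma> \<tau> :: "'a::real_normed_vector \<Rightarrow> complex^4"
  assumes \<phi>: "smooth_map \<phi>" and U: "open U" "x \<in> U"
    and lift: "\<And>y. y \<in> U \<Longrightarrow> \<phi> (hopf (\<sigma> y)) = hopf (\<tau> y)" "\<sigma> x \<noteq> 0" "\<tau> x \<noteq> 0"
    and d: "(\<sigma> has_derivative \<sigma>') (at x)" "(\<tau> has_derivative \<tau>') (at x)"
  shows "dmap \<phi> (hopf (\<sigma> x)) (dhopf (\<sigma> x) (\<sigma>' u)) = dhopf (\<tau> x) (\<tau>' u)"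
proof -
  define i where "i = (SOME i. hopf (\<sigma> x) \<in> chart_dom i)"
  obtain i' where "\<sigma> x $ i' \<noteq> 0" using vec4_nonzeroD[OF lift(2)] by blast
  then have "hopf (\<sigma> x) \<in> chart_dom i'" by (simp add: hopf_in_chart_dom lift(2))
  then have "hopf (\<sigma> x) \<in> chart_dom i" unfolding i_def by (rule someI)
  then have i: "\<sigma> x $ i \<noteq> 0" by (simp add: hopf_in_chart_dom lift(2))
  have "dmap \<phi> (hopf (\<sigma> x)) (dhopf (\<sigma> x) (\<sigma>' u)) $ j = dhopf (\<tau> x) (\<tau>' u) $ j" for j
  proof (cases "\<tau> x $ j = 0")
    case True
    then show ?thesis
      using lift(1)[OF U(2)] by (simp add: dmap_def Let_def dhopf_nth lift(2,3) hopf_in_chart_dom)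
  next
    case False
    let ?f = "chart j \<circ> \<phi> \<circ> chart_inv i"
    have dj: "\<phi> (hopf (\<sigma> x)) \<in> chart_dom j"
      using False by (simp add: lift(1)[OF U(2)] hopf_in_chart_dom lift(3))
    have df: "(?f has_derivative frechet_derivative ?f (at (affine_coords i (\<sigma> x)))) (at (affine_coords i (\<sigma> x)))"
      using smooth_map_differentiable[OF \<phi> i dj] frechet_derivative_works by blast
    have 1: "((\<lambda>y. ?f (affine_coords i (\<sigma> y))) has_derivative
       (\<lambda>u. frechet_derivative ?f (at (affine_coords i (\<sigma> x))) (affine_deriv i (\<sigma> x) (\<sigma>' u)))) (at x)"
      using has_derivative_compose[OF has_derivative_compose[OF d(1) has_derivative_affine_coords[OF i]] df] .
    have 2: "((\<lambda>y. chart j (hopf (\<tau> y))) has_derivative (\<lambda>u. affine_deriv j (\<tau> x) (\<tau>' u))) (at x)"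
      using has_derivative_compose[OF d(2) has_derivative_chart_hopf[OF False]] .
    have "((\<lambda>y. \<sigma> y $ i) \<longlongrightarrow> \<sigma> x $ i) (nhds x)"
      using has_derivative_continuous[OF d(1)] isCont_def tendsto_vec_nth tendsto_nhds_iff by metis
    then have "\<forall>\<^sub>F y in nhds x. \<sigma> y $ i \<noteq> 0"
      using i by (rule tendsto_imp_eventually_ne)
    moreover have "\<forall>\<^sub>F y in nhds x. y \<in> U" using U by (rule eventually_nhds_in_open)
    ultimately have ev: "\<forall>\<^sub>F y in at x. ?f (affine_coords i (\<sigma> y)) = chart j (hopf (\<tau> y))"
      unfolding eventually_at_filter by eventually_elim (simp add: chart_inv_chart_hopf lift(1))
    have "((\<lambda>y. chart j (hopf (\<tau> y))) has_derivative
       (\<lambda>u. frechet_derivative ?f (at (affine_coords i (\<sigma> x))) (affine_deriv i (\<sigma> x) (\<sigma>' u)))) (at x)"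
      by (rule has_derivative_transform_eventually[OF 1 ev])
        (use i U in \<open>auto simp: chart_inv_chart_hopf lift(1)\<close>)
    from fun_cong[OF has_derivative_unique[OF this 2], of u] have "frechet_derivative ?f (at (affine_coords i (\<sigma> x))) (affine_deriv i (\<sigma> x) (\<sigma>' u))
       = affine_deriv j (\<tau> x) (\<tau>' u)" by simp
    then show ?thesis
      using i False dj by (simp add: dmap_def Let_def flip: i_def) (simp add: dhopf_nth lift(2,3) chart_hopf)
  qed
  then show ?thesis by (simp add: vec_eq_iff[where ?'b=4])
qed

section \<open>The metrics in homogeneous coordinates\<close>

definition herm :: "complex^'n \<Rightarrow> complex^'n \<Rightarrow> complex" where
  "herm u v = (\<Sum>k\<in>UNIV. u $ k * cnj (v $ k))"

lemma herm_add_left: "herm (u + v) w = herm u w + herm v w"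
  by (simp add: herm_def sum.distrib algebra_simps)

lemma herm_add_right: "herm w (u + v) = herm w u + herm w v"
  by (simp add: herm_def sum.distrib algebra_simps)

lemma herm_smult_left: "herm (c *s u) w = c * herm u w"
  by (simp add: herm_def sum_distrib_left algebra_simps)

lemma herm_smult_right: "herm w (c *s u) = cnj c * herm w u"
  by (simp add: herm_def sum_distrib_left algebra_simps)

lemma herm_diff_left: "herm (u - v) w = herm u w - herm v w"
  by (simp add: herm_def sum_subtractf algebra_simps)

lemma herm_diff_right: "herm w (u - v) = herm w u - herm w v"
  by (simp add: herm_def sum_subtractf algebra_simps)

lemmas herm_simps = herm_add_left herm_add_right herm_smult_left herm_smult_right herm_diff_left herm_diff_right

lemma cnj_herm: "cnj (herm u v) = herm v u"
  by (simp add: herm_def cnj_sum mult.commute)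

lemma inner_eq_Re_herm: "u \<bullet> v = Re (herm u v)"
  by (simp add: herm_def inner_vec_def inner_complex_def)

lemma herm_self: "herm u u = complex_of_real ((norm u)\<^sup>2)"
proof -
  have "herm u u = complex_of_real (\<Sum>k\<in>UNIV. (norm (u $ k))\<^sup>2)"
    unfolding herm_def of_real_sum by (intro sum.cong) (simp_all add: complex_norm_square[symmetric])
  then show ?thesis by (simp add: norm_vec_def L2_set_def sum_nonneg)
qed

section \<open>Left multiplication by j as a conjugate-linear map\<close>

abbreviation J :: "complex^4 \<Rightarrow> complex^4" where "J \<equiv> lmul quat_j"

lemma lmul_quat_i: "lmul quat_i z = \<i> *s z"
  by (simp add: vec_eq_iff forall_4 lmul_def quat_mult_def quat_i_def Let_def)

lemma J_nth [simp]: "J z $ 1 = - cnj (z $ 2)" "J z $ 2 = cnj (z $ 1)" "J z $ 3 = - cnj (z $ 4)" "J z $ 4 = cnj (z $ 3)"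
  by (simp_all add: lmul_def quat_mult_def quat_j_def Let_def)

lemma lmul_quat_k: "lmul quat_k z = \<i> *s J z"
  by (simp add: vec_eq_iff forall_4 lmul_def quat_mult_def quat_k_def quat_i_def quat_j_def Let_def)

lemma J_smult: "J (c *s z) = cnj c *s J z"
  unfolding vec_eq_iff forall_4 J_nth vector_smult_component by simp

lemma J_add: "J (u + v) = J u + J v"
  unfolding vec_eq_iff forall_4 vector_add_component J_nth by simp

lemma J_J: "J (J z) = - z"
  unfolding vec_eq_iff forall_4 vector_uminus_component J_nth by simp

lemma herm4: "herm (u :: complex^4) v = u $ 1 * cnj (v $ 1) + u $ 2 * cnj (v $ 2) + u $ 3 * cnj (v $ 3) + u $ 4 * cnj (v $ 4)"
  unfolding herm_def sum_4 ..

lemma herm_J_J: "herm (J u) (J v) = herm v u"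
  unfolding herm4 J_nth by (simp add: algebra_simps)

text \<open>Up to conjugation this form is the complex symplectic form on \<complex>^4; its skewness
  is why z and \<open>J z\<close> are Hermitian orthogonal.\<close>

lemma herm_J_left: "herm (J u) v = - herm (J v) u"
  unfolding herm4 J_nth by (simp add: algebra_simps)

lemma herm_J_self [simp]: "herm (J z) z = 0" "herm z (J z) = 0"
  unfolding herm4 J_nth by (simp_all add: algebra_simps)

lemma in_orthogonal_comp_span: "v \<in> orthogonal_comp (span S) \<longleftrightarrow> (\<forall>s\<in>S. s \<bullet> v = 0)"
proof
  assume *: "\<forall>s\<in>S. s \<bullet> v = 0"
  have "orthogonal v x" if "x \<in> span S" for x
    by (rule orthogonal_to_span[OF that]) (use * in \<open>auto simp: orthogonal_def inner_commute\<close>)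
  then show "v \<in> orthogonal_comp (span S)"
    by (auto simp: orthogonal_comp_def orthogonal_commute)
qed (auto simp: orthogonal_comp_def orthogonal_def span_base)

text \<open>Applied to \<open>J q\<close>, it turns the real span of j q and k q = i (j q) into a
  complex line.\<close>

lemma span_complex_line: "span {z, \<i> *s z} = range (\<lambda>c. c *s (z :: complex^'n))"
proof
  have "subspace (range (\<lambda>c. c *s z))"
    unfolding subspace_def
  proof (intro conjI ballI allI)
    show "0 \<in> range (\<lambda>c. c *s z)" by (rule range_eqI[of _ _ 0]) simp
    fix x y and r :: real assume "x \<in> range (\<lambda>c. c *s z)" "y \<in> range (\<lambda>c. c *s z)"
    then obtain c d where "x = c *s z" "y = d *s z" by auto
    then have "x + y = (c + d) *s z" "r *\<^sub>R x = (complex_of_real r * c) *s z"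
      by (simp_all add: scaleR_eq_smult vector_sadd_rdistrib)
    then show "x + y \<in> range (\<lambda>c. c *s z)" "r *\<^sub>R x \<in> range (\<lambda>c. c *s z)" by blast+
  qed
  moreover have "{z, \<i> *s z} \<subseteq> range (\<lambda>c. c *s z)"
    using range_eqI[of z "\<lambda>c. c *s z" 1] by auto
  ultimately show "span {z, \<i> *s z} \<subseteq> range (\<lambda>c. c *s z)" by (rule span_minimal[rotated])
  have "c *s z = Re c *\<^sub>R z + Im c *\<^sub>R (\<i> *s z)" for c
    unfolding scaleR_eq_smult vector_smult_assoc vector_sadd_rdistrib[symmetric]
    by (rule arg_cong[of _ _ "\<lambda>c. c *s z"]) (simp add: complex_eq_iff)
  moreover have "Re c *\<^sub>R z + Im c *\<^sub>R (\<i> *s z) \<in> span {z, \<i> *s z}" for c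
    by (intro span_add span_scale span_base) simp_all
  ultimately show "range (\<lambda>c. c *s z) \<subseteq> span {z, \<i> *s z}"
    by (metis image_subsetI)
qed

lemma horizontal_iff: "v \<in> horizontal q \<longleftrightarrow> herm v q = 0"
proof -
  have "v \<in> horizontal q \<longleftrightarrow> Re (herm q v) = 0 \<and> Re (\<i> * herm q v) = 0"
    by (simp add: horizontal_def sphere_tangent_def in_orthogonal_comp_span orthogonal_def
        inner_eq_Re_herm lmul_quat_i herm_simps)
  also have "\<dots> \<longleftrightarrow> herm q v = 0" by (auto simp: complex_eq_iff)
  also have "\<dots> \<longleftrightarrow> herm v q = 0" using cnj_herm[of v q] by (metis complex_cnj_zero_iff)
  finally show ?thesis .
qed

lemma unit_fibre:
  assumes "norm q = 1" "norm q' = 1" "hopf q' = hopf q"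
  obtains c where "norm c = 1" "q' = c *s q"
proof -
  have "q \<noteq> 0" "q' \<noteq> 0" using assms by auto
  then obtain c where "q' = c *s q" using hopf_eq_iff[of q q'] assms(3) by metis
  moreover from this have "norm c = 1" using assms by (simp add: norm_smult_complex)
  ultimately show ?thesis using that by blast
qed

text \<open>Since \<open>J (c *s q) = cnj c *s J q\<close>, the line of \<open>J q\<close> is the
  same along the fibre, and \<open>dhopf_smult\<close> identifies its images; the union over the
  fibre therefore collapses to the contribution of one q.\<close>

lemma dist1_hopf:
  assumes "norm q = 1"
  shows "dist1 (hopf q) = range (\<lambda>c. dhopf q (c *s J q))"
proof -
  have q: "q \<noteq> 0" using assms by auto
  have fib: "dhopf q' ` span {lmul quat_j q', lmul quat_k q'} = range (\<lambda>c. dhopf q' (c *s J q'))" for q'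
    unfolding lmul_quat_k span_complex_line by auto
  have "dhopf (c *s q) (d *s J (c *s q)) = dhopf q ((d * cnj c / c) *s J q)" if "norm c = 1" for c d
  proof -
    have c: "c \<noteq> 0" using that by auto
    have eq: "d *s J (c *s q) = c *s ((d * cnj c / c) *s J q)"
      using c by (simp add: J_smult vector_smult_assoc)
    show ?thesis unfolding eq by (rule dhopf_smult[OF c q])
  qed
  then have sub: "range (\<lambda>d. dhopf (c *s q) (d *s J (c *s q))) \<subseteq> range (\<lambda>c. dhopf q (c *s J q))"
    if "norm c = 1" for c
    using that by blast
  have fib_sub: "range (\<lambda>d. dhopf q' (d *s J q')) \<subseteq> range (\<lambda>c. dhopf q (c *s J q))"
    if "norm q' = 1" "hopf q' = hopf q" for q'
    by (rule unit_fibre[OF assms that]) (simp add: sub)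
  then show ?thesis using assms unfolding dist1_def fib by fastforce
qed

lemma dist2_hopf:
  assumes "norm q = 1"
  shows "dist2 (hopf q) = dhopf q ` {v. herm v q = 0 \<and> herm v (J q) = 0}"
proof -
  have q: "q \<noteq> 0" using assms by auto
  have z: "Re w = 0 \<and> Re (\<i> * w) = 0 \<longleftrightarrow> w = 0" for w by (auto simp: complex_eq_iff)
  have fib: "sphere_tangent q' \<inter> orthogonal_comp (span {lmul quat_i q', lmul quat_j q', lmul quat_k q'})
      = {v. herm v q' = 0 \<and> herm v (J q') = 0}" for q'
  proof -
    have "v \<in> sphere_tangent q' \<inter> orthogonal_comp (span {lmul quat_i q', lmul quat_j q', lmul quat_k q'})
      \<longleftrightarrow> (Re (herm q' v) = 0 \<and> Re (\<i> * herm q' v) = 0) \<and> (Re (herm (J q') v) = 0 \<and> Re (\<i> * herm (J q') v) = 0)" for v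
      by (auto simp: sphere_tangent_def in_orthogonal_comp_span orthogonal_def
        inner_eq_Re_herm lmul_quat_i lmul_quat_k herm_simps)
    moreover have "herm q' v = 0 \<longleftrightarrow> herm v q' = 0" for v q' :: "complex^4"
      using cnj_herm[of v q'] by (metis complex_cnj_zero_iff)
    ultimately show ?thesis unfolding z by blast
  qed
  have sub: "dhopf (c *s q) ` {v. herm v (c *s q) = 0 \<and> herm v (J (c *s q)) = 0} \<subseteq> dhopf q ` {v. herm v q = 0 \<and> herm v (J q) = 0}"
    if "norm c = 1" for c
  proof
    fix X assume "X \<in> dhopf (c *s q) ` {v. herm v (c *s q) = 0 \<and> herm v (J (c *s q)) = 0}"
    then obtain v where v: "X = dhopf (c *s q) v" "herm v (c *s q) = 0" "herm v (J (c *s q)) = 0" by auto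
    have c: "c \<noteq> 0" using that by auto
    have "v = c *s (inverse c *s v)" using c by (simp add: vector_smult_assoc)
    then have "X = dhopf q (inverse c *s v)" using v(1) dhopf_smult[OF c q] by metis
    then show "X \<in> dhopf q ` {v. herm v q = 0 \<and> herm v (J q) = 0}"
      using v c by (intro image_eqI[of _ _ "inverse c *s v"]) (auto simp: herm_simps J_smult)
  qed
  have fib_sub: "dhopf q' ` {v. herm v q' = 0 \<and> herm v (J q') = 0} \<subseteq> dhopf q ` {v. herm v q = 0 \<and> herm v (J q) = 0}"
    if "norm q' = 1" "hopf q' = hopf q" for q'
    by (rule unit_fibre[OF assms that]) (simp add: sub)
  then show ?thesis using assms unfolding dist2_def fib by fastforce
qed

text \<open>The pull-back of the metric along \<open>hopf\<close>, in the form a g_1 + (1 - a) g_1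
  restricted to the D_1 components. The denominators extend it from unit vectors so that it is
  invariant under a common scaling of z, u and v.\<close>

definition metric_lift :: "real \<Rightarrow> complex^4 \<Rightarrow> complex^4 \<Rightarrow> complex^4 \<Rightarrow> real" where
  "metric_lift a z u v =
    a * (Re (herm u v) / (norm z)^2 - Re (herm u z * cnj (herm v z)) / (norm z)^4) +
    (1 - a) * (Re (herm u (J z) * cnj (herm v (J z))) / (norm z)^4)"

text \<open>The horizontal representative of \<open>dhopf q u\<close> is u minus its component along
  q. At another point of the fibre it is multiplied by a phase, which the inner product does not
  see; this settles the definite description.\<close>

lemma fubini_study_hopf:
  assumes "norm q = 1"
  shows "fubini_study (hopf q) (dhopf q u) (dhopf q v) = Re (herm u v) - Re (herm u q * cnj (herm v q))"
proof -
  have q: "q \<noteq> 0" using assms by auto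
  have qq: "herm q q = 1" using assms by (simp add: herm_self)
  define h where "h u = u - herm u q *s q" for u
  have hh: "herm (h u) q = 0" for u by (simp add: h_def herm_simps qq)
  have dh: "dhopf q (h u) = dhopf q u" for u
    unfolding dhopf_eq_iff[OF q] by (rule exI[of _ "- herm u q"]) (simp add: h_def vec_eq_iff)
  have val: "h u \<bullet> h v = Re (herm u v) - Re (herm u q * cnj (herm v q))"
    by (simp add: inner_eq_Re_herm h_def herm_simps qq cnj_herm)
  have uniq: "u' = c *s h u" if "norm c = 1" "herm u' (c *s q) = 0" "dhopf (c *s q) u' = dhopf q u" for c u u'
  proof -
    have c: "c \<noteq> 0" using that by auto
    define w where "w = inverse c *s u'"
    have w: "u' = c *s w" using c by (simp add: w_def vector_smult_assoc)
    have "herm w q = 0" using that(2) c by (simp add: w herm_simps)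
    have "dhopf q w = dhopf q u" using that(3) dhopf_smult[OF c q] by (simp add: w)
    then obtain d where d: "w = u + d *s q" using dhopf_eq_iff[OF q] by blast
    then have "d = - herm u q" using \<open>herm w q = 0\<close> by (simp add: herm_simps qq add_eq_0_iff)
    then have "w = h u" by (simp add: d h_def vec_eq_iff)
    then show ?thesis by (simp add: w)
  qed
  show ?thesis unfolding fubini_study_def
  proof (rule the_equality)
    show "\<exists>q'\<in>sphere 0 1. \<exists>u'\<in>horizontal q'. \<exists>v'\<in>horizontal q'. hopf q' = hopf q \<and> dhopf q' u' = dhopf q u \<and>
       dhopf q' v' = dhopf q v \<and> Re (herm u v) - Re (herm u q * cnj (herm v q)) = u' \<bullet> v'"
      by (rule bexI[of _ q], rule bexI[of _ "h u"], rule bexI[of _ "h v"])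
        (use assms in \<open>auto simp: horizontal_iff hh dh val\<close>)
  next
    fix r
    assume "\<exists>q'\<in>sphere 0 1. \<exists>u'\<in>horizontal q'. \<exists>v'\<in>horizontal q'. hopf q' = hopf q \<and> dhopf q' u' = dhopf q u \<and>
       dhopf q' v' = dhopf q v \<and> r = u' \<bullet> v'"
    then obtain q' u' v' where *: "norm q' = 1" "herm u' q' = 0" "herm v' q' = 0" "hopf q' = hopf q"
      "dhopf q' u' = dhopf q u" "dhopf q' v' = dhopf q v" "r = u' \<bullet> v'"
      by (auto simp: horizontal_iff)
    obtain c where c: "norm c = 1" "q' = c *s q" by (rule unit_fibre[OF assms *(1,4)])
    have "u' = c *s h u" "v' = c *s h v" using uniq[OF c(1)] * c(2) by auto
    then have "r = Re (c * cnj c * herm (h u) (h v))" using *(7) by (simp add: inner_eq_Re_herm herm_simps algebra_simps)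
    also have "\<dots> = h u \<bullet> h v" using c(1) complex_norm_square[of c] by (simp add: inner_eq_Re_herm)
    finally show "r = Re (herm u v) - Re (herm u q * cnj (herm v q))" by (simp add: val)
  qed
qed

text \<open>Existence and uniqueness of the splitting, which give meaning to the definite
  descriptions in \<open>prod_struct\<close> and \<open>metric_a\<close>.\<close>

lemma tangent_decomposition:
  assumes "norm q = 1"
  shows "dhopf q (herm v (J q) *s J q) \<in> dist1 (hopf q)"
    and "dhopf q (v - herm v (J q) *s J q) \<in> dist2 (hopf q)"
    and "X1 \<in> dist1 (hopf q) \<Longrightarrow> X2 \<in> dist2 (hopf q) \<Longrightarrow> dhopf q v = X1 + X2 \<Longrightarrow>
      X1 = dhopf q (herm v (J q) *s J q) \<and> X2 = dhopf q (v - herm v (J q) *s J q)"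
proof -
  have q: "q \<noteq> 0" using assms by auto
  have qq: "herm q q = 1" "herm (J q) (J q) = 1" using assms herm_self[of q] by (simp_all add: herm_J_J)
  show 1: "dhopf q (herm v (J q) *s J q) \<in> dist1 (hopf q)"
    unfolding dist1_hopf[OF assms] by blast
  \<comment> \<open>Removing the component along q as well does not change the image and yields a
    representative as \<open>dist2\<close> demands.\<close>
  have "dhopf q (v - herm v (J q) *s J q) = dhopf q (v - herm v (J q) *s J q - herm v q *s q)"
    using dhopf_eq_iff[OF q] by (metis diff_add_cancel)
  then show "dhopf q (v - herm v (J q) *s J q) \<in> dist2 (hopf q)"
    unfolding dist2_hopf[OF assms]
    by (rule image_eqI) (simp add: herm_simps qq)
  assume X: "X1 \<in> dist1 (hopf q)" "X2 \<in> dist2 (hopf q)" "dhopf q v = X1 + X2"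
  obtain c w where cw: "X1 = dhopf q (c *s J q)" "X2 = dhopf q w" "herm w q = 0" "herm w (J q) = 0"
    using X(1,2) unfolding dist1_hopf[OF assms] dist2_hopf[OF assms] by auto
  then have "dhopf q v = dhopf q (c *s J q + w)" using X(3) linear_add[OF linear_dhopf[OF q]] by metis
  then obtain d where "v = c *s J q + w + d *s q" using dhopf_eq_iff[OF q] by blast
  then have "c = herm v (J q)" using cw(4) by (simp add: herm_simps qq)
  then show "X1 = dhopf q (herm v (J q) *s J q) \<and> X2 = dhopf q (v - herm v (J q) *s J q)"
    using X(3) cw(1) linear_diff[OF linear_dhopf[OF q]] by auto
qed

lemma metric_a_hopf_unit:
  assumes "norm q = 1"
  shows "metric_a a (hopf q) (dhopf q u) (dhopf q v) = metric_lift a q u v"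
proof -
  have q: "q \<noteq> 0" using assms by auto
  have qq: "herm q q = 1" "herm (J q) (J q) = 1" using assms herm_self[of q] by (simp_all add: herm_J_J)
  let ?p = "\<lambda>u. herm u (J q) *s J q"
  have "metric_a a (hopf q) (dhopf q u) (dhopf q v) =
     fubini_study (hopf q) (dhopf q (?p u)) (dhopf q (?p v)) +
     a * fubini_study (hopf q) (dhopf q (u - ?p u)) (dhopf q (v - ?p v))" (is "_ = ?r")
    unfolding metric_a_def
  proof (rule the_equality)
    have sum: "dhopf q u = dhopf q (?p u) + dhopf q (u - ?p u)" for u
      by (simp flip: linear_add[OF linear_dhopf[OF q]])
    show "\<exists>X1\<in>dist1 (hopf q). \<exists>X2\<in>dist2 (hopf q). \<exists>Y1\<in>dist1 (hopf q). \<exists>Y2\<in>dist2 (hopf q).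
       dhopf q u = X1 + X2 \<and> dhopf q v = Y1 + Y2 \<and> ?r = fubini_study (hopf q) X1 Y1 + a * fubini_study (hopf q) X2 Y2"
      using tangent_decomposition(1,2)[OF assms] sum by blast
  next
    fix r
    assume "\<exists>X1\<in>dist1 (hopf q). \<exists>X2\<in>dist2 (hopf q). \<exists>Y1\<in>dist1 (hopf q). \<exists>Y2\<in>dist2 (hopf q).
       dhopf q u = X1 + X2 \<and> dhopf q v = Y1 + Y2 \<and> r = fubini_study (hopf q) X1 Y1 + a * fubini_study (hopf q) X2 Y2"
    then obtain X1 X2 Y1 Y2 where X: "X1 \<in> dist1 (hopf q)" "X2 \<in> dist2 (hopf q)" "dhopf q u = X1 + X2"
      and Y: "Y1 \<in> dist1 (hopf q)" "Y2 \<in> dist2 (hopf q)" "dhopf q v = Y1 + Y2"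
      and r: "r = fubini_study (hopf q) X1 Y1 + a * fubini_study (hopf q) X2 Y2" by blast
    show "r = ?r" unfolding r using tangent_decomposition(3)[OF assms X] tangent_decomposition(3)[OF assms Y] by simp
  qed
  also have "\<dots> = metric_lift a q u v"
    unfolding fubini_study_hopf[OF assms] metric_lift_def using assms
    by (simp add: herm_simps qq cnj_herm algebra_simps)
  finally show ?thesis .
qed

text \<open>Each numerator scales by the power of |c| in its denominator. In the last term
  \<open>J\<close> conjugates c, so the two factors contribute c^2 and its conjugate.\<close>

lemma metric_lift_smult:
  assumes "c \<noteq> 0"
  shows "metric_lift a (c *s z) (c *s u) (c *s v) = metric_lift a z u v"
proof -
  have c: "c * cnj c = complex_of_real ((norm c)^2)" using complex_norm_square[of c] by simp
  have Re_r: "Re (complex_of_real r * w) = r * Re w" for r w by simp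
  have 1: "Re (cnj c * (c * w)) = (norm c)^2 * Re w" for w
  proof -
    have "cnj c * (c * w) = complex_of_real ((norm c)^2) * w" unfolding c[symmetric] by (simp add: mult.assoc mult.left_commute)
    then show ?thesis by (simp only: Re_r)
  qed
  have 2: "Re (cnj c * (c * w) * (c * (cnj c * w'))) = (norm c)^4 * Re (w * w')" for w w'
  proof -
    have "cnj c * (c * w) * (c * (cnj c * w')) = (c * cnj c)^2 * (w * w')" by (simp add: power2_eq_square algebra_simps)
    also have "\<dots> = complex_of_real ((norm c)^4) * (w * w')"
      unfolding c of_real_power[symmetric] by simp
    finally show ?thesis by (simp only: Re_r)
  qed
  have 3: "Re (c * (c * w) * (cnj c * (cnj c * w'))) = (norm c)^4 * Re (w * w')" for w w'
    using 2[of w w'] by (simp add: algebra_simps)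
  have F1: "Re (herm (c *s u) (c *s v)) = (norm c)^2 * Re (herm u v)"
    by (simp only: herm_smult_left herm_smult_right 1)
  have F2: "Re (herm (c *s u) (c *s z) * cnj (herm (c *s v) (c *s z))) = (norm c)^4 * Re (herm u z * cnj (herm v z))"
    by (simp only: herm_smult_left herm_smult_right complex_cnj_mult complex_cnj_cnj 2)
  have F3: "Re (herm (c *s u) (J (c *s z)) * cnj (herm (c *s v) (J (c *s z)))) =
      (norm c)^4 * Re (herm u (J z) * cnj (herm v (J z)))"
    by (simp only: herm_smult_left herm_smult_right J_smult complex_cnj_mult complex_cnj_cnj 3)
  show ?thesis
    unfolding metric_lift_def F1 F2 F3 norm_smult_complex power_mult_distrib using assms by simp
qed

lemma metric_a_hopf:
  assumes "z \<noteq> 0"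
  shows "metric_a a (hopf z) (dhopf z u) (dhopf z v) = metric_lift a z u v"
proof -
  define c where "c = complex_of_real (inverse (norm z))"
  have c: "c \<noteq> 0" using assms by (simp add: c_def)
  have "norm (c *s z) = 1" using assms by (simp add: c_def norm_smult_complex norm_inverse)
  from metric_a_hopf_unit[OF this] show ?thesis
    using dhopf_smult[OF c assms] hopf_smult[OF c assms] metric_lift_smult[OF c] by metis
qed

lemma prod_struct_hopf:
  assumes "norm q = 1"
  shows "prod_struct (hopf q) (dhopf q v) = dhopf q (v - (2 * herm v (J q)) *s J q)"
  unfolding prod_struct_def
proof (rule the_equality)
  have q: "q \<noteq> 0" using assms by auto
  let ?p = "herm v (J q) *s J q"
  have eq: "dhopf q (v - (2 * herm v (J q)) *s J q) = - dhopf q ?p + dhopf q (v - ?p)"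
  proof -
    have "v - (2 * herm v (J q)) *s J q = - ?p + (v - ?p)"
      by (simp add: vec_eq_iff)
    then show ?thesis using linear_add[OF linear_dhopf[OF q]] linear_neg[OF linear_dhopf[OF q]] by metis
  qed
  have "dhopf q v = dhopf q ?p + dhopf q (v - ?p)"
    by (simp flip: linear_add[OF linear_dhopf[OF q]])
  then show "\<exists>X1\<in>dist1 (hopf q). \<exists>X2\<in>dist2 (hopf q). dhopf q v = X1 + X2 \<and>
      dhopf q (v - (2 * herm v (J q)) *s J q) = - X1 + X2"
    using tangent_decomposition(1,2)[OF assms] eq by blast
  fix Y
  assume "\<exists>X1\<in>dist1 (hopf q). \<exists>X2\<in>dist2 (hopf q). dhopf q v = X1 + X2 \<and> Y = - X1 + X2"
  then obtain X1 X2 where X: "X1 \<in> dist1 (hopf q)" "X2 \<in> dist2 (hopf q)" "dhopf q v = X1 + X2"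
    and Y: "Y = - X1 + X2" by blast
  show "Y = dhopf q (v - (2 * herm v (J q)) *s J q)"
    unfolding Y eq using tangent_decomposition(3)[OF assms X] by simp
qed

section \<open>Curvature of the metrics\<close>

definition twist_form :: "complex^3 \<Rightarrow> complex^3 \<Rightarrow> complex^3" where
  "twist_form x u = vector [0, x $ 1 * cnj (u $ 3), - (x $ 1 * cnj (u $ 2))]"

lemma twist_form_nth [simp]: "twist_form x u $ 1 = 0" "twist_form x u $ 2 = x $ 1 * cnj (u $ 3)"
  "twist_form x u $ 3 = - (x $ 1 * cnj (u $ 2))"
  by (simp_all add: twist_form_def)

lemma bounded_bilinear_twist_form: "bounded_bilinear twist_form"
  unfolding bilinear_conv_bounded_bilinear[symmetric] bilinear_def
  by (auto intro!: linearI simp: vec_eq_iff forall_3 complex_eq_iff algebra_simps)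

text \<open>Tangent to the identity at 0. With e u = x2 u3 - x3 u2 the affine expression of the
  metric has the linear term (1 - a) (u1 \<bullet> e v + e u \<bullet> v1). The quadratic correction
  adds - a c times the same bracket, so c = (1 - a) / a removes it.\<close>

definition twist :: "real \<Rightarrow> complex^3 \<Rightarrow> complex^3" where
  "twist c x = x + c *\<^sub>R twist_form x x"

definition dtwist :: "real \<Rightarrow> complex^3 \<Rightarrow> complex^3 \<Rightarrow> complex^3" where
  "dtwist c x u = u + c *\<^sub>R (twist_form x u + twist_form u x)"

lemma has_derivative_twist: "(twist c has_derivative dtwist c x) (at x)"
  using has_derivative_add[OF has_derivative_ident
      has_derivative_scaleR_right[OF bounded_bilinear.FDERIV[OF bounded_bilinear_twist_form
          has_derivative_ident has_derivative_ident], of c x UNIV]]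
  by (simp add: twist_def[abs_def] dtwist_def[abs_def])

text \<open>For fixed first coordinate the equations x2 + c w1 cnj x3 = w2 and x3 - c w1 cnj x2 = w3
  are real-linear with determinant factor 1 + c^2 |w1|^2. As this never vanishes, the inverse is
  globally defined and smooth.\<close>

definition untwist :: "real \<Rightarrow> complex^3 \<Rightarrow> complex^3" where
  "untwist c w = (let d = inverse (1 + of_real c * w $ 1 * (of_real c * cnj (w $ 1))) in
     vector [w $ 1, d * (w $ 2 - of_real c * w $ 1 * cnj (w $ 3)), d * (w $ 3 + of_real c * w $ 1 * cnj (w $ 2))])"

lemma twist_denominator: "1 + of_real c * z * (of_real c * cnj z) \<noteq> (0 :: complex)"
proof -
  have "of_real c * z * (of_real c * cnj z) = complex_of_real ((c * norm z)\<^sup>2)"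
    using complex_norm_square[of z] by (simp add: power_mult_distrib power2_eq_square algebra_simps)
  then have "1 + of_real c * z * (of_real c * cnj z) = complex_of_real (1 + (c * norm z)\<^sup>2)" by simp
  moreover have "1 + (c * norm z)\<^sup>2 > 0" by (simp add: add_pos_nonneg)
  ultimately show ?thesis by (metis of_real_eq_0_iff less_irrefl)
qed

lemma twist_untwist: "twist c (untwist c w) = w"
proof -
  define N where "N = 1 + of_real c * w $ 1 * (of_real c * cnj (w $ 1))"
  define d where "d = inverse N"
  have N: "d * N = 1" using twist_denominator[of c "w $ 1"] by (simp add: d_def N_def)
  have "cnj N = N" by (simp add: N_def mult_ac)
  then have "cnj d = d" by (simp add: d_def)
  then have *: "twist c (untwist c w) $ 2 = d * N * w $ 2" "twist c (untwist c w) $ 3 = d * N * w $ 3"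
    by (simp_all add: twist_def untwist_def Let_def flip: N_def d_def)
      (simp_all add: N_def scaleR_conv_of_real algebra_simps)
  have "twist c (untwist c w) $ 1 = w $ 1" by (simp add: twist_def untwist_def Let_def)
  then show ?thesis unfolding vec_eq_iff forall_3 * N by simp
qed

lemma inner3: "(u :: complex^3) \<bullet> v = u $ 1 \<bullet> v $ 1 + u $ 2 \<bullet> v $ 2 + u $ 3 \<bullet> v $ 3"
  by (simp add: inner_vec_def sum_3)

lemma herm3: "herm (u :: complex^3) v = u $ 1 * cnj (v $ 1) + u $ 2 * cnj (v $ 2) + u $ 3 * cnj (v $ 3)"
  by (simp add: herm_def sum_3)

text \<open>In the coordinates \<open>twist ((1 - a) / a)\<close> the metric is \<open>metric0 a + a (Q0 + c Q1 + c\<^sup>2 Q2) + O(|x|\<^sup>3)\<close>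
  with \<open>c = (1 - a) / a\<close>.\<close>

definition Q0 :: "complex^3 \<Rightarrow> complex^3 \<Rightarrow> complex^3 \<Rightarrow> real" where
  "Q0 x u v = - (herm u x \<bullet> herm v x) - (x \<bullet> x) * (u \<bullet> v)"

definition Q1 :: "complex^3 \<Rightarrow> complex^3 \<Rightarrow> complex^3 \<Rightarrow> real" where
  "Q1 x u v = (x $ 2 * u $ 3 - x $ 3 * u $ 2) \<bullet> (x $ 2 * v $ 3 - x $ 3 * v $ 2) - 2 * (x \<bullet> x) * (u $ 1 \<bullet> v $ 1)"

text \<open>The r^2 coefficient, divided by c, of the form u1 + w2 u3 - w3 u2 after the twist at r
  x. The separate argument w, which tends to x as r tends to 0, keeps the expansion exact instead of
  truncated.\<close>

definition cubic_part :: "complex^3 \<Rightarrow> complex^3 \<Rightarrow> complex^3 \<Rightarrow> complex" where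
  "cubic_part w x u = x $ 1 * (cnj (x $ 3) * u $ 3 + cnj (x $ 2) * u $ 2)
      - w $ 2 * (u $ 1 * cnj (x $ 2) + x $ 1 * cnj (u $ 2)) - w $ 3 * (u $ 1 * cnj (x $ 3) + x $ 1 * cnj (u $ 3))"

definition Q2 :: "complex^3 \<Rightarrow> complex^3 \<Rightarrow> complex^3 \<Rightarrow> real" where
  "Q2 x u v = (twist_form x u + twist_form u x) \<bullet> (twist_form x v + twist_form v x)
     + u $ 1 \<bullet> cubic_part x x v + cubic_part x x u \<bullet> v $ 1"

text \<open>The number p of the overview. Its square is the squared area spanned by the vertical
  parts, which is what makes vertical vectors special.\<close>

definition vert_area :: "complex^3 \<Rightarrow> complex^3 \<Rightarrow> real" where
  "vert_area x u = Im (cnj (x $ 1) * u $ 1)"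

definition hor_kaehler :: "complex^3 \<Rightarrow> complex^3 \<Rightarrow> real" where
  "hor_kaehler x u = Im (cnj (x $ 2) * u $ 2 + cnj (x $ 3) * u $ 3)"

definition hor_inner :: "complex^3 \<Rightarrow> complex^3 \<Rightarrow> real" where
  "hor_inner x u = x $ 2 \<bullet> u $ 2 + x $ 3 \<bullet> u $ 3"

definition hor_gram :: "complex^3 \<Rightarrow> complex^3 \<Rightarrow> real" where
  "hor_gram x u = hor_inner x x * hor_inner u u - (hor_inner x u)\<^sup>2"

definition mixed_part :: "complex^3 \<Rightarrow> complex^3 \<Rightarrow> real" where
  "mixed_part x u = (x $ 1 \<bullet> x $ 1) * hor_inner u u + hor_inner x x * (u $ 1 \<bullet> u $ 1)
    - 2 * (x $ 1 \<bullet> u $ 1) * hor_inner x u"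

lemmas quartic_defs = vert_area_def hor_kaehler_def hor_gram_def mixed_part_def hor_inner_def

lemmas complex_components = inner3 vector_add_component vector_minus_component inner_complex_def
  complex.sel times_complex.sel plus_complex.sel minus_complex.sel cnj.sel uminus_complex.sel zero_complex.sel

text \<open>The Fubini-Study case c = 0: since the squared area of x and u is p^2 +
  \<open>mixed_part\<close> + \<open>hor_gram\<close>, the value is twice the squared area plus 6 (p
  + q)^2, that is, holomorphic sectional curvature 4.\<close>

lemma sec_form_Q0:
  "sec_form Q0 x u = 2 * (4 * (vert_area x u)\<^sup>2 + mixed_part x u + hor_gram x u + 3 * (hor_kaehler x u)\<^sup>2
     + 6 * vert_area x u * hor_kaehler x u)"
  unfolding sec_form_def Q0_def quartic_defs herm3 complex_components by algebra

lemma sec_form_Q1: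
  "sec_form Q1 x u = 2 * (4 * (vert_area x u)\<^sup>2 + 2 * mixed_part x u - 3 * hor_gram x u + 3 * (hor_kaehler x u)\<^sup>2)"
  unfolding sec_form_def Q1_def quartic_defs complex_components by algebra

lemma sec_form_Q2: "sec_form Q2 x u = 2 * (mixed_part x u - 6 * vert_area x u * hor_kaehler x u)"
  unfolding sec_form_def Q2_def cubic_part_def quartic_defs complex_components twist_form_nth by algebra

definition metric0 :: "real \<Rightarrow> complex^3 \<Rightarrow> complex^3 \<Rightarrow> real" where
  "metric0 a u v = u $ 1 \<bullet> v $ 1 + a * hor_inner u v"

text \<open>\<open>metric_lift\<close> in affine coordinates of a quaternionic frame. The
  combination u1 + w2 u3 - w3 u2 is the Hermitian product of the lifted tangent vector with
  \<open>J\<close> of the lifted point.\<close>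

definition coord_metric :: "real \<Rightarrow> complex^3 \<Rightarrow> complex^3 \<Rightarrow> complex^3 \<Rightarrow> real" where
  "coord_metric a w u v =
     a * ((u \<bullet> v) / (1 + w \<bullet> w) - (herm u w \<bullet> herm v w) / (1 + w \<bullet> w)\<^sup>2) +
     (1 - a) * ((u $ 1 + w $ 2 * u $ 3 - w $ 3 * u $ 2) \<bullet> (v $ 1 + w $ 2 * v $ 3 - w $ 3 * v $ 2)) / (1 + w \<bullet> w)\<^sup>2"

text \<open>The exact quotient of (metric - \<open>metric0\<close>) by r^2, with r^2 cancelled
  symbolically. It thus makes sense at r = 0, where it is the second-order coefficient, and
  continuity follows from the limit rules.\<close>

definition metric_remainder :: "real \<Rightarrow> real \<Rightarrow> complex^3 \<Rightarrow> complex^3 \<Rightarrow> complex^3 \<Rightarrow> real" where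
  "metric_remainder a r x u v =
    (let c = (1 - a) / a;
         w = x + (r * c) *\<^sub>R twist_form x x;
         n = w \<bullet> w;
         N = 1 + r\<^sup>2 * n;
         d = (\<lambda>u. c *\<^sub>R (twist_form x u + twist_form u x));
         e = (\<lambda>u. x $ 2 * u $ 3 - x $ 3 * u $ 2);
         f = (\<lambda>u. c *\<^sub>R cubic_part w x u);
         s = (\<lambda>u. herm (u + r *\<^sub>R d u) w);
         \<theta> = (\<lambda>u. u $ 1 + r *\<^sub>R e u + r\<^sup>2 *\<^sub>R f u)
     in a * (d u \<bullet> d v) +
        (1 - a) * (e u \<bullet> e v + u $ 1 \<bullet> f v + f u \<bullet> v $ 1 + r * (e u \<bullet> f v + f u \<bullet> e v) + r\<^sup>2 * (f u \<bullet> f v)) -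
        a * (s u \<bullet> s v) -
        n * (a * ((u + r *\<^sub>R d u) \<bullet> (v + r *\<^sub>R d v))) / N -
        n * (1 + N) * ((1 - a) * (\<theta> u \<bullet> \<theta> v) - a * r\<^sup>2 * (s u \<bullet> s v)) / N\<^sup>2)"

lemma twist_metric_expansion:
  assumes "a > 0"
  shows "coord_metric a (twist ((1 - a) / a) (r *\<^sub>R x)) (dtwist ((1 - a) / a) (r *\<^sub>R x) u) (dtwist ((1 - a) / a) (r *\<^sub>R x) v) =
     metric0 a u v + r\<^sup>2 * metric_remainder a r x u v"
proof -
  define c where "c = (1 - a) / a"
  have ac: "a * c = 1 - a" using assms by (simp add: c_def)
  define w where "w = x + (r * c) *\<^sub>R twist_form x x"
  define n where "n = w \<bullet> w"
  define N where "N = 1 + r\<^sup>2 * n"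
  define d where "d u = c *\<^sub>R (twist_form x u + twist_form u x)" for u
  define e where "e u = x $ 2 * u $ 3 - x $ 3 * u $ 2" for u :: "complex^3"
  define f where "f u = c *\<^sub>R cubic_part w x u" for u
  define s where "s u = herm (u + r *\<^sub>R d u) w" for u
  define \<theta> where "\<theta> u = u $ 1 + r *\<^sub>R e u + r\<^sup>2 *\<^sub>R f u" for u
  define H where "H = (u + r *\<^sub>R d u) \<bullet> (v + r *\<^sub>R d v)"
  have tw: "twist c (r *\<^sub>R x) = r *\<^sub>R w"
    by (simp add: twist_def w_def vec_eq_iff forall_3 complex_eq_iff algebra_simps)
  have dtw: "dtwist c (r *\<^sub>R x) u = u + r *\<^sub>R d u" for u
    by (simp add: dtwist_def d_def vec_eq_iff forall_3 complex_eq_iff algebra_simps)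
  have \<theta>: "(u + r *\<^sub>R d u) $ 1 + (r *\<^sub>R w) $ 2 * (u + r *\<^sub>R d u) $ 3 - (r *\<^sub>R w) $ 3 * (u + r *\<^sub>R d u) $ 2 = \<theta> u" for u
    unfolding \<theta>_def d_def e_def f_def w_def cubic_part_def vector_add_component vector_scaleR_component twist_form_nth
    unfolding scaleR_conv_of_real by (simp add: power2_eq_square algebra_simps)
  have s: "herm (u + r *\<^sub>R d u) (r *\<^sub>R w) = r *\<^sub>R s u" for u
    by (simp add: s_def herm_def scaleR_sum_right)
  have n: "r *\<^sub>R w \<bullet> r *\<^sub>R w = r\<^sup>2 * n" by (simp add: n_def power2_eq_square)
  have N: "N > 0" unfolding N_def n_def by (intro add_pos_nonneg mult_nonneg_nonneg) auto
  \<comment> \<open>The terms of order r; here the value of c is used.\<close>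
  have lin: "a * (u \<bullet> d v + d u \<bullet> v) + (1 - a) * (u $ 1 \<bullet> e v + e u \<bullet> v $ 1) = 0"
    unfolding ac[symmetric] d_def e_def complex_components twist_form_nth vector_scaleR_component scaleR_complex.sel
    by algebra
  have H: "H = u \<bullet> v + r * (u \<bullet> d v + d u \<bullet> v) + r\<^sup>2 * (d u \<bullet> d v)"
    by (simp add: H_def inner_add_left inner_add_right power2_eq_square algebra_simps)
  have T: "\<theta> u \<bullet> \<theta> v = u $ 1 \<bullet> v $ 1 + r * (u $ 1 \<bullet> e v + e u \<bullet> v $ 1) + r\<^sup>2 *
     (e u \<bullet> e v + u $ 1 \<bullet> f v + f u \<bullet> v $ 1 + r * (e u \<bullet> f v + f u \<bullet> e v) + r\<^sup>2 * (f u \<bullet> f v))"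
    by (simp add: \<theta>_def inner_add_left inner_add_right power2_eq_square algebra_simps)
  have m0: "metric0 a u v = a * (u \<bullet> v) + (1 - a) * (u $ 1 \<bullet> v $ 1)"
    by (simp add: metric0_def hor_inner_def inner3 algebra_simps)
  \<comment> \<open>From N = 1 + r^2 n: 1 / N = 1 - r^2 n / N and 1 / N^2 = 1 - r^2 n (1 + N) / N^2,
    so a factor r^2 splits off without any series.\<close>
  have frac: "A / N + B / N\<^sup>2 = A + B - r\<^sup>2 * (n * A / N + n * (1 + N) * B / N\<^sup>2)" for A B
  proof -
    have "N\<^sup>2 * (A / N + B / N\<^sup>2) = N * A + B" using N by (simp add: power2_eq_square field_simps)
    moreover have "N\<^sup>2 * (A + B - r\<^sup>2 * (n * A / N + n * (1 + N) * B / N\<^sup>2)) = N\<^sup>2 * (A + B) - r\<^sup>2 * (n * A * N + n * (1 + N) * B)"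
      using N by (simp add: power2_eq_square field_simps)
    moreover have "N\<^sup>2 * (A + B) - r\<^sup>2 * (n * A * N + n * (1 + N) * B) = N * A + B"
      unfolding N_def by algebra
    ultimately show ?thesis using N by (metis mult_left_cancel power_eq_0_iff less_irrefl)
  qed
  have "coord_metric a (twist c (r *\<^sub>R x)) (dtwist c (r *\<^sub>R x) u) (dtwist c (r *\<^sub>R x) v) =
     a * (H / N - r\<^sup>2 * (s u \<bullet> s v) / N\<^sup>2) + (1 - a) * (\<theta> u \<bullet> \<theta> v) / N\<^sup>2"
    unfolding coord_metric_def tw dtw \<theta> s n H_def N_def by (simp add: power2_eq_square)
  also have "\<dots> = (a * H) / N + ((1 - a) * (\<theta> u \<bullet> \<theta> v) - a * r\<^sup>2 * (s u \<bullet> s v)) / N\<^sup>2"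
    by (simp add: diff_divide_distrib right_diff_distrib)
  also have "\<dots> = a * H + ((1 - a) * (\<theta> u \<bullet> \<theta> v) - a * r\<^sup>2 * (s u \<bullet> s v)) -
     r\<^sup>2 * (n * (a * H) / N + n * (1 + N) * ((1 - a) * (\<theta> u \<bullet> \<theta> v) - a * r\<^sup>2 * (s u \<bullet> s v)) / N\<^sup>2)"
    by (rule frac)
  also have "a * H + ((1 - a) * (\<theta> u \<bullet> \<theta> v) - a * r\<^sup>2 * (s u \<bullet> s v)) = metric0 a u v + r\<^sup>2 * (a * (d u \<bullet> d v) +
     (1 - a) * (e u \<bullet> e v + u $ 1 \<bullet> f v + f u \<bullet> v $ 1 + r * (e u \<bullet> f v + f u \<bullet> e v) + r\<^sup>2 * (f u \<bullet> f v)) -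
        a * (s u \<bullet> s v))"
    unfolding H T m0 using lin by algebra
  finally have "coord_metric a (twist c (r *\<^sub>R x)) (dtwist c (r *\<^sub>R x) u) (dtwist c (r *\<^sub>R x) v) =
     metric0 a u v + r\<^sup>2 * (a * (d u \<bullet> d v) +
        (1 - a) * (e u \<bullet> e v + u $ 1 \<bullet> f v + f u \<bullet> v $ 1 + r * (e u \<bullet> f v + f u \<bullet> e v) + r\<^sup>2 * (f u \<bullet> f v)) -
        a * (s u \<bullet> s v) - n * (a * H) / N -
        n * (1 + N) * ((1 - a) * (\<theta> u \<bullet> \<theta> v) - a * r\<^sup>2 * (s u \<bullet> s v)) / N\<^sup>2)"
    by (simp only: right_diff_distrib distrib_left)
  then show ?thesis
    unfolding metric_remainder_def Let_def c_def[symmetric] w_def[symmetric]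
    unfolding n_def[symmetric] N_def[symmetric] d_def[symmetric] e_def[symmetric] f_def[symmetric]
    unfolding s_def[symmetric] \<theta>_def[symmetric] H_def[symmetric] .
qed

lemma metric_remainder_0:
  assumes "a > 0"
  shows "metric_remainder a 0 x u v = a * (Q0 x u v + (1 - a) / a * Q1 x u v + ((1 - a) / a)\<^sup>2 * Q2 x u v)"
proof -
  define c where "c = (1 - a) / a"
  have ac: "1 - a = a * c" using assms by (simp add: c_def)
  show ?thesis
    unfolding metric_remainder_def Let_def c_def[symmetric] Q0_def Q1_def Q2_def ac
    by (simp add: inner_add_left inner_add_right power2_eq_square algebra_simps)
qed

lemma isCont_metric_remainder: "isCont (\<lambda>(r, x, u, v). metric_remainder a r x u v) (0, x, u, v)"
proof -
  have tf: "((\<lambda>p. twist_form (f p) (g p)) \<longlongrightarrow> twist_form y z) F"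
    if "(f \<longlongrightarrow> y) F" "(g \<longlongrightarrow> z) F" for f g y z and F :: "(real \<times> (complex^3) \<times> (complex^3) \<times> (complex^3)) filter"
    using bounded_bilinear.tendsto[OF bounded_bilinear_twist_form that] .
  show ?thesis
    unfolding isCont_def case_prod_beta metric_remainder_def Let_def herm3 cubic_part_def
    by (intro tendsto_intros tf) auto
qed

text \<open>With a (1 + c) = 1 the powers of c combine: a (1 + c)^2 = 1 / a for the mixed term, a (1
  - 3 c) = 4 a - 3 for the horizontal one, 6 a (1 - c^2) = 12 - 6 / a for the product p q. The
  overall factor 2 is the normalization of \<open>sec_form\<close> against K.\<close>

lemma sec_form_remainder:
  assumes "a > 0"
  shows "sec_form (metric_remainder a 0) x u = 2 * (4 * (vert_area x u)\<^sup>2 + mixed_part x u / a + (4 * a - 3) * hor_gram x u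
     + 3 * (hor_kaehler x u)\<^sup>2 + (12 - 6 / a) * vert_area x u * hor_kaehler x u)"
proof -
  define c where "c = (1 - a) / a"
  have ac: "a * (1 + c) = 1" "1 / a = 1 + c" using assms by (simp_all add: c_def field_simps)
  have "sec_form (metric_remainder a 0) x u = a * (sec_form Q0 x u + c * sec_form Q1 x u + c\<^sup>2 * sec_form Q2 x u)"
    unfolding sec_form_def metric_remainder_0[OF assms] c_def[symmetric] by (simp add: algebra_simps)
  then show ?thesis
    unfolding sec_form_Q0 sec_form_Q1 sec_form_Q2
    using ac by (simp add: divide_inverse) algebra
qed

section \<open>Recognizing vertical vectors by their curvature\<close>

definition rank_one_jacobi :: "real \<Rightarrow> complex^3 \<Rightarrow> bool" where
  "rank_one_jacobi a x \<longleftrightarrow> (\<exists>\<kappa> \<mu> v. \<forall>u. sec_form (metric_remainder a 0) x u =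
     \<kappa> * (metric0 a x x * metric0 a u u - (metric0 a x u)\<^sup>2) + \<mu> * (metric0 a v u)\<^sup>2)"

text \<open>For vertical x = (U, 0) the squared area in the metric is p^2 + a |U|^2 |Y|^2, so K = 4
  p^2 + |U|^2 |Y|^2 / a equals 1 / a^2 times this area plus (4 - 1 / a^2) p^2. As p is linear in u,
  namely the product with i U, its square has rank one; doubling gives the constants.\<close>

lemma rank_one_jacobi_vertical:
  assumes "a > 0" "x $ 2 = 0" "x $ 3 = 0"
  shows "rank_one_jacobi a x"
  unfolding rank_one_jacobi_def
proof (intro exI allI)
  fix u
  show "sec_form (metric_remainder a 0) x u =
     2 / a\<^sup>2 * (metric0 a x x * metric0 a u u - (metric0 a x u)\<^sup>2) +
     (8 - 2 / a\<^sup>2) * (metric0 a (vector [\<i> * x $ 1, 0, 0]) u)\<^sup>2"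
  proof -
    define k where "k = 1 / a"
    have k: "a * k = 1" "2 / a\<^sup>2 = 2 * k\<^sup>2" "\<And>t. t / a = t * k"
      using assms(1) by (simp_all add: k_def power2_eq_square)
    define p where "p = vert_area x u"
    define R where "R = x $ 1 \<bullet> u $ 1"
    define A where "A = x $ 1 \<bullet> x $ 1"
    define b where "b = u $ 1 \<bullet> u $ 1"
    define Y where "Y = hor_inner u u"
    have f: "mixed_part x u = A * Y" "hor_gram x u = 0" "hor_kaehler x u = 0" "metric0 a x x = A" "metric0 a x u = R"
      "metric0 a u u = b + a * Y" "metric0 a (vector [\<i> * x $ 1, 0, 0]) u = p"
      by (simp_all add: quartic_defs metric0_def A_def R_def b_def p_def Y_def assms inner_complex_def)
    have pR: "A * b - R\<^sup>2 = p\<^sup>2"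
      unfolding p_def R_def A_def b_def vert_area_def complex_components by algebra
    have ka: "k\<^sup>2 * a = k" using k(1) by (simp add: power2_eq_square mult.commute)
    have "2 * k\<^sup>2 * (A * (b + a * Y) - R\<^sup>2) + (8 - 2 * k\<^sup>2) * p\<^sup>2 =
        2 * k\<^sup>2 * (A * b - R\<^sup>2) + 2 * (k\<^sup>2 * a) * (A * Y) + (8 - 2 * k\<^sup>2) * p\<^sup>2"
      by (simp add: algebra_simps)
    also have "\<dots> = 2 * (4 * p\<^sup>2 + A * Y * k)" unfolding pR ka by (simp add: algebra_simps)
    finally have "2 * (4 * p\<^sup>2 + A * Y * k) = 2 * k\<^sup>2 * (A * (b + a * Y) - R\<^sup>2) + (8 - 2 * k\<^sup>2) * p\<^sup>2" ..
    then show ?thesis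
      unfolding sec_form_remainder[OF assms(1)] f p_def[symmetric] k(2,3) by simp
  qed
qed

text \<open>Test the identity in horizontal directions killed by the rank-one form, in the direction
  i X, in one vertical direction, and in the sum of the last two. The first and third tests both
  determine \<kappa>, with results that agree only for a = 1.\<close>

lemma rank_one_jacobi_imp_vertical:
  assumes "a > 0" "a \<noteq> 1" "rank_one_jacobi a x"
  shows "x $ 2 = 0 \<and> x $ 3 = 0"
proof (rule ccontr)
  assume nz: "\<not> (x $ 2 = 0 \<and> x $ 3 = 0)"
  obtain \<kappa> \<mu> v where P: "\<And>u. sec_form (metric_remainder a 0) x u =
     \<kappa> * (metric0 a x x * metric0 a u u - (metric0 a x u)\<^sup>2) + \<mu> * (metric0 a v u)\<^sup>2"
    using assms(3) unfolding rank_one_jacobi_def by blast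
  define X where "X = hor_inner x x"
  define A where "A = x $ 1 \<bullet> x $ 1"
  have X: "X > 0" unfolding X_def hor_inner_def using nz
    by (metis add_nonneg_pos add_pos_nonneg inner_ge_zero inner_gt_zero_iff)
  have xx: "metric0 a x x = A + a * X" by (simp add: metric0_def A_def X_def)
  have lin: "metric0 a v (u + w) = metric0 a v u + metric0 a v w" for u v w
    by (simp add: metric0_def hor_inner_def inner_add_right algebra_simps)
  \<comment> \<open>The directions \<open>y j x\<close> with \<open>y\<close> complex, where \<open>x\<close> stands for its horizontal part.\<close>
  define Y where "Y y = (vector [0, - (y * cnj (x $ 3)), y * cnj (x $ 2)] :: complex^3)" for y
  have linY: "metric0 a v (Y y) = Re y * metric0 a v (Y 1) + Im y * metric0 a v (Y \<i>)" for y
    unfolding Y_def metric0_def hor_inner_def vector_3 complex_components imaginary_unit.sel one_complex.sel by algebra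
  obtain y where y: "y \<noteq> 0" "metric0 a v (Y y) = 0"
  proof (cases "metric0 a v (Y 1) = 0")
    case True
    then show ?thesis using that[of 1] by simp
  next
    case False
    \<comment> \<open>A kernel vector of the real functional with coefficients
      \<open>metric0 a v (Y 1)\<close> and \<open>metric0 a v (Y \<i>)\<close>: the coefficient pair
      turned by a right angle.\<close>
    let ?y = "Complex (metric0 a v (Y \<i>)) (- metric0 a v (Y 1))"
    have "metric0 a v (Y ?y) = 0" using linY[of ?y] by simp
    then show ?thesis using that[of ?y] False by (simp add: complex_eq_iff)
  qed
  define y2 where "y2 = (Re y)\<^sup>2 + (Im y)\<^sup>2"
  have y2: "y2 > 0" using y(1) by (simp add: y2_def complex_neq_0)
  have Yf: "vert_area x (Y y) = 0" "mixed_part x (Y y) = A * (X * y2)" "hor_gram x (Y y) = X * (X * y2)" "hor_kaehler x (Y y) = 0"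
    "metric0 a (Y y) (Y y) = a * (X * y2)" "metric0 a x (Y y) = 0"
    by (simp_all add: quartic_defs metric0_def Y_def A_def X_def y2_def inner_complex_def power2_eq_square algebra_simps)
  have "2 * (A / a + (4 * a - 3) * X) * (X * y2) = (\<kappa> * a * (A + a * X)) * (X * y2)"
    using P[of "Y y"] unfolding sec_form_remainder[OF assms(1)] Yf xx y(2) by (simp add: algebra_simps)
  then have \<kappa>: "2 * (A / a + (4 * a - 3) * X) = \<kappa> * a * (A + a * X)" using X y2 by simp
  \<comment> \<open>A direction orthogonal to x with p = 0 but q = |X|^2.\<close>
  define I where "I = (vector [0, \<i> * x $ 2, \<i> * x $ 3] :: complex^3)"
  \<comment> \<open>A vertical direction parallel to the vertical part of x, so that p = 0; if that
    part is zero, any nonzero number serves.\<close>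
  define V where "V = (if x $ 1 = 0 then 1 else x $ 1)"
  define W where "W = (vector [V, 0, 0] :: complex^3)"
  define b where "b = V \<bullet> V"
  have b: "b > 0" by (simp add: b_def V_def)
  have Vx: "Im (cnj (x $ 1) * V) = 0" "A * b - (x $ 1 \<bullet> V)\<^sup>2 = 0"
    by (auto simp: V_def A_def b_def power2_eq_square)
  have If: "vert_area x I = 0" "mixed_part x I = A * X" "hor_gram x I = X * X" "hor_kaehler x I = X"
    "metric0 a I I = a * X" "metric0 a x I = 0"
    by (simp_all add: quartic_defs metric0_def I_def A_def X_def inner_complex_def power2_eq_square algebra_simps)
  have Wf: "vert_area x W = 0" "mixed_part x W = X * b" "hor_gram x W = 0" "hor_kaehler x W = 0"
    "metric0 a W W = b" "metric0 a x W = x $ 1 \<bullet> V"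
    using Vx(1) by (simp_all add: quartic_defs metric0_def W_def b_def X_def)
  have Sf: "vert_area x (W + I) = 0" "mixed_part x (W + I) = A * X + X * b" "hor_gram x (W + I) = X * X"
    "hor_kaehler x (W + I) = X" "metric0 a (W + I) (W + I) = b + a * X" "metric0 a x (W + I) = x $ 1 \<bullet> V"
  proof -
    have n: "(W + I) $ 1 = W $ 1" "(W + I) $ 2 = I $ 2" "(W + I) $ 3 = I $ 3" by (simp_all add: W_def I_def)
    have h: "hor_inner x I = 0" unfolding hor_inner_def I_def vector_3 complex_components imaginary_unit.sel by algebra
    show "vert_area x (W + I) = 0" "hor_gram x (W + I) = X * X" "hor_kaehler x (W + I) = X"
      using Wf(1) If(3,4) by (simp_all only: vert_area_def hor_gram_def hor_kaehler_def hor_inner_def n)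
    have "hor_inner (W + I) (W + I) = hor_inner I I" "hor_inner x (W + I) = hor_inner x I" by (simp_all only: hor_inner_def n)
    then show "mixed_part x (W + I) = A * X + X * b" "metric0 a (W + I) (W + I) = b + a * X" "metric0 a x (W + I) = x $ 1 \<bullet> V"
      unfolding mixed_part_def metric0_def n h using If(2,5) Wf(2,5,6) h
      by (simp_all add: mixed_part_def metric0_def W_def I_def b_def hor_inner_def A_def X_def)
  qed
  have eI: "2 * (A * X / a + (4 * a - 3) * (X * X) + 3 * X\<^sup>2) = \<kappa> * ((A + a * X) * (a * X)) + \<mu> * (metric0 a v I)\<^sup>2"
    using P[of I] unfolding sec_form_remainder[OF assms(1)] If xx by simp
  have eW: "2 * (X * b / a) = \<kappa> * ((A + a * X) * b - (x $ 1 \<bullet> V)\<^sup>2) + \<mu> * (metric0 a v W)\<^sup>2"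
    using P[of W] unfolding sec_form_remainder[OF assms(1)] Wf xx by simp
  have eS: "2 * ((A * X + X * b) / a + (4 * a - 3) * (X * X) + 3 * X\<^sup>2) =
     \<kappa> * ((A + a * X) * (b + a * X) - (x $ 1 \<bullet> V)\<^sup>2) + \<mu> * (metric0 a v W + metric0 a v I)\<^sup>2"
    using P[of "W + I"] unfolding sec_form_remainder[OF assms(1)] Sf xx lin[of v W I] by simp
  \<comment> \<open>Both K and the area term are additive on W + I, so the mixed term of the
    rank-one square has nothing to balance it.\<close>
  have cross: "\<mu> * metric0 a v W * metric0 a v I = 0"
  proof -
    have \<mu>: "\<mu> * (metric0 a v W + metric0 a v I)\<^sup>2 =
        \<mu> * (metric0 a v W)\<^sup>2 + \<mu> * (metric0 a v I)\<^sup>2 + 2 * (\<mu> * metric0 a v W * metric0 a v I)"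
      by (simp add: power2_eq_square algebra_simps)
    have \<kappa>: "\<kappa> * ((A + a * X) * (b + a * X) - (x $ 1 \<bullet> V)\<^sup>2) =
        \<kappa> * ((A + a * X) * b - (x $ 1 \<bullet> V)\<^sup>2) + \<kappa> * ((A + a * X) * (a * X))"
      by (simp add: algebra_simps)
    have linear: "z = 0" if "t = t1 + t2" "m = m1 + m2 + 2 * z" "d = p + s" "2 * (p + q + r) = t2 + m2"
      "2 * s = t1 + m1" "2 * (d + q + r) = t + m" for t t1 t2 m m1 m2 z d p q r s :: real
      using that by simp
    show ?thesis by (rule linear[OF \<kappa> \<mu> add_divide_distrib eI eW eS])
  qed
  \<comment> \<open>Scaled to equal length, the directions \<open>Y y\<close> and \<open>I\<close>
    differ only in the term 3 q^2, which the rank-one square must supply along \<open>I\<close>.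
    Hence its functional is nonzero on \<open>I\<close> and, by \<open>cross\<close>, zero on
    \<open>W\<close>.\<close>
  have "2 * (A * X / a + (4 * a - 3) * (X * X)) = \<kappa> * ((A + a * X) * (a * X))"
    using arg_cong[OF \<kappa>, of "\<lambda>t. t * X"] by (simp add: algebra_simps)
  then have "\<mu> * (metric0 a v I)\<^sup>2 = 6 * X\<^sup>2" using eI by (simp add: algebra_simps)
  then have "\<mu> \<noteq> 0" "metric0 a v I \<noteq> 0" using X by auto
  then have "metric0 a v W = 0" using cross by simp
  moreover have "(A + a * X) * b - (x $ 1 \<bullet> V)\<^sup>2 = a * X * b" using Vx(2) by (simp add: distrib_right)
  ultimately have "2 * (X * b / a) = \<kappa> * (a * X * b)" using eW by simp
  then have "(X * b) * (\<kappa> * a) = (X * b) * (2 / a)" by (simp add: algebra_simps)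
  moreover have "X * b \<noteq> 0" using X b by simp
  ultimately have "\<kappa> * a = 2 / a" using mult_left_cancel by blast
  then have "2 * (A / a + (4 * a - 3) * X) = 2 / a * (A + a * X)" using \<kappa> by simp
  \<comment> \<open>The value 2 / a of \<kappa> a found in the direction \<open>W\<close> is put
    into the equation from the horizontal directions; only a = 1 would satisfy it.\<close>
  then have "(4 * a - 3) * X = X" using assms(1) by (simp add: field_simps)
  then show False using X assms(2) by simp
qed

section \<open>Isometries in adapted coordinates\<close>

lemma bounded_linear_smult: "bounded_linear ((*s) c :: complex^'n \<Rightarrow> complex^'n)"
  unfolding linear_conv_bounded_linear[symmetric]
  by (rule linearI) (simp_all add: vec_eq_iff algebra_simps)

lemma Ck_on_affine_coords: "Ck_on k {z. z $ i \<noteq> 0} (affine_coords i)"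
proof (rule Ck_on_vec[OF open_nth_nonzero])
  fix m :: 3
  have "Ck_on k {z :: complex^4. z $ i \<noteq> 0} (\<lambda>z. z $ l * inverse (z $ i))" for l
    by (intro Ck_on_bilinear[OF open_nth_nonzero bounded_bilinear_mult] Ck_on_inverse[OF open_nth_nonzero]
        Ck_on_linear[OF open_nth_nonzero bounded_linear_vec_nth]) auto
  then show "Ck_on k {z. z $ i \<noteq> 0} (\<lambda>z. affine_coords i z $ m)"
    using exhaust_3[of m] by (auto simp: affine_coords_def divide_inverse)
qed

lemma Ck_on_affine_section: "Ck_on k UNIV (affine_section i)"
proof (rule Ck_on_vec[OF open_UNIV])
  show "Ck_on k UNIV (\<lambda>w. affine_section i w $ l)" for l
    using index4_cases[of l i]
    by (elim disjE) (simp_all add: affine_section_def Ck_on_linear[OF open_UNIV bounded_linear_vec_nth])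
qed

text \<open>Read \<phi> in two affine charts and return to \<complex>^4 by the affine section.
  Scaling the section by the constant z' $ j makes the lift take the prescribed value z' at z, not
  merely a multiple of it.\<close>

lemma local_lift:
  assumes \<phi>: "smooth_map \<phi>" and z: "z \<noteq> 0" "z' \<noteq> 0" "\<phi> (hopf z) = hopf z'"
  obtains U \<tau> where "open U" "z \<in> U" "\<tau> z = z'" "\<And>k. Ck_on k U \<tau>"
    "\<And>y. y \<in> U \<Longrightarrow> y \<noteq> 0 \<and> \<tau> y \<noteq> 0 \<and> \<phi> (hopf y) = hopf (\<tau> y)"
proof -
  obtain i j where i: "z $ i \<noteq> 0" and j: "z' $ j \<noteq> 0" using vec4_nonzeroD z by metis
  define S where "S = chart i ` (chart_dom i \<inter> \<phi> -` chart_dom j)"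
  define f where "f = chart j \<circ> \<phi> \<circ> chart_inv i"
  have S: "open S" and f: "\<And>k. Ck_on k S f"
    using \<phi> unfolding smooth_map_def smooth_on_def S_def f_def Let_def by blast+
  define U where "U = {y. y $ i \<noteq> 0} \<inter> affine_coords i -` S"
  define \<tau> where "\<tau> y = z' $ j *s affine_section j (f (affine_coords i y))" for y
  have U: "open U" unfolding U_def
    using continuous_open_preimage[OF _ open_nth_nonzero S] Ck_on_affine_coords[of 0 i] by simp
  have lift: "\<phi> (hopf y) \<in> chart_dom j" if "y \<in> U" for y
  proof -
    have y: "y $ i \<noteq> 0" "affine_coords i y \<in> S" using that by (auto simp: U_def)
    then obtain p where p: "p \<in> chart_dom i" "\<phi> p \<in> chart_dom j" "affine_coords i y = chart i p"
      by (auto simp: S_def)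
    obtain w where w: "p = hopf w" "w $ i \<noteq> 0" using p(1) by (auto simp: chart_dom_def)
    have "hopf y = p" using chart_inv_chart_hopf[OF y(1)] chart_inv_chart_hopf[OF w(2)] p(3) w
      by (simp add: chart_hopf)
    then show ?thesis using p by simp
  qed
  have "z \<in> U" unfolding U_def S_def using i j z
    by (auto simp: chart_hopf hopf_in_chart_dom intro!: image_eqI[of _ _ "hopf z"])
  moreover have "\<tau> z = z'"
    unfolding \<tau>_def f_def using affine_section_coords[OF j] by (simp add: chart_inv_chart_hopf[OF i] z(3) chart_hopf[OF j])
  moreover have "Ck_on k U \<tau>" for k
  proof -
    have "Ck_on k U (\<lambda>y. f (affine_coords i y))"
      using U by (intro Ck_on_compose[OF U S _ f] Ck_on_subset[OF Ck_on_affine_coords]) (auto simp: U_def)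
    then have "Ck_on k U (\<lambda>y. affine_section j (f (affine_coords i y)))"
      by (rule Ck_on_compose[OF U open_UNIV _ Ck_on_affine_section]) simp
    then show ?thesis unfolding \<tau>_def by (rule Ck_on_bounded_linear[OF U bounded_linear_smult])
  qed
  moreover have "y \<noteq> 0 \<and> \<tau> y \<noteq> 0 \<and> \<phi> (hopf y) = hopf (\<tau> y)" if "y \<in> U" for y
  proof -
    have y: "y $ i \<noteq> 0" using that by (auto simp: U_def)
    obtain w where w: "\<phi> (hopf y) = hopf w" "w $ j \<noteq> 0"
      using lift[OF \<open>y \<in> U\<close>] by (auto simp: chart_dom_def)
    have "f (affine_coords i y) = affine_coords j w"
      by (simp add: f_def chart_inv_chart_hopf[OF y] w chart_hopf)
    then have "\<tau> y = z' $ j *s affine_section j (affine_coords j w)" by (simp add: \<tau>_def)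
    then show ?thesis using y j w hopf_smult[OF j affine_section_nonzero] chart_inv_chart_hopf[OF w(2)]
      by (auto simp: chart_inv_eq)
  qed
  ultimately show ?thesis using that U by blast
qed

section \<open>Quaternionic frames and the affine coordinates they define\<close>

definition orthonormal_frame :: "complex^4 \<Rightarrow> complex^4 \<Rightarrow> bool" where
  "orthonormal_frame q r \<longleftrightarrow> norm q = 1 \<and> norm r = 1 \<and> herm r q = 0 \<and> herm r (J q) = 0"

text \<open>Four real vectors cannot span \<real>^8. Real orthogonality to x and to i x together is
  Hermitian orthogonality, so a vector orthogonal to all four can be normalized to r.\<close>

lemma orthonormal_frame_exists:
  assumes "norm q = 1"
  obtains r where "orthonormal_frame q r"
proof -
  let ?B = "{q, \<i> *s q, J q, \<i> *s J q}"
  have "card ?B \<le> 4" using card_length[of "[q, \<i> *s q, J q, \<i> *s J q]"] by simp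
  moreover have "dim ?B \<le> card ?B" by (rule dim_le_card') simp
  moreover have "DIM(complex^4) = 8" by simp
  ultimately have "dim ?B < DIM(complex^4)" by linarith
  then obtain y where y: "y \<noteq> 0" "\<And>x. x \<in> span ?B \<Longrightarrow> orthogonal y x"
    by (rule orthogonal_to_subspace_exists) blast
  have h: "herm y x = 0" if "x \<in> ?B" "\<i> *s x \<in> ?B" for x
  proof -
    have "y \<bullet> x = 0" "y \<bullet> (\<i> *s x) = 0" using y(2)[OF span_base[OF that(1)]] y(2)[OF span_base[OF that(2)]]
      by (simp_all add: orthogonal_def)
    then show ?thesis by (simp add: inner_eq_Re_herm herm_simps complex_eq_iff)
  qed
  define r where "r = complex_of_real (inverse (norm y)) *s y"
  have "norm r = 1" using y(1) by (simp add: r_def norm_smult_complex norm_inverse)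
  moreover have "herm r q = 0" "herm r (J q) = 0" using h[of q] h[of "J q"] by (simp_all add: r_def herm_simps)
  ultimately show ?thesis using that assms by (simp add: orthonormal_frame_def)
qed

lemma orthonormal_frame_herm:
  assumes "orthonormal_frame q r"
  shows "herm q q = 1" "herm r r = 1" "herm (J q) (J q) = 1" "herm (J r) (J r) = 1"
    "herm r q = 0" "herm q r = 0" "herm r (J q) = 0" "herm (J q) r = 0"
    "herm (J r) q = 0" "herm q (J r) = 0" "herm (J r) (J q) = 0" "herm (J q) (J r) = 0"
proof -
  show 1: "herm q q = 1" "herm r r = 1" using assms herm_self[of q] herm_self[of r] by (simp_all add: orthonormal_frame_def)
  then show "herm (J q) (J q) = 1" "herm (J r) (J r) = 1" by (simp_all add: herm_J_J)
  show 2: "herm r q = 0" "herm r (J q) = 0" using assms by (simp_all add: orthonormal_frame_def)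
  then show 3: "herm q r = 0" "herm (J q) r = 0" using cnj_herm by (metis complex_cnj_zero)+
  then show 4: "herm (J r) q = 0" using herm_J_left[of r q] by simp
  then show "herm q (J r) = 0" using cnj_herm by (metis complex_cnj_zero)
  show "herm (J r) (J q) = 0" "herm (J q) (J r) = 0" using 2 3 by (simp_all add: herm_J_J)
qed

text \<open>Orthonormality says that the matrix A with rows \<open>q\<close>, \<open>J q\<close>,
  \<open>r\<close>, \<open>J r\<close> satisfies A B = 1 with B its conjugate transpose; for square
  matrices B A = 1 follows, and this is the expansion.\<close>

lemma orthonormal_frame_expansion:
  assumes "orthonormal_frame q r"
  shows "z = herm z q *s q + herm z (J q) *s J q + herm z r *s r + herm z (J r) *s J r"
proof -
  define e :: "4 \<Rightarrow> complex^4" where "e m = (if m = 1 then q else if m = 2 then J q else if m = 3 then r else J r)" for m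
  define A :: "complex^4^4" where "A = (\<chi> m k. e m $ k)"
  define B :: "complex^4^4" where "B = (\<chi> k m. cnj (e m $ k))"
  have "(A ** B) $ m $ n = herm (e m) (e n)" for m n
    by (simp add: matrix_matrix_mult_def A_def B_def herm_def)
  moreover have "herm (e m) (e n) = (if m = n then 1 else 0)" for m n
    using exhaust_4[of m] exhaust_4[of n] by (auto simp: e_def orthonormal_frame_herm[OF assms])
  ultimately have "A ** B = mat 1" by (simp add: vec_eq_iff mat_def)
  then have BA: "B ** A = mat 1" using matrix_left_right_inverse by blast
  have "z $ l = (\<Sum>m\<in>UNIV. herm z (e m) * e m $ l)" for l
  proof -
    have "(\<Sum>m\<in>UNIV. herm z (e m) * e m $ l) = (\<Sum>m\<in>UNIV. \<Sum>k\<in>UNIV. z $ k * (cnj (e m $ k) * e m $ l))"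
      by (simp add: herm_def sum_distrib_right mult.assoc)
    also have "\<dots> = (\<Sum>k\<in>UNIV. \<Sum>m\<in>UNIV. z $ k * (cnj (e m $ k) * e m $ l))" by (rule sum.swap)
    also have "\<dots> = (\<Sum>k\<in>UNIV. z $ k * (B ** A) $ k $ l)"
      by (simp add: matrix_matrix_mult_def A_def B_def sum_distrib_left)
    also have "\<dots> = z $ l" by (simp add: BA mat_def if_distrib cong: if_cong)
    finally show ?thesis by simp
  qed
  moreover have "(\<Sum>m\<in>UNIV. herm z (e m) * e m $ l) =
     (herm z q *s q + herm z (J q) *s J q + herm z r *s r + herm z (J r) *s J r) $ l" for l
    unfolding sum_4 by (simp add: e_def)
  ultimately show ?thesis unfolding vec_eq_iff by presburger
qed

definition frame_lin :: "complex^4 \<Rightarrow> complex^4 \<Rightarrow> complex^3 \<Rightarrow> complex^4" where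
  "frame_lin q r u = u $ 1 *s J q + u $ 2 *s r + u $ 3 *s J r"

definition frame_map :: "complex^4 \<Rightarrow> complex^4 \<Rightarrow> complex^3 \<Rightarrow> complex^4" where
  "frame_map q r w = q + frame_lin q r w"

lemma bounded_linear_frame_lin: "bounded_linear (frame_lin q r)"
  unfolding linear_conv_bounded_linear[symmetric]
  by (rule linearI) (simp_all add: frame_lin_def vec_eq_iff algebra_simps)

text \<open>Neither q nor r occurs on the right. This expresses the homogeneity of the metric under
  the symplectic group and lets source and target of an isometry share one coordinate
  metric.\<close>

lemma metric_lift_frame:
  assumes "orthonormal_frame q r"
  shows "metric_lift a (frame_map q r w) (frame_lin q r u) (frame_lin q r v) = coord_metric a w u v"
    and "frame_map q r w \<noteq> 0"
proof -
  note o = orthonormal_frame_herm[OF assms]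
  have J: "J (frame_map q r w) = J q + (- cnj (w $ 1)) *s q + cnj (w $ 2) *s J r + (- cnj (w $ 3)) *s r"
    by (simp add: frame_map_def frame_lin_def J_add J_smult J_J vec_eq_iff)
  have 1: "herm (frame_lin q r u) (frame_lin q r v) = herm u v" for u v
    by (simp add: frame_lin_def herm_simps o herm3)
  have 2: "herm (frame_lin q r u) (frame_map q r w) = herm u w" for u
    by (simp add: frame_map_def frame_lin_def herm_simps o herm3)
  have 3: "herm (frame_lin q r u) (J (frame_map q r w)) = u $ 1 + w $ 2 * u $ 3 - w $ 3 * u $ 2" for u
    unfolding J by (simp add: frame_lin_def herm_simps o)
  have "complex_of_real ((norm (frame_map q r w))\<^sup>2) = 1 + herm w w"
    unfolding herm_self[symmetric] by (simp add: frame_map_def frame_lin_def herm_simps o herm3)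
  then have "complex_of_real ((norm (frame_map q r w))\<^sup>2) = complex_of_real (1 + w \<bullet> w)"
    by (simp add: herm_self power2_norm_eq_inner)
  then have n: "(norm (frame_map q r w))\<^sup>2 = 1 + w \<bullet> w" using of_real_eq_iff by blast
  have n4: "(norm (frame_map q r w))^4 = (1 + w \<bullet> w)\<^sup>2" unfolding n[symmetric] by simp
  have i: "x \<bullet> y = Re (x * cnj y)" for x y :: complex by (simp add: inner_complex_def)
  show "metric_lift a (frame_map q r w) (frame_lin q r u) (frame_lin q r v) = coord_metric a w u v"
    unfolding metric_lift_def coord_metric_def n n4 1 2 3 i inner_eq_Re_herm[of u v] by simp
  have "(norm (frame_map q r w))\<^sup>2 > 0" unfolding n by (simp add: add_pos_nonneg)
  then show "frame_map q r w \<noteq> 0" by auto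
qed

definition frame_coords :: "complex^4 \<Rightarrow> complex^4 \<Rightarrow> complex^4 \<Rightarrow> complex^3" where
  "frame_coords q r z = inverse (herm z q) *s vector [herm z (J q), herm z r, herm z (J r)]"

lemma frame_map_coords:
  assumes "orthonormal_frame q r" "herm z q \<noteq> 0"
  shows "hopf (frame_map q r (frame_coords q r z)) = hopf z"
proof -
  let ?w = "frame_coords q r z"
  have c: "herm z q * ?w $ 1 = herm z (J q)" "herm z q * ?w $ 2 = herm z r" "herm z q * ?w $ 3 = herm z (J r)"
    using assms(2) by (simp_all add: frame_coords_def)
  have "herm z q *s frame_map q r ?w =
      herm z q *s q + (herm z q * ?w $ 1) *s J q + (herm z q * ?w $ 2) *s r + (herm z q * ?w $ 3) *s J r"
    by (simp add: frame_map_def frame_lin_def vec_eq_iff algebra_simps)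
  also have "\<dots> = z" unfolding c by (rule orthonormal_frame_expansion[OF assms(1), symmetric])
  finally have "herm z q *s frame_map q r ?w = z" .
  then show ?thesis using hopf_smult[OF assms(2) metric_lift_frame(2)[OF assms(1)]] by metis
qed

lemma bounded_linear_herm: "bounded_linear (\<lambda>z. herm z v)"
  unfolding linear_conv_bounded_linear[symmetric]
  by (rule linearI) (simp_all add: herm_simps scaleR_eq_smult scaleR_conv_of_real)

lemma open_herm_nonzero: "open {z. herm z v \<noteq> 0}"
proof -
  have "continuous_on UNIV (\<lambda>z. herm z v)"
    using bounded_linear.continuous_on[OF bounded_linear_herm continuous_on_id] .
  then have "open ((\<lambda>z. herm z v) -` (- {0}))" by (rule open_vimage[rotated]) auto
  then show ?thesis by (simp add: vimage_def Compl_eq)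
qed

lemma Ck_on_frame_coords: "Ck_on k {z. herm z q \<noteq> 0} (frame_coords q r)"
proof (rule Ck_on_vec[OF open_herm_nonzero])
  fix m :: 3
  have "Ck_on k {z. herm z q \<noteq> 0} (\<lambda>z. inverse (herm z q) * herm z v)" for v
    by (intro Ck_on_bilinear[OF open_herm_nonzero bounded_bilinear_mult] Ck_on_inverse[OF open_herm_nonzero]
        Ck_on_linear[OF open_herm_nonzero bounded_linear_herm]) auto
  then show "Ck_on k {z. herm z q \<noteq> 0} (\<lambda>z. frame_coords q r z $ m)"
    using exhaust_3[of m] by (auto simp: frame_coords_def)
qed

lemma Ck_on_frame_map: "Ck_on k UNIV (frame_map q r)"
  unfolding frame_map_def[abs_def]
  by (intro Ck_on_add[OF open_UNIV] Ck_on_const Ck_on_linear[OF open_UNIV bounded_linear_frame_lin])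

lemma Ck_on_twist: "Ck_on k UNIV (twist c)"
  unfolding twist_def[abs_def]
  by (intro Ck_on_add[OF open_UNIV] Ck_on_linear[OF open_UNIV bounded_linear_ident]
      Ck_on_bounded_linear[OF open_UNIV bounded_linear_scaleR_right]
      Ck_on_bilinear[OF open_UNIV bounded_bilinear_twist_form])

lemma Ck_on_untwist: "Ck_on k UNIV (untwist c)"
proof (rule Ck_on_vec[OF open_UNIV])
  fix m :: 3
  have n: "Ck_on k UNIV (\<lambda>w :: complex^3. w $ i)" for i
    by (rule Ck_on_linear[OF open_UNIV bounded_linear_vec_nth])
  have cn: "Ck_on k UNIV (\<lambda>w :: complex^3. cnj (w $ i))" for i
    by (rule Ck_on_bounded_linear[OF open_UNIV bounded_linear_cnj n])
  have d: "Ck_on k UNIV (\<lambda>w :: complex^3. inverse (1 + of_real c * w $ 1 * (of_real c * cnj (w $ 1))))"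
    by (intro Ck_on_inverse[OF open_UNIV twist_denominator] Ck_on_add[OF open_UNIV]
        Ck_on_bilinear[OF open_UNIV bounded_bilinear_mult] Ck_on_const n cn)
  have "Ck_on k UNIV (\<lambda>w :: complex^3. inverse (1 + of_real c * w $ 1 * (of_real c * cnj (w $ 1))) *
      (w $ i + of_real b * w $ 1 * cnj (w $ j)))" for i j and b :: real
    by (intro Ck_on_add[OF open_UNIV] Ck_on_bilinear[OF open_UNIV bounded_bilinear_mult] Ck_on_const n cn d)
  from this[of 2 "-c" 3] this[of 3 c 2]
  show "Ck_on k UNIV (\<lambda>w. untwist c w $ m)"
    using exhaust_3[of m] n by (auto simp: untwist_def Let_def)
qed

text \<open>In twisted frame coordinates about \<open>hopf q\<close> and its image the isometry
  fixes 0 and preserves a single metric h. Its derivative A at 0 then carries vectors passing the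
  rank-one test to vectors passing it, and in these coordinates D_1 at 0 is the first axis.\<close>

lemma isometry_preserves_dist1:
  assumes a: "a > 0" "a \<noteq> 1" and iso: "isometry (metric_a a) \<phi>"
    and q: "norm q = 1" "norm q' = 1" "\<phi> (hopf q) = hopf q'"
  obtains \<alpha> where "dmap \<phi> (hopf q) (dhopf q (c *s J q)) = dhopf q' (\<alpha> *s J q')"
proof -
  define b where "b = (1 - a) / a"
  have \<phi>: "smooth_map \<phi>" using iso by (simp add: isometry_def)
  obtain r where r: "orthonormal_frame q r" by (rule orthonormal_frame_exists[OF q(1)])
  obtain r' where r': "orthonormal_frame q' r'" by (rule orthonormal_frame_exists[OF q(2)])
  have q0: "q \<noteq> 0" "q' \<noteq> 0" using q by auto
  obtain U \<tau> where U: "open U" "q \<in> U" "\<tau> q = q'" "\<And>k. Ck_on k U \<tau>"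
    and lift: "\<And>y. y \<in> U \<Longrightarrow> y \<noteq> 0 \<and> \<tau> y \<noteq> 0 \<and> \<phi> (hopf y) = hopf (\<tau> y)"
    using local_lift[OF \<phi> q0 q(3)] by blast
  define \<sigma> where "\<sigma> x = frame_map q r (twist b x)" for x
  define \<sigma>' where "\<sigma>' x = frame_map q' r' (twist b x)" for x
  have dmap_param: "((\<lambda>x. frame_map q r (twist b x)) has_derivative (\<lambda>u. frame_lin q r (dtwist b x u))) (at x)" for q r x
    unfolding frame_map_def
    using has_derivative_add[OF has_derivative_const
        bounded_linear.has_derivative[OF bounded_linear_frame_lin has_derivative_twist], of q] by simp
  have d\<sigma>: "(\<sigma> has_derivative (\<lambda>u. frame_lin q r (dtwist b x u))) (at x)" for x
    using dmap_param unfolding \<sigma>_def[abs_def] .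
  have d\<sigma>': "(\<sigma>' has_derivative (\<lambda>u. frame_lin q' r' (dtwist b x u))) (at x)" for x
    using dmap_param unfolding \<sigma>'_def[abs_def] .
  have C\<sigma>: "Ck_on k UNIV \<sigma>" for k
    unfolding \<sigma>_def[abs_def] by (rule Ck_on_compose[OF open_UNIV open_UNIV Ck_on_twist Ck_on_frame_map]) simp
  have tw0: "twist b 0 = 0" by (simp add: twist_def vec_eq_iff forall_3)
  have \<sigma>0: "\<sigma> 0 = q" "\<sigma>' 0 = q'" by (simp_all add: \<sigma>_def \<sigma>'_def tw0 frame_map_def frame_lin_def)
  have dtw0: "dtwist b 0 u = u" for u by (simp add: dtwist_def vec_eq_iff forall_3)
  define S where "S = \<sigma> -` U"
  have S: "open S" unfolding S_def
    using open_vimage[OF U(1)] C\<sigma>[of 0] by simp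
  have C\<tau>: "Ck_on k S (\<lambda>x. \<tau> (\<sigma> x))" for k
    by (rule Ck_on_compose[OF S U(1) Ck_on_subset[OF C\<sigma>] U(4)]) (auto simp: S_def)
  \<comment> \<open>The points whose image stays in the affine chart centred at
    \<open>hopf q'\<close>.\<close>
  define V where "V = S \<inter> (\<lambda>x. \<tau> (\<sigma> x)) -` {z. herm z q' \<noteq> 0}"
  have V: "open V" unfolding V_def
    using continuous_open_preimage[OF _ S open_herm_nonzero] C\<tau>[of 0] by simp
  have "0 \<in> V" using U(2,3) orthonormal_frame_herm(1)[OF r'] by (simp add: V_def S_def \<sigma>0)
  define F where "F x = untwist b (frame_coords q' r' (\<tau> (\<sigma> x)))" for x
  have CF: "Ck_on k V F" for k
  proof -
    have "Ck_on k V (\<lambda>x. frame_coords q' r' (\<tau> (\<sigma> x)))"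
      by (rule Ck_on_compose[OF V open_herm_nonzero Ck_on_subset[OF C\<tau>] Ck_on_frame_coords]) (auto simp: V_def)
    then show ?thesis unfolding F_def
      by (rule Ck_on_compose[OF V open_UNIV _ Ck_on_untwist]) simp
  qed
  have F0: "F 0 = 0"
    using orthonormal_frame_herm[OF r']
    by (simp add: F_def \<sigma>0 U(3) frame_coords_def untwist_def vec_eq_iff forall_3)
  have hF: "\<phi> (hopf (\<sigma> x)) = hopf (\<sigma>' (F x))" if "x \<in> V" for x
  proof -
    have x: "\<sigma> x \<in> U" "herm (\<tau> (\<sigma> x)) q' \<noteq> 0" using that by (auto simp: V_def S_def)
    show ?thesis
      unfolding \<sigma>'_def F_def twist_untwist frame_map_coords[OF r' x(2)] using lift[OF x(1)] by simp
  qed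
  have nz: "\<sigma> x \<noteq> 0" "\<sigma>' x \<noteq> 0" for x
    unfolding \<sigma>_def \<sigma>'_def using metric_lift_frame(2)[OF r] metric_lift_frame(2)[OF r'] by blast+
  have dF: "dmap \<phi> (hopf (\<sigma> x)) (dhopf (\<sigma> x) (frame_lin q r (dtwist b x u))) =
     dhopf (\<sigma>' (F x)) (frame_lin q' r' (dtwist b (F x) (frechet_derivative F (at x) u)))" if "x \<in> V" for x u
  proof -
    have "(F has_derivative frechet_derivative F (at x)) (at x)"
      by (rule Ck_on_Suc_has_derivative[OF CF that])
    from has_derivative_compose[OF this d\<sigma>'] show ?thesis
      using dmap_dhopf[OF \<phi> V that, of \<sigma> "\<lambda>x. \<sigma>' (F x)", OF hF nz(1) nz(2) d\<sigma>] by blast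
  qed
  \<comment> \<open>One h serves both ends, because \<open>coord_metric\<close> does not depend on
    the frame.\<close>
  define h where "h x u v = coord_metric a (twist b x) (dtwist b x u) (dtwist b x v)" for x u v
  have hiso: "h (F x) (frechet_derivative F (at x) u) (frechet_derivative F (at x) v) = h x u v" if "x \<in> V" for x u v
  proof -
    let ?X = "\<lambda>u. dhopf (\<sigma> x) (frame_lin q r (dtwist b x u))"
    have tan: "?X u \<in> tangent_space (hopf (\<sigma> x))" for u using tangent_space_hopf[OF nz(1)] by blast
    have "metric_a a (\<phi> (hopf (\<sigma> x))) (dmap \<phi> (hopf (\<sigma> x)) (?X u)) (dmap \<phi> (hopf (\<sigma> x)) (?X v)) =
       metric_a a (hopf (\<sigma> x)) (?X u) (?X v)"
      using iso tan[of u] tan[of v] unfolding isometry_def by blast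
    then show ?thesis
      unfolding hF[OF that] dF[OF that] metric_a_hopf[OF nz(1)] metric_a_hopf[OF nz(2)]
      unfolding \<sigma>_def \<sigma>'_def metric_lift_frame(1)[OF r] metric_lift_frame(1)[OF r'] h_def .
  qed
  define A where "A = frechet_derivative F (at 0)"
  have bil: "bounded_bilinear (metric0 a)"
    unfolding bilinear_conv_bounded_bilinear[symmetric] bilinear_def
    by (auto intro!: linearI simp: metric0_def hor_inner_def inner_add_left inner_add_right algebra_simps)
  have sym: "metric0 a u v = metric0 a v u" for u v by (simp add: metric0_def hor_inner_def inner_commute)
  have pos: "metric0 a u u > 0" if "u \<noteq> 0" for u
  proof -
    have "u $ 1 \<noteq> 0 \<or> u $ 2 \<noteq> 0 \<or> u $ 3 \<noteq> 0" using that by (simp add: vec_eq_iff forall_3)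
    then have "u $ 1 \<bullet> u $ 1 > 0 \<or> a * (u $ 2 \<bullet> u $ 2) > 0 \<or> a * (u $ 3 \<bullet> u $ 3) > 0"
      using a(1) by (auto simp: zero_less_mult_iff)
    moreover have "u $ 1 \<bullet> u $ 1 \<ge> 0" "a * (u $ 2 \<bullet> u $ 2) \<ge> 0" "a * (u $ 3 \<bullet> u $ 3) \<ge> 0" using a(1) by simp_all
    ultimately show ?thesis unfolding metric0_def hor_inner_def distrib_left by linarith
  qed
  have exp: "h (r *\<^sub>R x) u v = metric0 a u v + r\<^sup>2 * metric_remainder a r x u v" for r x u v
    unfolding h_def b_def by (rule twist_metric_expansion[OF a(1)])
  note jet = local_isometry_jet[where h = h and \<Phi> = "metric_remainder a" and S = V and F = F,
      OF bil sym pos exp isCont_metric_remainder V \<open>0 \<in> V\<close> CF F0 hiso,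
      folded A_def]
  have metric_A: "metric0 a (A u) (A v) = metric0 a u v" for u v by (rule jet(1))
  have sec_form_A: "sec_form (metric_remainder a 0) (A x) (A u) = sec_form (metric_remainder a 0) x u" for x u
    by (rule jet(2))
  have linA: "linear A" unfolding A_def
    using Ck_on_Suc_has_derivative[OF CF \<open>0 \<in> V\<close>] has_derivative_linear by blast
  \<comment> \<open>A map preserving a positive definite form is injective, so no inverse of \<phi>
    is needed to make A bijective.\<close>
  have "inj A"
    unfolding linear_injective_0[OF linA]
  proof (intro allI impI, rule ccontr)
    fix u assume "A u = 0" "u \<noteq> 0"
    then show False using metric_A[of u u] pos[of u] by (simp add: metric0_def hor_inner_def)
  qed
  then have surj: "surj A" using linear_injective_imp_surjective[OF linA] by simp
  \<comment> \<open>The same \<kappa> and \<mu> work for A x, with v replaced by A v; surjectivity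
    of A reaches all test directions.\<close>
  have rank: "rank_one_jacobi a (A x)" if x: "rank_one_jacobi a x" for x
  proof -
    obtain \<kappa> \<mu> v where P: "\<And>u. sec_form (metric_remainder a 0) x u =
       \<kappa> * (metric0 a x x * metric0 a u u - (metric0 a x u)\<^sup>2) + \<mu> * (metric0 a v u)\<^sup>2"
      using x unfolding rank_one_jacobi_def by blast
    have "sec_form (metric_remainder a 0) (A x) w =
       \<kappa> * (metric0 a (A x) (A x) * metric0 a w w - (metric0 a (A x) w)\<^sup>2) + \<mu> * (metric0 a (A v) w)\<^sup>2" for w
    proof -
      obtain u where u: "w = A u" using surj by (metis surjD)
      show ?thesis unfolding u metric_A sec_form_A by (rule P)
    qed
    then show ?thesis unfolding rank_one_jacobi_def by blast
  qed
  define u where "u = (vector [c, 0, 0] :: complex^3)"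
  have "rank_one_jacobi a u" by (rule rank_one_jacobi_vertical[OF a(1)]) (simp_all add: u_def)
  then have Au: "A u $ 2 = 0" "A u $ 3 = 0" using rank_one_jacobi_imp_vertical[OF a rank] by blast+
  have "dmap \<phi> (hopf q) (dhopf q (frame_lin q r u)) = dhopf q' (frame_lin q' r' (A u))"
    using dF[OF \<open>0 \<in> V\<close>, of u] by (simp add: F0 \<sigma>0 dtw0 A_def)
  moreover have "frame_lin q r u = c *s J q" by (simp add: frame_lin_def u_def)
  moreover have "frame_lin q' r' (A u) = A u $ 1 *s J q'" by (simp add: frame_lin_def Au)
  ultimately show ?thesis using that[of "A u $ 1"] by simp
qed

text \<open>The derivative of a local lift. With it the differential of \<phi> at one point becomes
  a real-linear map of \<complex>^4, and both directions of the result become linear algebra modulo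
  the complex lines of z and z'.\<close>

lemma dmap_linear_lift:
  assumes "smooth_map \<phi>" "z \<noteq> 0" "z' \<noteq> 0" "\<phi> (hopf z) = hopf z'"
  obtains L where "linear L" "\<And>v. dmap \<phi> (hopf z) (dhopf z v) = dhopf z' (L v)"
proof -
  obtain U \<tau> where U: "open U" "z \<in> U" "\<tau> z = z'" "\<And>k. Ck_on k U \<tau>"
    and lift: "\<And>y. y \<in> U \<Longrightarrow> y \<noteq> 0 \<and> \<tau> y \<noteq> 0 \<and> \<phi> (hopf y) = hopf (\<tau> y)"
    using local_lift[OF assms] by blast
  have d: "(\<tau> has_derivative frechet_derivative \<tau> (at z)) (at z)"
    by (rule Ck_on_Suc_has_derivative[OF U(4) U(2)])
  have "dmap \<phi> (hopf z) (dhopf z v) = dhopf z' (frechet_derivative \<tau> (at z) v)" for v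
    using dmap_dhopf[OF assms(1) U(1,2), of "\<lambda>y. y" \<tau>, OF _ _ _ has_derivative_ident d, of v] lift U(2,3) assms(3) by simp
  then show ?thesis using that has_derivative_linear[OF d] by blast
qed

section \<open>Linear algebra of the splitting at a single point\<close>

lemma metric_lift_decomposition:
  assumes "norm q = 1"
  shows "metric_lift a q u v = a * metric_lift 1 q u v + (1 - a) * Re (herm u (J q) * cnj (herm v (J q)))"
  using assms by (simp add: metric_lift_def)

text \<open>The parameter a drops out on the right: against a vector of D_1 only vertical components
  count, and on those all metrics of the family agree.\<close>

lemma metric_lift_vertical:
  assumes "norm q = 1"
  shows "metric_lift a q u (\<alpha> *s J q) = Re (herm u (J q) * cnj \<alpha>)"
proof -
  have "herm (J q) (J q) = 1" using assms herm_self[of q] by (simp add: herm_J_J)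
  then show ?thesis using assms by (simp add: metric_lift_def herm_simps algebra_simps)
qed

lemma metric_lift_cong:
  assumes "norm q = 1" "dhopf q u = dhopf q u'" "dhopf q v = dhopf q v'"
  shows "metric_lift a q u v = metric_lift a q u' v'"
  using assms metric_a_hopf_unit[OF assms(1)] by metis

text \<open>\<open>herm u (J q) *s J q\<close> represents the component of \<open>dhopf q u\<close> in \<open>dist1\<close>; both directions of the
  corollary amount to \<open>L\<close> commuting with this projection modulo the kernel of \<open>dhopf q'\<close>.\<close>

theorem corollary5p3:
  fixes a :: real and \<phi> :: "cp3 \<Rightarrow> cp3"
  assumes "a > 0" and "a \<noteq> 1"
  shows "isometry (metric_a a) \<phi> \<longleftrightarrow> isometry fubini_study \<phi> \<and> preserves_prod_struct \<phi>"
proof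
  assume iso: "isometry (metric_a a) \<phi>"
  then have \<phi>: "smooth_map \<phi>" by (simp add: isometry_def)
  have main: "fubini_study (\<phi> p) (dmap \<phi> p X) (dmap \<phi> p Y) = fubini_study p X Y \<and>
      dmap \<phi> p (prod_struct p X) = prod_struct (\<phi> p) (dmap \<phi> p X)"
    if XY: "X \<in> tangent_space p" "Y \<in> tangent_space p" for p X Y
  proof -
    obtain q where q: "norm q = 1" "hopf q = p" by (rule hopf_surj)
    obtain q' where q': "norm q' = 1" "hopf q' = \<phi> p" by (rule hopf_surj)
    have q0: "q \<noteq> 0" "q' \<noteq> 0" using q q' by auto
    have \<phi>q: "\<phi> (hopf q) = hopf q'" using q q' by simp
    obtain L where L: "linear L" "\<And>v. dmap \<phi> (hopf q) (dhopf q v) = dhopf q' (L v)"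
      by (rule dmap_linear_lift[OF \<phi> q0 \<phi>q]) blast
    have qq: "herm (J q) (J q) = 1" using q(1) herm_self[of q] by (simp add: herm_J_J)
    have qq': "herm (J q') (J q') = 1" using q'(1) herm_self[of q'] by (simp add: herm_J_J)
    have tan: "dhopf q u \<in> tangent_space (hopf q)" for u using tangent_space_hopf[OF q0(1)] by blast
    have G: "metric_lift a q' (L u) (L v) = metric_lift a q u v" for u v
      using iso tan L(2) metric_a_hopf_unit[OF q(1)] metric_a_hopf_unit[OF q'(1)] \<phi>q
      unfolding isometry_def by metis
    have "\<exists>\<alpha>. dhopf q' (L (c *s J q)) = dhopf q' (\<alpha> *s J q')" for c
      using isometry_preserves_dist1[OF assms iso q(1) q'(1) \<phi>q, of c] L(2) by metis
    then obtain \<alpha> where \<alpha>: "\<And>c. dhopf q' (L (c *s J q)) = dhopf q' (\<alpha> c *s J q')" by metis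
    \<comment> \<open>The lift of a D_1 vector is fixed only up to a multiple of q', which the
      product with \<open>J q'\<close> ignores; so \<alpha> is a function of L and inherits its
      linearity.\<close>
    have herm\<alpha>: "herm (L (c *s J q)) (J q') = \<alpha> c" for c
    proof -
      obtain d where "L (c *s J q) = \<alpha> c *s J q' + d *s q'" using \<alpha>[of c] dhopf_eq_iff[OF q0(2)] by blast
      then show ?thesis by (simp add: herm_simps qq')
    qed
    have G\<alpha>: "Re (herm (L u) (J q') * cnj (\<alpha> c)) = Re (herm u (J q) * cnj c)" for u c
      using G[of u "c *s J q"] metric_lift_cong[OF q'(1) refl \<alpha>[of c], of a "L u"]
      by (simp add: metric_lift_vertical[OF q(1)] metric_lift_vertical[OF q'(1)])
    have lin\<alpha>: "linear \<alpha>"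
    proof (rule linearI)
      have s: "(c + d) *s J q = c *s J q + d *s J q" "(t *\<^sub>R c) *s J q = t *\<^sub>R (c *s J q)" for c d and t :: real
        by (simp_all add: vec_eq_iff algebra_simps)
      show "\<alpha> (c + d) = \<alpha> c + \<alpha> d" "\<alpha> (t *\<^sub>R c) = t *\<^sub>R \<alpha> c" for c d t
        unfolding herm\<alpha>[symmetric] s linear_add[OF L(1)] linear_scale[OF L(1)]
        by (simp_all add: herm_simps scaleR_eq_smult scaleR_conv_of_real)
    qed
    have "inj \<alpha>" unfolding linear_injective_0[OF lin\<alpha>]
    proof (intro allI impI)
      fix c assume "\<alpha> c = 0"
      then have "Re (c * cnj c) = 0" using G\<alpha>[of "c *s J q" c] by (simp add: herm_simps qq)
      then show "c = 0" by (simp add: complex_eq_iff power2_eq_square[symmetric] sum_power2_eq_zero_iff)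
    qed
    then have surj: "surj \<alpha>" using linear_injective_imp_surjective[OF lin\<alpha>] by simp
    \<comment> \<open>\<open>?w\<close> represents the D_2 component of u. Its image is orthogonal
      to every \<alpha> c, and since \<alpha> is onto this makes it orthogonal to all of D_1: the
      complement is preserved too.\<close>
    have om: "herm (L u) (J q') = \<alpha> (herm u (J q))" for u
    proof -
      let ?w = "u - herm u (J q) *s J q"
      have "Re (herm (L ?w) (J q') * cnj (\<alpha> c)) = 0" for c
        unfolding G\<alpha> by (simp add: herm_simps qq)
      moreover obtain c where "herm (L ?w) (J q') = \<alpha> c" using surj by (metis surjD)
      ultimately have "Re (herm (L ?w) (J q') * cnj (herm (L ?w) (J q'))) = 0" by metis
      then have "herm (L ?w) (J q') = 0"
        by (simp add: complex_eq_iff power2_eq_square[symmetric] sum_power2_eq_zero_iff)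
      then show ?thesis
        unfolding linear_diff[OF L(1)] by (simp add: herm_simps herm\<alpha>)
    qed
    obtain u v where uv: "X = dhopf q u" "Y = dhopf q v" using XY tangent_space_hopf[OF q0(1)] q by auto
    have X': "dmap \<phi> p X = dhopf q' (L u)" "dmap \<phi> p Y = dhopf q' (L v)" using L(2) uv q by auto
    have "Re (herm (L u) (J q') * cnj (herm (L v) (J q'))) = Re (herm u (J q) * cnj (herm v (J q)))"
      unfolding om[of v] by (rule G\<alpha>)
    \<comment> \<open>The metric is a g_1 plus (1 - a) times the product of vertical components.
      Both it and this product are preserved, so a g_1 is, and a may be cancelled.\<close>
    then have "metric_lift 1 q' (L u) (L v) = metric_lift 1 q u v"
      using G[of u v] assms(1)
      unfolding metric_lift_decomposition[OF q(1), of a] metric_lift_decomposition[OF q'(1), of a] by simp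
    then have 1: "fubini_study (\<phi> p) (dmap \<phi> p X) (dmap \<phi> p Y) = fubini_study p X Y"
      unfolding X'
      unfolding uv q(2)[symmetric] q'(2)[symmetric] \<phi>q fubini_study_hopf[OF q(1)] fubini_study_hopf[OF q'(1)]
      using q(1) q'(1) by (simp add: metric_lift_def)
    have "dmap \<phi> p (prod_struct p X) = dhopf q' (L (u - (2 * herm u (J q)) *s J q))"
      using q L(2) uv prod_struct_hopf[OF q(1)] by metis
    also have "\<dots> = dhopf q' (L u) - dhopf q' (\<alpha> (2 * herm u (J q)) *s J q')"
      unfolding linear_diff[OF L(1)] linear_diff[OF linear_dhopf[OF q0(2)]] \<alpha> ..
    also have "\<alpha> (2 * herm u (J q)) = 2 * herm (L u) (J q')"
      using linear_scale[OF lin\<alpha>, of 2 "herm u (J q)"] by (simp add: om scaleR_conv_of_real)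
    also have "dhopf q' (L u) - dhopf q' ((2 * herm (L u) (J q')) *s J q') = prod_struct (\<phi> p) (dmap \<phi> p X)"
      unfolding X' q'(2)[symmetric] prod_struct_hopf[OF q'(1)] linear_diff[OF linear_dhopf[OF q0(2)]] ..
    finally show ?thesis using 1 by blast
  qed
  then show "isometry fubini_study \<phi> \<and> preserves_prod_struct \<phi>"
    using \<phi> unfolding isometry_def preserves_prod_struct_def by blast
next
  assume "isometry fubini_study \<phi> \<and> preserves_prod_struct \<phi>"
  then have \<phi>: "smooth_map \<phi>"
    and iso: "\<And>p X Y. X \<in> tangent_space p \<Longrightarrow> Y \<in> tangent_space p \<Longrightarrow>
      fubini_study (\<phi> p) (dmap \<phi> p X) (dmap \<phi> p Y) = fubini_study p X Y"
    and P: "\<And>p X. X \<in> tangent_space p \<Longrightarrow> dmap \<phi> p (prod_struct p X) = prod_struct (\<phi> p) (dmap \<phi> p X)"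
    by (auto simp: isometry_def preserves_prod_struct_def)
  have "metric_a a (\<phi> p) (dmap \<phi> p X) (dmap \<phi> p Y) = metric_a a p X Y"
    if XY: "X \<in> tangent_space p" "Y \<in> tangent_space p" for p X Y
  proof -
    obtain q where q: "norm q = 1" "hopf q = p" by (rule hopf_surj)
    obtain q' where q': "norm q' = 1" "hopf q' = \<phi> p" by (rule hopf_surj)
    have q0: "q \<noteq> 0" "q' \<noteq> 0" using q q' by auto
    have \<phi>q: "\<phi> (hopf q) = hopf q'" using q q' by simp
    obtain L where L: "linear L" "\<And>v. dmap \<phi> (hopf q) (dhopf q v) = dhopf q' (L v)"
      by (rule dmap_linear_lift[OF \<phi> q0 \<phi>q]) blast
    have qq: "herm (J q) (J q) = 1" using q(1) herm_self[of q] by (simp add: herm_J_J)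
    have qq': "herm (J q') (J q') = 1" using q'(1) herm_self[of q'] by (simp add: herm_J_J)
    have tan: "dhopf q u \<in> tangent_space (hopf q)" for u using tangent_space_hopf[OF q0(1)] by blast
    have G: "metric_lift 1 q' (L u) (L v) = metric_lift 1 q u v" for u v
      using iso[OF tan tan, of u v] q(1) q'(1)
      unfolding L(2) \<phi>q fubini_study_hopf[OF q(1)] fubini_study_hopf[OF q'(1)] by (simp add: metric_lift_def)
    let ?p = "\<lambda>u. herm u (J q) *s J q"
    let ?p' = "\<lambda>u. herm u (J q') *s J q'"
    have two: "(2 * c) *s w = 2 *\<^sub>R (c *s w)" for c and w :: "complex^4" by (simp add: scaleR_eq_smult)
    \<comment> \<open>\<open>prod_struct\<close> is the identity minus twice the projection to D_1;
      cancelling the identity leaves commutation with the projection.\<close>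
    have comm: "dhopf q' (L (?p u)) = dhopf q' (?p' (L u))" for u
    proof -
      have "dhopf q' (L (u - (2 * herm u (J q)) *s J q)) = dhopf q' (L u - (2 * herm (L u) (J q')) *s J q')"
        using P[OF tan, of u] unfolding prod_struct_hopf[OF q(1)] L(2) \<phi>q prod_struct_hopf[OF q'(1)] .
      then show ?thesis
        unfolding two linear_diff[OF L(1)] linear_scale[OF L(1)] linear_diff[OF linear_dhopf[OF q0(2)]]
          linear_scale[OF linear_dhopf[OF q0(2)]] by simp
    qed
    have pp: "metric_lift 1 q (herm u (J q) *s J q) (herm v (J q) *s J q) = Re (herm u (J q) * cnj (herm v (J q)))" if "norm q = 1" for q u v
      using that herm_self[of q] by (simp add: metric_lift_vertical[OF that] herm_simps herm_J_J)
    \<comment> \<open>Apply invariance of g_1 to the vertical components alone: by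
      \<open>comm\<close> their images are the vertical components of the images. The decomposition
      of the metric then gives its invariance for every a.\<close>
    have "Re (herm (L u) (J q') * cnj (herm (L v) (J q'))) = Re (herm u (J q) * cnj (herm v (J q)))" for u v
      using G[of "?p u" "?p v"] metric_lift_cong[OF q'(1) comm comm, of 1 u v]
      unfolding pp[OF q(1)] pp[OF q'(1)] by simp
    then have Ga: "metric_lift a q' (L u) (L v) = metric_lift a q u v" for u v
      unfolding metric_lift_decomposition[OF q(1), of a] metric_lift_decomposition[OF q'(1), of a] G by simp
    obtain u v where uv: "X = dhopf q u" "Y = dhopf q v" using XY tangent_space_hopf[OF q0(1)] q by auto
    show ?thesis
      using Ga[of u v] L(2) metric_a_hopf_unit[OF q(1)] metric_a_hopf_unit[OF q'(1)] q(2) q'(2) uv by simp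
  qed
  then show "isometry (metric_a a) \<phi>" using \<phi> unfolding isometry_def by blast
qed

end
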